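(* Let $G\subset\mathbb{C}$ be a bounded simply-connected domain whose boundary $\Gamma=\partial G$ is a Jordan curve, and let $b_n$ be the coefficient of $1/w^n$ in the Laurent expansion at infinity of the exterior conformal map $\Psi$. (i) Assume that $\Gamma$ is an analytic Jordan curve, and let $\rho<1$ be the smallest number for which $\Phi$ (extended analytically across $\Gamma$) is conformal in the exterior of the level curve $L_\rho=\{z:|\Phi(z)|=\rho\}$. Then there is a constant $c_{10}(\Gamma)\ge0$, depending only on $\Gamma$, such that for every $n\in\mathbb{N}$ $$|b_n|\le c_{10}(\Gamma)\,\frac{\rho^n}{\sqrt n}.$$ (ii) Assume that $\Gamma\in C(p+1,\alpha)$, where $p\ge 0$ is an integer, $0<\alpha<1$ and $p+\alpha>1/2$. Then there is a constant $c_{11}(\Gamma)\ge0$, depending only on $\Gamma$, such that for every $n\in\mathbb{N}$ $$|b_n|\le c_{11}(\Gamma)\,\frac{1}{n^{p+\alpha+1/2}}.$$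
   Context: $\mathbb{N}=\{1,2,\dots\}$. Let $\Omega=\overline{\mathbb{C}}\setminus\overline{G}$, $\Delta=\{w:|w|>1\}\cup\{\infty\}$, $\Phi:\Omega\to\Delta$ the conformal map with $\Phi(z)=\gamma z+\gamma_0+\gamma_1/z+\cdots$ near infinity, $\gamma>0$, and $\Psi=\Phi^{-1}:\Delta\to\Omega$, $\Psi(w)=bw+b_0+b_1/w+b_2/w^2+\cdots$ for $|w|>1$, $b=1/\gamma$. When $\Gamma$ is analytic, $\Phi$ has an analytic one-to-one continuation across $\Gamma$ inside $G$. For a positive integer $q$ and $0<\alpha<1$, $\Gamma\in C(q,\alpha)$ means that $\Gamma$ is given by $z=g(s)$, where $s$ is arclength, with $g^{(q)}\in\operatorname{Lip}\alpha$ (Hölder continuous with exponent $\alpha$). *)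

theory Defs
  imports "HOL-Complex_Analysis.Complex_Analysis"
begin

definition jordan_curve :: "complex set \<Rightarrow> bool" where
  "jordan_curve \<Gamma> \<longleftrightarrow>
     (\<exists>g. simple_path g \<and> pathfinish g = pathstart g \<and> path_image g = \<Gamma>)"

definition analytic_jordan_curve :: "complex set \<Rightarrow> bool" where
  "analytic_jordan_curve \<Gamma> \<longleftrightarrow>
     (\<exists>U f. open U \<and> sphere 0 1 \<subseteq> U \<and> f holomorphic_on U \<and> inj_on f U
        \<and> f ` sphere 0 1 = \<Gamma>)"

definition holder :: "real \<Rightarrow> (real \<Rightarrow> complex) \<Rightarrow> bool" where
  "holder \<alpha> f \<longleftrightarrow> (\<exists>M. \<forall>s t. norm (f s - f t) \<le> M * \<bar>s - t\<bar> powr \<alpha>)"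

text \<open>
  The class \<open>C(q,\<alpha>)\<close> of closed curves, for \<open>q \<ge> 1\<close>. The arclength parametrization \<open>g\<close> of a
  Jordan curve of length \<open>L\<close> is taken as an \<open>L\<close>-periodic function on the whole real line, so that
  the smoothness condition also applies at the point where the curve closes up. Since \<open>g\<close> is
  differentiable, arclength means unit speed. Here \<open>d k\<close> is the \<open>k\<close>-th derivative of \<open>g\<close>.
\<close>

definition curve_class :: "nat \<Rightarrow> real \<Rightarrow> complex set \<Rightarrow> bool" where
  "curve_class q \<alpha> \<Gamma> \<longleftrightarrow> q \<ge> 1 \<and>
     (\<exists>g L d. L > 0 \<and> (\<forall>s. g (s + L) = g s) \<and> inj_on g {0..<L} \<and> g ` {0..<L} = \<Gamma>
        \<and> d 0 = g
        \<and> (\<forall>k<q. \<forall>s. (d k has_vector_derivative d (Suc k) s) (at s))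
        \<and> (\<forall>s. norm (d 1 s) = 1)
        \<and> holder \<alpha> (d q))"

text \<open>\<open>f(w) = c w + a\<^sub>0 + a\<^sub>1/w + a\<^sub>2/w\<^sup>2 + \<dots>\<close> for \<open>\<bar>w\<bar> > R\<close>\<close>

definition laurent_at_infinity ::
  "(complex \<Rightarrow> complex) \<Rightarrow> real \<Rightarrow> complex \<Rightarrow> (nat \<Rightarrow> complex) \<Rightarrow> bool" where
  "laurent_at_infinity f R c a \<longleftrightarrow>
     (\<forall>w. norm w > R \<longrightarrow> (\<lambda>n. a n / w ^ n) sums (f w - c * w))"

text \<open>
  The conformal map \<open>\<Phi>\<close> from the exterior of \<open>G\<close> onto the exterior of the unit disc. Both domains
  contain the point at infinity, which is left implicit: \<open>\<Phi>\<close> is given on the finite points, and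
  \<open>\<Phi>(\<infinity>) = \<infinity>\<close> with \<open>\<Phi>'(\<infinity>) = \<gamma> > 0\<close> is expressed by the Laurent expansion near infinity.
\<close>

definition exterior_map :: "complex set \<Rightarrow> (complex \<Rightarrow> complex) \<Rightarrow> real \<Rightarrow> bool" where
  "exterior_map G \<Phi> \<gamma> \<longleftrightarrow>
     \<Phi> holomorphic_on (- closure G)
     \<and> bij_betw \<Phi> (- closure G) {w. norm w > 1}
     \<and> \<gamma> > 0 \<and> (\<exists>R a. laurent_at_infinity \<Phi> R (of_real \<gamma>) a)"

text \<open>\<open>b n\<close> is the coefficient of \<open>1/w\<^sup>n\<close> in the expansion of the inverse map
  \<open>\<Psi> = \<Phi>\<inverse>\<close>, whose leading coefficient is \<open>1/\<gamma>\<close>.\<close>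

definition exterior_inverse_coeffs ::
  "complex set \<Rightarrow> (complex \<Rightarrow> complex) \<Rightarrow> real \<Rightarrow> (nat \<Rightarrow> complex) \<Rightarrow> bool" where
  "exterior_inverse_coeffs G \<Phi> \<gamma> b \<longleftrightarrow>
     laurent_at_infinity (the_inv_into (- closure G) \<Phi>) 1 (of_real (1 / \<gamma>)) b"

text \<open>
  \<open>\<Phi>\<close>, continued analytically across the boundary of \<open>G\<close>, is conformal in the exterior of the level
  curve \<open>L\<^sub>r = {z. \<bar>\<Phi>(z)\<bar> = r}\<close>. Here \<open>F\<close> is the continuation and \<open>D\<close> is the (finite part of the)
  exterior of \<open>L\<^sub>r\<close>, that is, the domain that the continuation maps onto \<open>\<bar>w\<bar> > r\<close>. The continuation
  need not be defined on \<open>L\<^sub>r\<close> itself: for an ellipse and the smallest possible \<open>r\<close>,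
  \<open>D\<close> is the complement of the segment between the foci. For a circle the smallest \<open>r\<close> is 0.
\<close>

definition conformal_outside_level ::
  "complex set \<Rightarrow> (complex \<Rightarrow> complex) \<Rightarrow> real \<Rightarrow> bool" where
  "conformal_outside_level G \<Phi> r \<longleftrightarrow> 0 \<le> r \<and>
     (\<exists>D F. open D \<and> - G \<subseteq> D \<and> F holomorphic_on D \<and> inj_on F D
        \<and> F ` D = {w. norm w > r} \<and> (\<forall>z\<in>- closure G. F z = \<Phi> z))"

definition smallest_conformal_level ::
  "complex set \<Rightarrow> (complex \<Rightarrow> complex) \<Rightarrow> real \<Rightarrow> bool" where
  "smallest_conformal_level G \<Phi> \<rho> \<longleftrightarrow>
     conformal_outside_level G \<Phi> \<rho> \<and> (\<forall>r. conformal_outside_level G \<Phi> r \<longrightarrow> \<rho> \<le> r)"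

end

theory Submission
  imports Defs
begin

text \<open>
  Put \<open>H \<zeta> = \<Psi> (exp \<zeta>)\<close>. As \<open>\<Psi>\<close> is univalent, the Dirichlet integral of \<open>H\<close> over a period strip is at most
  an area.

  For an analytic curve, \<open>H\<close> extends to \<open>Re \<zeta> > ln \<rho>\<close>, and \<open>- n b\<^sub>n\<close> is, up to the factor \<open>exp (n x)\<close>, a Fourier
  coefficient of \<open>H'\<close> on every line \<open>Re \<zeta> = x\<close>. The Cauchy-Schwarz inequality, integrated over \<open>ln r < x < 0\<close>, gives
  \<open>\<pi> n \<bar>b\<^sub>n\<bar>\<^sup>2 (r\<^sup>-\<^sup>2\<^sup>n - 1) \<le> area\<close>, and \<open>r\<close> tends to \<open>\<rho>\<close>.

  For a curve in \<open>C(p+1,\<alpha>)\<close> no boundary regularity of \<open>\<Psi>\<close> is needed. The function \<open>cnj z\<close> on the curve has an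
  extension \<open>S\<close> whose \<open>cnj z\<close>-derivative is of order \<open>d\<close> to the power \<open>p + \<alpha>\<close>, where \<open>d\<close> is the distance to the
  curve. The conjugate of \<open>b\<^sub>n\<close> is the limit for \<open>x \<rightarrow> 0\<close> of a Fourier coefficient of \<open>S \<circ> H\<close>, and the dependence of
  that coefficient on \<open>x\<close> involves only this derivative. A Hopf lemma for \<open>C(1,1/2)\<close> curves bounds \<open>d\<close> by a
  multiple of \<open>x\<close>, and the Dirichlet integral controls the remaining factor \<open>\<bar>H'\<bar>\<close>.
\<close>

section \<open>The Dirichlet integral of a univalent function\<close>

unbundle no fps_syntax

text \<open>The 1/2 in the exponent of (ii) is an L2 gain. Write \<beta> = p + \<alpha>. On Re z = x
  the conjugate of exp (n z) is exp (2 n x) exp (- n z), so the conjugate of b_n becomes a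
  coefficient against a decaying exponential. Moving the line from x to a fixed x0 costs at most a
  multiple of the double integral of x^\<beta> |H'| exp (- n x). The square integral of x^\<beta>
  exp (- n x) has order n^(- 2 \<beta> - 1) and that of |H'| is at most an area; the product of the
  roots is n^(- \<beta> - 1/2). On the line x0 itself the coefficient is exponentially small. The
  factor x^\<beta> requires H (x + i t) to lie within O(x) of the curve. With a half-Hoelder
  tangent, which p + \<alpha> > 1/2 supplies, the exterior need not contain tangent discs of a fixed
  size, so the comparison domain is a bent disc. A curve of finite smoothness need not have a
  Schwarz function, that is, a holomorphic function equal to cnj z on it. Averaged Taylor
  polynomials along the curve replace it. Both constants must serve every admissible
  \<open>\<Phi>\<close>, hence the uniqueness of the exterior map.\<close>

text \<open>A bridge between three models of the plane: the Jacobian formula is applied on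
  \<open>real^2\<close>, Fubini on \<open>real \<times> real\<close>, and the integrand lives on
  \<open>complex\<close>.\<close>

lemma integral_vec2_eq_iterated:
  fixes f :: "complex \<Rightarrow> real"
  assumes cont: "continuous_on (cbox (Complex x0 y0) (Complex x1 y1)) f"
  defines "p \<equiv> (\<lambda>v::real^2. Complex (v$1) (v$2))"
  defines "B \<equiv> cbox (vector [x0, y0] :: real^2) (vector [x1, y1])"
  shows "(\<lambda>v. f (p v)) integrable_on B"
    and "integral B (\<lambda>v. f (p v)) =
         integral {x0..x1} (\<lambda>x. integral {y0..y1} (\<lambda>y. f (Complex x y)))"
proof -
  define k where "k = (\<lambda>v::real^2. (v$1, v$2))"
  define q where "q = (\<lambda>w::real\<times>real. vector [fst w, snd w] :: real^2)"
  have kq: "k (q w) = w" and qk: "q (k v) = v" for w v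
    by (auto simp: k_def q_def vec_eq_iff forall_2)
  have contk: "continuous (at v) k" for v
    unfolding k_def by (intro continuous_intros)
  have mem: "v \<in> cbox a b \<longleftrightarrow> a$1 \<le> v$1 \<and> v$1 \<le> b$1 \<and> a$2 \<le> v$2 \<and> v$2 \<le> b$2" for a b v :: "real^2"
    by (auto simp: mem_box_cart forall_2)
  have kim: "k ` cbox u v = cbox (u$1, u$2) (v$1, v$2)" for u v
  proof (rule set_eqI, rule iffI)
    fix w assume "w \<in> cbox (u$1, u$2) (v$1, v$2)"
    then have "q w \<in> cbox u v" by (cases w) (auto simp: mem q_def)
    then show "w \<in> k ` cbox u v" using kq by (metis image_eqI)
  qed (auto simp: mem k_def)
  have qim: "q ` cbox u v = cbox (q u) (q v)" for u v
  proof (rule set_eqI, rule iffI)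
    fix w assume "w \<in> cbox (q u) (q v)"
    then have "k w \<in> cbox u v" by (cases u; cases v) (auto simp: mem q_def k_def)
    then show "w \<in> q ` cbox u v" using qk by (metis image_eqI)
  qed (cases u; cases v; auto simp: mem q_def cbox_Pair_eq)
  \<comment> \<open>The coordinate change carries boxes to boxes of the same content, so the
    substitution rule applies with factor 1.\<close>
  have cont_k: "measure lborel (k ` cbox u v) = 1 * measure lborel (cbox u v)" for u v
  proof (cases "u$1 \<le> v$1 \<and> u$2 \<le> v$2")
    case True
    then have "measure lborel (cbox u v) = (v$1 - u$1) * (v$2 - u$2)"
      by (subst content_cbox_cart) (auto simp: interval_ne_empty_cart forall_2 UNIV_2 box_ne_empty)
    then show ?thesis unfolding kim using True by (simp add: content_Pair)
  next
    case False
    then have "cbox u v = {}" by (auto simp: mem set_eq_iff intro: order_trans)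
    then show ?thesis by simp
  qed
  let ?g = "\<lambda>w::real\<times>real. f (Complex (fst w) (snd w))"
  have c: "continuous_on (cbox (x0,y0) (x1,y1)) ?g"
    by (rule continuous_on_compose2[OF cont])
       (auto intro!: continuous_intros simp: Complex_eq in_cbox_complex_iff cbox_Pair_eq)
  then have "(?g has_integral integral (cbox (x0,y0) (x1,y1)) ?g) (cbox (x0,y0) (x1,y1))"
    by (simp add: integrable_continuous integrable_integral)
  from has_integral_twiddle[OF _ qk kq contk _ _ cont_k this]
  have "((\<lambda>v. ?g (k v)) has_integral integral (cbox (x0,y0) (x1,y1)) ?g) (q ` cbox (x0,y0) (x1,y1))"
    using kim qim by auto
  moreover have "q ` cbox (x0,y0) (x1,y1) = B"
    unfolding qim by (simp add: q_def B_def)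
  ultimately have I: "((\<lambda>v. f (p v)) has_integral integral (cbox (x0,y0) (x1,y1)) ?g) B"
    by (simp add: k_def p_def)
  then show "(\<lambda>v. f (p v)) integrable_on B" by blast
  show "integral B (\<lambda>v. f (p v)) =
         integral {x0..x1} (\<lambda>x. integral {y0..y1} (\<lambda>y. f (Complex x y)))"
    using integral_unique[OF I] integral_prod_continuous[OF c] by simp
qed

text \<open>By the Cauchy-Riemann equations the real Jacobian of \<open>h\<close> is |h'|^2, so the
  integral is the area of an injective image, which lies in a square of side 2 R. Injectivity is
  asked for on the open box only, since \<open>exp\<close> identifies the two long sides of a period
  strip.\<close>

lemma iterated_integral_norm_deriv_le:
  assumes U: "open U" and h: "h holomorphic_on U"
    and sub: "cbox (Complex x0 y0) (Complex x1 y1) \<subseteq> U"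
    and inj: "inj_on h (box (Complex x0 y0) (Complex x1 y1))"
    and bd: "\<And>z. z \<in> box (Complex x0 y0) (Complex x1 y1) \<Longrightarrow> norm (h z) \<le> R"
    and R: "R \<ge> 0"
  shows "integral {x0..x1} (\<lambda>x. integral {y0..y1} (\<lambda>y. (norm (deriv h (Complex x y)))\<^sup>2)) \<le> 4 * R\<^sup>2"
proof -
  define p where "p = (\<lambda>v::real^2. Complex (v$1) (v$2))"
  define q where "q = (\<lambda>z. vector [Re z, Im z] :: real^2)"
  define B where "B = cbox (vector [x0, y0] :: real^2) (vector [x1, y1])"
  define B' where "B' = box (vector [x0, y0] :: real^2) (vector [x1, y1])"
  define F where "F = (\<lambda>v. q (h (p v)))"
  define F' where "F' = (\<lambda>v u. q (deriv h (p v) * p u))"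
  have bl_p: "bounded_linear p"
  proof -
    have "p = (\<lambda>v. of_real (v$1) + \<i> * of_real (v$2))" by (auto simp: p_def Complex_eq)
    then show ?thesis
      by (auto intro!: bounded_linear_add bounded_linear_mult_const bounded_linear_const_mult
            bounded_linear_compose[OF bounded_linear_of_real] bounded_linear_vec_nth)
  qed
  have lin_q: "linear q"
    by (rule linearI) (auto simp: q_def vec_eq_iff forall_2)
  then have bl_q: "bounded_linear q" by (rule linear_linear[THEN iffD2, rotated] linear_conv_bounded_linear[THEN iffD1])
  have pB': "p v \<in> box (Complex x0 y0) (Complex x1 y1) \<longleftrightarrow> v \<in> B'" for v
    by (auto simp: p_def B'_def mem_box_cart forall_2 in_box_complex_iff)
  have pU: "p v \<in> U" if "v \<in> B'" for v
    using that pB' sub box_subset_cbox by blast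
  have der: "(F has_derivative F' v) (at v within B')" if "v \<in> B'" for v
  proof -
    have "(h has_derivative (*) (deriv h (p v))) (at (p v))"
      using holomorphic_derivI[OF h U pU[OF that]] by (simp add: has_field_derivative_def)
    from has_derivative_compose[OF bounded_linear_imp_has_derivative[OF bl_p] this]
    have "((\<lambda>v. h (p v)) has_derivative (\<lambda>u. deriv h (p v) * p u)) (at v within B')"
      by (simp add: has_derivative_at_withinI)
    then show ?thesis unfolding F_def F'_def
      by (rule bounded_linear.has_derivative[OF bl_q])
  qed
  have injF: "inj_on F B'"
  proof (rule inj_onI)
    fix u v assume uv: "u \<in> B'" "v \<in> B'" "F u = F v"
    then have "h (p u) = h (p v)"
      unfolding F_def q_def by (metis complex_eqI vector_2)
    then have "p u = p v" using inj uv pB' by (auto dest: inj_onD)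
    then show "u = v" by (auto simp: p_def vec_eq_iff forall_2)
  qed
  have det: "\<bar>det (matrix (F' v))\<bar> = (norm (deriv h (p v)))\<^sup>2" for v
    unfolding det_2 matrix_def cmod_power2
    by (simp add: F'_def q_def p_def axis_def power2_eq_square)
  have cont: "continuous_on (cbox (Complex x0 y0) (Complex x1 y1)) (\<lambda>z. (norm (deriv h z))\<^sup>2)"
    using holomorphic_on_imp_continuous_on[OF holomorphic_deriv[OF h U]] sub
    by (intro continuous_intros) (auto intro: continuous_on_subset)
  have int: "(\<lambda>v. (norm (deriv h (p v)))\<^sup>2) integrable_on B"
    and eq: "integral B (\<lambda>v. (norm (deriv h (p v)))\<^sup>2) = integral {x0..x1} (\<lambda>x. integral {y0..y1} (\<lambda>y. (norm (deriv h (Complex x y)))\<^sup>2))"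
    using integral_vec2_eq_iterated[OF cont] by (simp_all add: p_def B_def)
  have meas: "(F ` B') \<in> lmeasurable \<and> measure lebesgue (F ` B') = integral B' (\<lambda>v. (norm (deriv h (p v)))\<^sup>2)"
  proof -
    have i: "(\<lambda>v. \<bar>det (matrix (F' v))\<bar>) integrable_on B'"
      unfolding det B'_def using int[unfolded B_def] by (simp add: integrable_on_open_interval)
    have s: "B' \<in> sets lebesgue" by (simp add: B'_def)
    show ?thesis
      using measurable_differentiable_image_eq[OF s der injF] measure_differentiable_image_eq[OF s der injF] i det
      by simp
  qed
  have "F ` B' \<subseteq> cbox (vector [-R, -R]) (vector [R, R])"
  proof
    fix w assume "w \<in> F ` B'"
    then obtain v where v: "v \<in> B'" "w = F v" by auto
    have "norm (h (p v)) \<le> R" using bd pB' v by auto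
    then have "\<bar>Re (h (p v))\<bar> \<le> R" "\<bar>Im (h (p v))\<bar> \<le> R"
      using abs_Re_le_cmod abs_Im_le_cmod order_trans by blast+
    then show "w \<in> cbox (vector [-R, -R]) (vector [R, R])"
      by (auto simp: v mem_box_cart forall_2 F_def q_def)
  qed
  then have "measure lebesgue (F ` B') \<le> measure lebesgue (cbox (vector [-R, -R]) (vector [R, R]) :: (real^2) set)"
    using meas by (intro measure_mono_fmeasurable) (auto simp: fmeasurableD)
  also have "\<dots> = measure lborel (cbox (vector [-R, -R]) (vector [R, R]) :: (real^2) set)"
    by simp
  also have "\<dots> = 4 * R\<^sup>2"
    using R by (subst content_cbox_cart) (auto simp: interval_ne_empty_cart forall_2 UNIV_2 box_ne_empty power2_eq_square)
  finally show ?thesis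
    using meas eq by (simp add: B'_def B_def integral_open_interval)
qed

section \<open>Means over a period\<close>

text \<open>With the Wirtinger derivatives a and b, the x-derivative of V is a + b and its
  t-derivative is \<i> (a - b). The latter integrates to 0 over a period, so a and b have the same
  mean. For holomorphic V the mean is therefore constant in x; in general only the cnj z-derivative
  moves it.\<close>

lemma periodic_mean_has_vector_derivative:
  fixes V a b :: "complex \<Rightarrow> complex" and T :: real
  assumes V: "\<And>z. x0 < Re z \<Longrightarrow> Re z < x1 \<Longrightarrow> (V has_derivative (\<lambda>h. a z * h + b z * cnj h)) (at z)"
    and a: "continuous_on {z. x0 < Re z \<and> Re z < x1} a"
    and b: "continuous_on {z. x0 < Re z \<and> Re z < x1} b"
    and per: "\<And>x. x0 < x \<Longrightarrow> x < x1 \<Longrightarrow> V (Complex x T) = V (Complex x 0)"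
    and T: "0 \<le> T" and x: "x0 < x" "x < x1"
  shows "((\<lambda>x. integral {0..T} (\<lambda>t. V (Complex x t))) has_vector_derivative
          2 * integral {0..T} (\<lambda>t. b (Complex x t))) (at x)"
proof -
  have ca: "continuous_on ({x0<..<x1} \<times> cbox 0 T) (\<lambda>(x, t). a (Complex x t))"
    and cb: "continuous_on ({x0<..<x1} \<times> cbox 0 T) (\<lambda>(x, t). b (Complex x t))"
    unfolding split_def
    by (auto intro!: continuous_on_compose2[OF a] continuous_on_compose2[OF b] continuous_intros simp: Complex_eq)
  have dx: "((\<lambda>x. V (Complex x t)) has_vector_derivative (a (Complex x t) + b (Complex x t))) (at x)"
    if "x0 < x" "x < x1" for x t
  proof -
    have "((\<lambda>x. Complex x t) has_derivative (\<lambda>h. of_real h)) (at x)"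
      unfolding Complex_eq by (auto intro!: derivative_eq_intros)
    from has_derivative_compose[OF this V] that show ?thesis
      by (simp add: has_vector_derivative_def scaleR_conv_of_real algebra_simps)
  qed
  have dt: "((\<lambda>t. V (Complex x t)) has_vector_derivative \<i> * (a (Complex x t) - b (Complex x t))) (at t)" for t
  proof -
    have "((\<lambda>t. Complex x t) has_derivative (\<lambda>h. \<i> * of_real h)) (at t)"
      unfolding Complex_eq by (auto intro!: derivative_eq_intros)
    from has_derivative_compose[OF this V] x show ?thesis
      by (simp add: has_vector_derivative_def scaleR_conv_of_real algebra_simps)
  qed
  have cV: "continuous_on {0..T} (\<lambda>t. V (Complex x t))" if "x0 < x" "x < x1" for x
  proof -
    have "continuous_on {z. x0 < Re z \<and> Re z < x1} V"
      by (intro continuous_at_imp_continuous_on ballI has_derivative_continuous[OF V]) auto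
    then show ?thesis
      by (rule continuous_on_compose2) (use that in \<open>auto intro!: continuous_intros simp: Complex_eq\<close>)
  qed
  have ix: "(\<lambda>t. a (Complex x t)) integrable_on {0..T}" "(\<lambda>t. b (Complex x t)) integrable_on {0..T}"
    using x by (auto intro!: integrable_continuous_real continuous_on_compose2[OF a] continuous_on_compose2[OF b] continuous_intros simp: Complex_eq)
  have "((\<lambda>x. integral (cbox 0 T) (\<lambda>t. V (Complex x t))) has_vector_derivative
      integral (cbox 0 T) (\<lambda>t. a (Complex x t) + b (Complex x t))) (at x within {x0<..<x1})"
  proof (rule leibniz_rule_vector_derivative)
    show "continuous_on ({x0<..<x1} \<times> cbox 0 T) (\<lambda>(x, t). a (Complex x t) + b (Complex x t))"
      using continuous_on_add[OF ca cb] by (simp add: split_def)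
  qed (use x cV dx in \<open>auto intro: has_vector_derivative_at_within integrable_continuous_real\<close>)
  then have 1: "((\<lambda>x. integral {0..T} (\<lambda>t. V (Complex x t))) has_vector_derivative
      integral {0..T} (\<lambda>t. a (Complex x t) + b (Complex x t))) (at x)"
    using x by (simp add: at_within_open[of x "{x0<..<x1}"])
  have "((\<lambda>t. \<i> * (a (Complex x t) - b (Complex x t))) has_integral (V (Complex x T) - V (Complex x 0))) {0..T}"
    by (rule fundamental_theorem_of_calculus[OF T]) (use dt has_vector_derivative_at_within in blast)
  from integral_unique[OF this]
  have "integral {0..T} (\<lambda>t. \<i> * (a (Complex x t) - b (Complex x t))) = 0"
    unfolding per[OF x] diff_self .
  then have "integral {0..T} (\<lambda>t. a (Complex x t)) = integral {0..T} (\<lambda>t. b (Complex x t))"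
    using ix by (simp add: integral_diff)
  then show ?thesis using 1 ix by (simp add: integral_add)
qed

text \<open>Cauchy-Schwarz against the constant 1, from the pointwise inequality 2 c |f| <= c^2 / (b
  - a) + (b - a) |f|^2 with c the norm of the integral.\<close>

lemma norm_integral_square_le:
  fixes f :: "real \<Rightarrow> complex"
  assumes f: "continuous_on {a..b} f" and ab: "a \<le> b"
  shows "(norm (integral {a..b} f))\<^sup>2 \<le> (b - a) * integral {a..b} (\<lambda>t. (norm (f t))\<^sup>2)"
proof -
  define c where "c = norm (integral {a..b} f)"
  have i2: "(\<lambda>t. (norm (f t))\<^sup>2) integrable_on {a..b}" and i1: "(\<lambda>t. norm (f t)) integrable_on {a..b}"
    using f by (auto intro!: integrable_continuous_real continuous_intros)
  have c1: "c \<le> integral {a..b} (\<lambda>t. norm (f t))"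
    unfolding c_def by (rule integral_norm_bound_integral) (use f i1 in \<open>auto intro: integrable_continuous_real\<close>)
  have "2 * c * integral {a..b} (\<lambda>t. norm (f t)) \<le> integral {a..b} (\<lambda>t. c\<^sup>2 / (b - a) + (b - a) * (norm (f t))\<^sup>2)" if "a < b"
  proof -
    have "integral {a..b} (\<lambda>t. 2 * c * norm (f t)) \<le> integral {a..b} (\<lambda>t. c\<^sup>2 / (b - a) + (b - a) * (norm (f t))\<^sup>2)"
    proof (rule integral_le)
      show "(\<lambda>t. c\<^sup>2 / (b - a) + (b - a) * (norm (f t))\<^sup>2) integrable_on {a..b}"
        using i2 by (intro integrable_add integrable_const_ivl integrable_on_mult_right)
      fix t
      have "0 \<le> (c - (b - a) * norm (f t))\<^sup>2 / (b - a)" using that by simp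
      then show "2 * c * norm (f t) \<le> c\<^sup>2 / (b - a) + (b - a) * (norm (f t))\<^sup>2"
        using that by (simp add: power2_eq_square field_simps)
    qed (intro integrable_on_mult_right i1)
    then show ?thesis by simp
  qed
  moreover have "integral {a..b} (\<lambda>t. c\<^sup>2 / (b - a) + (b - a) * (norm (f t))\<^sup>2) = c\<^sup>2 + (b - a) * integral {a..b} (\<lambda>t. (norm (f t))\<^sup>2)" if "a < b"
    using that i2 by (subst integral_add) (auto intro!: integrable_on_cmult_left)
  moreover have "c\<^sup>2 \<le> c * integral {a..b} (\<lambda>t. norm (f t))"
    using c1 unfolding power2_eq_square by (intro mult_left_mono) (auto simp: c_def)
  ultimately have "c\<^sup>2 \<le> (b - a) * integral {a..b} (\<lambda>t. (norm (f t))\<^sup>2)" if "a < b"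
    using that by linarith
  then show ?thesis
    using ab by (cases "a = b") (auto simp: c_def)
qed

section \<open>The exterior map\<close>

lemma integral_exp_period:
  "integral {0..2 * pi} (\<lambda>t. exp (of_int m * Complex x t)) = (if m = 0 then of_real (2 * pi) else 0)"
proof (cases "m = 0")
  case False
  have e: "exp (of_int m * Complex x (2 * pi)) = exp (of_int m * Complex x 0)"
    by (subst exp_eq) (auto intro!: exI[of _ m] simp: Complex_eq algebra_simps)
  have "((\<lambda>t. exp (of_int m * Complex x t)) has_integral
     (exp (of_int m * Complex x (2 * pi)) / (\<i> * of_int m) - exp (of_int m * Complex x 0) / (\<i> * of_int m))) {0..2 * pi}"
  proof (rule fundamental_theorem_of_calculus)
    fix t
    have "((\<lambda>z. exp (of_int m * (of_real x + \<i> * z)) / (\<i> * of_int m)) has_field_derivative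
        exp (of_int m * (of_real x + \<i> * of_real t))) (at (of_real t))"
      using False by (auto intro!: derivative_eq_intros simp: field_simps)
    from has_vector_derivative_real_field[OF this]
    show "((\<lambda>t. exp (of_int m * Complex x t) / (\<i> * of_int m)) has_vector_derivative
        exp (of_int m * Complex x t)) (at t within {0..2 * pi})"
      by (simp add: Complex_eq)
  qed simp
  from integral_unique[OF this] show ?thesis unfolding e using False by simp
qed (simp add: scaleR_conv_of_real)

text \<open>Termwise integration over a circle of radius exp x: after multiplication by exp (n z)
  only the term k = n has frequency 0, and the linear term c w has frequency n + 1.\<close>

lemma laurent_coeff_integral:
  fixes a :: "nat \<Rightarrow> complex"
  assumes f: "laurent_at_infinity f R c a" and x: "exp x > R" and n: "n \<ge> 1"
  shows "integral {0..2 * pi} (\<lambda>t. f (exp (Complex x t)) * exp (of_nat n * Complex x t)) = 2 * pi * a n"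
proof -
  \<comment> \<open>The expansion is given as pointwise convergence. Convergence at the smaller
    radius exp y yields the absolute convergence at exp x that the uniform limit needs.\<close>
  obtain y where y: "y < x" "R < exp y"
  proof (cases "R \<le> 0")
    case True
    then show ?thesis using that[of "x - 1"] by (auto intro: le_less_trans[OF _ exp_gt_zero])
  next
    case False
    then have "ln R < x" using x ln_less_cancel_iff[of R "exp x"] by simp
    then obtain y where "ln R < y" "y < x" using dense by blast
    then show ?thesis using that[of y] False exp_less_cancel_iff[of "ln R" y] by simp
  qed
  define F where "F = (\<lambda>N t. c * exp (of_int (int n + 1) * Complex x t)
    + (\<Sum>k<N. a k * exp (of_int (int n - int k) * Complex x t)))"
  have "(\<lambda>k. a k / of_real (exp y) ^ k) sums (f (of_real (exp y)) - c * of_real (exp y))"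
    using f y by (auto simp: laurent_at_infinity_def)
  then have "summable (\<lambda>k. a k * (of_real (exp (- y))) ^ k)"
    by (auto simp: sums_iff exp_minus field_simps power_inverse)
  then have "summable (\<lambda>k. norm (a k * of_real (exp (- x)) ^ k))"
    by (rule powser_insidea) (use y in auto)
  then have sM: "summable (\<lambda>k. norm (a k) * exp (- x) ^ k * exp (real n * x))"
    by (intro summable_mult2) (simp add: norm_mult norm_power)
  have E: "a k * exp (of_int (int n - int k) * Complex x t) = a k / exp (Complex x t) ^ k * exp (of_nat n * Complex x t)" for k t
    by (simp add: exp_of_nat_mult[symmetric] exp_diff algebra_simps)
  have ul: "uniform_limit {0..2 * pi} (\<lambda>N t. \<Sum>k<N. a k * exp (of_int (int n - int k) * Complex x t))
     (\<lambda>t. \<Sum>k. a k * exp (of_int (int n - int k) * Complex x t)) sequentially"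
  proof (rule Weierstrass_m_test[OF _ sM])
    fix k t
    have "norm (exp (of_int (int n - int k) * Complex x t)) = exp (- x) ^ k * exp (real n * x)"
      by (simp add: exp_of_nat_mult[symmetric] exp_add[symmetric] algebra_simps)
    then show "norm (a k * exp (of_int (int n - int k) * Complex x t)) \<le> norm (a k) * exp (- x) ^ k * exp (real n * x)"
      by (simp add: norm_mult)
  qed
  have suminf: "(\<Sum>k. a k * exp (of_int (int n - int k) * Complex x t))
      = (f (exp (Complex x t)) - c * exp (Complex x t)) * exp (of_nat n * Complex x t)" for t
  proof -
    have "(\<lambda>k. a k / exp (Complex x t) ^ k) sums (f (exp (Complex x t)) - c * exp (Complex x t))"
      using f x by (auto simp: laurent_at_infinity_def)
    from sums_mult2[OF this, of "exp (of_nat n * Complex x t)"]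
    show ?thesis unfolding E by (simp add: sums_iff)
  qed
  have "uniform_limit {0..2 * pi} F (\<lambda>t. f (exp (Complex x t)) * exp (of_nat n * Complex x t)) sequentially"
  proof -
    have "uniform_limit {0..2 * pi} F (\<lambda>t. c * exp (of_int (int n + 1) * Complex x t) + (\<Sum>k. a k * exp (of_int (int n - int k) * Complex x t))) sequentially"
      unfolding F_def by (intro uniform_limit_add[OF uniform_limit_const ul])
    moreover have "c * exp (of_int (int n + 1) * Complex x t) + (\<Sum>k. a k * exp (of_int (int n - int k) * Complex x t))
        = f (exp (Complex x t)) * exp (of_nat n * Complex x t)" for t
      unfolding suminf by (simp add: exp_add algebra_simps)
    ultimately show ?thesis by simp
  qed
  then obtain I J where IJ: "\<And>N. (F N has_integral I N) {0..2 * pi}"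
    "((\<lambda>t. f (exp (Complex x t)) * exp (of_nat n * Complex x t)) has_integral J) {0..2 * pi}" "I \<longlonglongrightarrow> J"
    by (rule uniform_limit_integral) (auto simp: F_def Complex_eq intro!: continuous_intros)
  have int: "((\<lambda>t. exp (of_int m * Complex x t)) has_integral (if m = 0 then of_real (2 * pi) else 0)) {0..2 * pi}" for m
    unfolding integral_exp_period[of m x, symmetric]
    unfolding Complex_eq by (intro integrable_integral integrable_continuous_real continuous_intros)
  have "I N = 2 * pi * a n" if "N > n" for N
  proof -
    have "(F N has_integral c * (if int n + 1 = 0 then of_real (2 * pi) else 0)
       + (\<Sum>k<N. a k * (if int n - int k = 0 then of_real (2 * pi) else 0))) {0..2 * pi}"
      unfolding F_def by (intro has_integral_add has_integral_mult_right has_integral_sum int finite_lessThan)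
    with IJ(1) have "I N = c * (if int n + 1 = 0 then of_real (2 * pi) else 0)
       + (\<Sum>k<N. a k * (if int n - int k = 0 then of_real (2 * pi) else 0))"
      by (rule has_integral_unique)
    also have "\<dots> = (\<Sum>k<N. a k * (if k = n then of_real (2 * pi) else 0))"
      by (auto intro!: sum.cong)
    also have "\<dots> = 2 * pi * a n"
      using that by (simp add: if_distrib[of "\<lambda>u. _ * u"] sum.delta cong: if_cong)
    finally show ?thesis .
  qed
  then have "I \<longlonglongrightarrow> 2 * pi * a n"
    by (intro tendsto_eventually eventually_sequentiallyI[of "Suc n"]) auto
  with IJ(3) have "J = 2 * pi * a n" by (rule LIMSEQ_unique)
  with IJ(2) show ?thesis by (simp add: integral_unique)
qed

lemma laurent_at_infinity_bound:
  assumes f: "laurent_at_infinity f R c a"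
  obtains B r where "B \<ge> 0" "r > 0" "\<And>z. norm z \<ge> r \<Longrightarrow> norm (f z - c * z) \<le> B"
proof -
  define r where "r = max R 0 + 1"
  have r: "r > 0" "r > R" by (auto simp: r_def)
  have "(\<lambda>n. a n / of_real r ^ n) sums (f (of_real r) - c * of_real r)"
    using f r by (auto simp: laurent_at_infinity_def)
  then have "(\<lambda>n. a n / of_real r ^ n) \<longlonglongrightarrow> 0" by (simp add: sums_iff summable_LIMSEQ_zero)
  then have "Bseq (\<lambda>n. a n / of_real r ^ n)" by (intro convergent_imp_Bseq) (auto simp: convergent_def)
  then obtain K where K: "K > 0" "\<And>n. norm (a n / of_real r ^ n) \<le> K" by (auto simp: Bseq_def)
  \<comment> \<open>The terms are bounded by K at radius r; doubling the radius turns this into the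
    geometric majorant K (1/2)^n, whose sum is 2 K.\<close>
  have "norm (f z - c * z) \<le> 2 * K" if z: "norm z \<ge> 2 * r" for z
  proof -
    have s: "(\<lambda>n. a n / z ^ n) sums (f z - c * z)"
      using f z r by (auto simp: laurent_at_infinity_def)
    have b: "norm (a n / z ^ n) \<le> K * (1/2) ^ n" for n
    proof -
      have "norm (a n / z ^ n) = norm (a n / of_real r ^ n) * (r / norm z) ^ n"
        using r by (simp add: norm_divide norm_power power_divide)
      also have "\<dots> \<le> K * (1/2) ^ n"
        using K z r by (intro mult_mono power_mono) (auto simp: divide_le_eq)
      finally show ?thesis .
    qed
    have g: "(\<lambda>n. K * (1/2) ^ n) sums (K * 2)"
      using sums_mult[OF geometric_sums[of "1/2::real"], of K] by simp
    have "norm (\<Sum>n. a n / z ^ n) \<le> (\<Sum>n. K * (1/2) ^ n)"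
      by (rule norm_suminf_le[OF b]) (use g in \<open>simp add: sums_iff\<close>)
    then show ?thesis using s g by (simp add: sums_iff)
  qed
  then show thesis using that[of "2 * K" "2 * r"] K r by auto
qed

lemma laurent_at_infinity_quotient:
  assumes "laurent_at_infinity f R c a"
  shows "((\<lambda>z. f z / z) \<longlongrightarrow> c) at_infinity"
proof -
  obtain B r where B: "B \<ge> 0" "r > 0" "\<And>z. norm z \<ge> r \<Longrightarrow> norm (f z - c * z) \<le> B"
    using laurent_at_infinity_bound[OF assms] by metis
  have "((\<lambda>z. f z / z - c) \<longlongrightarrow> 0) at_infinity"
  proof (rule Lim_null_comparison)
    show "\<forall>\<^sub>F z in at_infinity. norm (f z / z - c) \<le> B * norm (inverse z)"
      unfolding eventually_at_infinity
    proof (intro exI[of _ r] allI impI)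
      fix z :: complex assume z: "r \<le> norm z"
      then have "z \<noteq> 0" using B by auto
      then have "f z / z - c = (f z - c * z) / z" by (simp add: diff_divide_distrib)
      then show "norm (f z / z - c) \<le> B * norm (inverse z)"
        using B(3)[OF z] by (simp add: norm_divide norm_inverse divide_inverse[symmetric] divide_right_mono)
    qed
    show "((\<lambda>z::complex. B * norm (inverse z)) \<longlongrightarrow> 0) at_infinity"
      using tendsto_mult_right_zero[OF tendsto_norm_zero[OF tendsto_inverse_0]] by blast
  qed
  then show ?thesis by (simp add: LIM_zero_iff)
qed

lemma laurent_at_infinity_filterlim:
  assumes "laurent_at_infinity f R c a" "c \<noteq> 0"
  shows "filterlim f at_infinity at_infinity"
proof -
  have "filterlim (\<lambda>z. f z / z * z) at_infinity at_infinity"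
    by (rule tendsto_mult_filterlim_at_infinity[OF laurent_at_infinity_quotient[OF assms(1)] assms(2) filterlim_ident])
  moreover have "\<forall>\<^sub>F z in at_infinity. f z / z * z = f z"
    unfolding eventually_at_infinity by (intro exI[of _ 1]) auto
  ultimately show ?thesis by (rule filterlim_cong[OF refl refl, THEN iffD1, rotated])
qed

section \<open>Inverse, uniqueness and compactness for the exterior map\<close>

lemma exterior_inverse:
  assumes "exterior_map G \<Phi> \<gamma>"
  defines "\<Psi> \<equiv> the_inv_into (- closure G) \<Phi>"
  shows "\<Psi> holomorphic_on {w. norm w > 1}" "inj_on \<Psi> {w. norm w > 1}"
    "\<And>w. norm w > 1 \<Longrightarrow> \<Psi> w \<in> - closure G" "\<And>w. norm w > 1 \<Longrightarrow> \<Phi> (\<Psi> w) = w"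
    "\<And>z. z \<in> - closure G \<Longrightarrow> \<Psi> (\<Phi> z) = z" "\<And>z. z \<in> - closure G \<Longrightarrow> norm (\<Phi> z) > 1"
proof -
  have hol: "\<Phi> holomorphic_on (- closure G)" and bij: "bij_betw \<Phi> (- closure G) {w. norm w > 1}"
    using assms by (auto simp: exterior_map_def)
  have inj: "inj_on \<Phi> (- closure G)" and im: "\<Phi> ` (- closure G) = {w. norm w > 1}"
    using bij by (auto simp: bij_betw_def)
  show 1: "\<And>z. z \<in> - closure G \<Longrightarrow> \<Psi> (\<Phi> z) = z"
    unfolding \<Psi>_def using inj by (rule the_inv_into_f_f)
  show 2: "\<And>w. norm w > 1 \<Longrightarrow> \<Phi> (\<Psi> w) = w"
    unfolding \<Psi>_def using inj im by (simp add: f_the_inv_into_f)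
  show 3: "\<And>w. norm w > 1 \<Longrightarrow> \<Psi> w \<in> - closure G"
    unfolding \<Psi>_def using the_inv_into_into[OF inj _ order_refl] im by blast
  show "\<And>z. z \<in> - closure G \<Longrightarrow> norm (\<Phi> z) > 1" using im by blast
  show "inj_on \<Psi> {w. norm w > 1}" using 2 by (intro inj_on_inverseI[of _ \<Phi>]) auto
  obtain g where g: "g holomorphic_on (\<Phi> ` (- closure G))" "\<And>z. z \<in> - closure G \<Longrightarrow> g (\<Phi> z) = z"
    by (rule holomorphic_has_inverse[OF hol open_Compl[OF closed_closure] inj]) (rule that)
  have "g w = \<Psi> w" if "norm w > 1" for w using g(2)[OF 3[OF that]] 2[OF that] by simp
  with g(1) show "\<Psi> holomorphic_on {w. norm w > 1}" unfolding im
    by (elim holomorphic_transform) auto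
qed

lemma exterior_map_at_infinity:
  assumes "exterior_map G \<Phi> \<gamma>"
  shows "((\<lambda>z. \<Phi> z / z) \<longlongrightarrow> of_real \<gamma>) at_infinity" "filterlim \<Phi> at_infinity at_infinity" "\<gamma> > 0"
proof -
  obtain R a where l: "laurent_at_infinity \<Phi> R (of_real \<gamma>) a" and \<gamma>: "\<gamma> > 0"
    using assms by (auto simp: exterior_map_def)
  show "((\<lambda>z. \<Phi> z / z) \<longlongrightarrow> of_real \<gamma>) at_infinity" by (rule laurent_at_infinity_quotient[OF l])
  show "filterlim \<Phi> at_infinity at_infinity"
    by (rule laurent_at_infinity_filterlim[OF l]) (use \<gamma> in simp)
qed (use assms in \<open>auto simp: exterior_map_def\<close>)

text \<open>The transition from one exterior coordinate to another, read in the unit disc through w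
  \<mapsto> 1 / w. Infinity becomes the removable singularity 0, which prepares the Schwarz
  lemma.\<close>

lemma exterior_map_comparison:
  assumes \<Phi>1: "exterior_map G \<Phi>1 \<gamma>1" and b1: "exterior_inverse_coeffs G \<Phi>1 \<gamma>1 b1"
    and \<Phi>2: "exterior_map G \<Phi>2 \<gamma>2"
  obtains k where "k holomorphic_on ball 0 1" "k 0 = 0" "\<And>u. norm u < 1 \<Longrightarrow> norm (k u) < 1"
    "\<And>z. z \<in> - closure G \<Longrightarrow> k (1 / \<Phi>1 z) = 1 / \<Phi>2 z"
proof -
  define k where "k = (\<lambda>u. if u = 0 then 0 else 1 / \<Phi>2 (the_inv_into (- closure G) \<Phi>1 (1 / u)))"
  note i1 = exterior_inverse[OF \<Phi>1] and i2 = exterior_inverse[OF \<Phi>2]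
  let ?\<Psi> = "the_inv_into (- closure G) \<Phi>1"
  have gt: "norm (1 / u) > 1" if "norm u < 1" "u \<noteq> 0" for u :: complex
    using that by (simp add: norm_divide)
  have k0: "k 0 = 0" by (simp add: k_def)
  have k1: "norm (k u) < 1" if "norm u < 1" for u
    using i2(6)[OF i1(3)[OF gt[OF that]]] by (auto simp: k_def norm_divide divide_less_eq)
  have k2: "k (1 / \<Phi>1 z) = 1 / \<Phi>2 z" if "z \<in> - closure G" for z
    using i1(5)[OF that] i1(6)[OF that] by (auto simp: k_def)
  \<comment> \<open>The limit at infinity of the inverse map is read off its Laurent expansion, the
    reason for assuming \<open>exterior_inverse_coeffs\<close>.\<close>
  have "filterlim ?\<Psi> at_infinity at_infinity"
    using laurent_at_infinity_filterlim[OF b1[unfolded exterior_inverse_coeffs_def]] exterior_map_at_infinity(3)[OF \<Phi>1]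
    by simp
  then have "filterlim (\<lambda>w. \<Phi>2 (?\<Psi> w)) at_infinity at_infinity"
    by (rule filterlim_compose[OF exterior_map_at_infinity(2)[OF \<Phi>2]])
  then have "filterlim (\<lambda>u. \<Phi>2 (?\<Psi> (inverse u))) at_infinity (at 0)"
    by (rule filterlim_compose[OF _ filterlim_inverse_at_infinity])
  then have "((\<lambda>u. inverse (\<Phi>2 (?\<Psi> (inverse u)))) \<longlongrightarrow> 0) (at 0)"
    by (rule filterlim_compose[OF tendsto_inverse_0])
  then have lim: "(k \<longlongrightarrow> 0) (at 0)"
    by (rule Lim_transform_eventually) (simp add: k_def eventually_at_filter inverse_eq_divide)
  have "(\<lambda>u. 1 / \<Phi>2 (?\<Psi> (1 / u))) holomorphic_on ball 0 1 - {0}"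
  proof (intro holomorphic_intros)
    have h1: "(\<lambda>u. 1 / u) holomorphic_on ball 0 1 - {0}" by (intro holomorphic_intros) auto
    have "(?\<Psi> \<circ> (\<lambda>u. 1 / u)) holomorphic_on ball 0 1 - {0}"
    proof (rule holomorphic_on_compose_gen[OF h1 i1(1)])
      show "(\<lambda>u. 1 / u) ` (ball (0::complex) 1 - {0}) \<subseteq> {w. 1 < norm w}"
        using gt by (intro image_subsetI) simp
    qed
    moreover have "\<Phi>2 holomorphic_on (- closure G)" using \<Phi>2 by (simp add: exterior_map_def)
    ultimately have "(\<Phi>2 \<circ> (?\<Psi> \<circ> (\<lambda>u. 1 / u))) holomorphic_on ball 0 1 - {0}"
    proof (rule holomorphic_on_compose_gen)
      show "(?\<Psi> \<circ> (\<lambda>u. 1 / u)) ` (ball 0 1 - {0}) \<subseteq> - closure G"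
      proof (rule image_subsetI)
        fix u :: complex assume "u \<in> ball 0 1 - {0}"
        then show "(?\<Psi> \<circ> (\<lambda>u. 1 / u)) u \<in> - closure G"
          unfolding o_def by (intro i1(3) gt) auto
      qed
    qed
    then show "(\<lambda>u. \<Phi>2 (?\<Psi> (1 / u))) holomorphic_on ball 0 1 - {0}" by (simp add: o_def)
    fix u :: complex assume "u \<in> ball 0 1 - {0}"
    then show "\<Phi>2 (?\<Psi> (1 / u)) \<noteq> 0" using i2(6)[OF i1(3)[OF gt, of u]] by auto
  qed
  then have "k holomorphic_on ball 0 1 - {0}"
    by (rule holomorphic_transform) (auto simp: k_def)
  then have k3: "k holomorphic_on ball 0 1"
    by (rule no_isolated_singularity'[rotated])
       (use lim k0 tendsto_within_subset[OF lim subset_UNIV] in simp_all)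
  show thesis by (rule that[OF k3 k0 k1 k2])
qed

text \<open>The Schwarz lemma for the transition map and for its inverse gives equality of moduli,
  so the transition is a rotation; since both leading coefficients are positive, the rotation is the
  identity. This makes a constant found for one exterior map valid for all of them.\<close>

lemma exterior_map_unique:
  assumes \<Phi>1: "exterior_map G \<Phi>1 \<gamma>1" and b1: "exterior_inverse_coeffs G \<Phi>1 \<gamma>1 b1"
    and \<Phi>2: "exterior_map G \<Phi>2 \<gamma>2" and b2: "exterior_inverse_coeffs G \<Phi>2 \<gamma>2 b2"
    and G: "bounded G"
  shows "\<gamma>1 = \<gamma>2" "\<And>z. z \<in> - closure G \<Longrightarrow> \<Phi>1 z = \<Phi>2 z"
proof -
  note i1 = exterior_inverse[OF \<Phi>1] and i2 = exterior_inverse[OF \<Phi>2]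
  obtain k where k: "k holomorphic_on ball 0 1" "k 0 = 0" "\<And>u. norm u < 1 \<Longrightarrow> norm (k u) < 1"
    "\<And>z. z \<in> - closure G \<Longrightarrow> k (1 / \<Phi>1 z) = 1 / \<Phi>2 z"
    by (rule exterior_map_comparison[OF \<Phi>1 b1 \<Phi>2]) (rule that)
  obtain l where l: "l holomorphic_on ball 0 1" "l 0 = 0" "\<And>u. norm u < 1 \<Longrightarrow> norm (l u) < 1"
    "\<And>z. z \<in> - closure G \<Longrightarrow> l (1 / \<Phi>2 z) = 1 / \<Phi>1 z"
    by (rule exterior_map_comparison[OF \<Phi>2 b2 \<Phi>1]) (rule that)
  have lt: "norm (1 / \<Phi>1 z) < 1" "norm (1 / \<Phi>2 z) < 1" if "z \<in> - closure G" for z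
    using i1(6)[OF that] i2(6)[OF that] by (simp_all add: norm_divide divide_less_eq)
  have eq: "norm (k (1 / \<Phi>1 z)) = norm (1 / \<Phi>1 z)" if "z \<in> - closure G" for z
    using Schwarz_Lemma(1)[OF k(1,2,3) lt(1)[OF that]] Schwarz_Lemma(1)[OF l(1,2,3) lt(2)[OF that]]
    unfolding k(4)[OF that] l(4)[OF that] by simp
  have "bounded (closure G)" using G by (rule bounded_closure)
  then obtain r where "\<And>z. z \<in> closure G \<Longrightarrow> norm z \<le> r"
    unfolding bounded_iff by blast
  then have r: "\<And>z. norm z > r \<Longrightarrow> z \<in> - closure G" by force
  define z0 :: complex where "z0 = of_real (\<bar>r\<bar> + 1)"
  have z0: "z0 \<in> - closure G" by (rule r) (auto simp: z0_def)
  have "\<exists>u. norm u < 1 \<and> u \<noteq> 0 \<and> norm (k u) = norm u"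
    using eq[OF z0] lt[OF z0] i1(6)[OF z0] by (intro exI[of _ "1 / \<Phi>1 z0"]) auto
  then obtain \<alpha> where \<alpha>: "\<And>u. norm u < 1 \<Longrightarrow> k u = \<alpha> * u" "norm \<alpha> = 1"
    using Schwarz_Lemma(3)[OF k(1,2,3), of 0] by (metis norm_zero zero_less_one)
  have \<Phi>12: "\<Phi>1 z = \<alpha> * \<Phi>2 z" if "z \<in> - closure G" for z
  proof -
    have "\<Phi>1 z \<noteq> 0" "\<Phi>2 z \<noteq> 0" using i1(6)[OF that] i2(6)[OF that] by auto
    then show ?thesis using \<alpha>(1)[OF lt(1)[OF that]] unfolding k(4)[OF that] by (simp add: field_simps)
  qed
  have q1: "((\<lambda>z. \<Phi>1 z / z) \<longlongrightarrow> of_real \<gamma>1) at_infinity" and q2: "((\<lambda>z. \<Phi>2 z / z) \<longlongrightarrow> of_real \<gamma>2) at_infinity"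
    and pos: "\<gamma>1 > 0" "\<gamma>2 > 0"
    by (intro exterior_map_at_infinity[OF \<Phi>1] exterior_map_at_infinity[OF \<Phi>2])+
  have "((\<lambda>z. \<Phi>1 z / z) \<longlongrightarrow> \<alpha> * of_real \<gamma>2) at_infinity"
  proof (rule Lim_transform_eventually[OF tendsto_mult_left[OF q2]])
    show "\<forall>\<^sub>F z in at_infinity. \<alpha> * (\<Phi>2 z / z) = \<Phi>1 z / z"
      unfolding eventually_at_infinity
    proof (intro exI[of _ "r + 1"] allI impI)
      fix z :: complex assume "r + 1 \<le> norm z"
      then show "\<alpha> * (\<Phi>2 z / z) = \<Phi>1 z / z" using \<Phi>12[OF r[of z]] by simp
    qed
  qed
  with q1 have e: "of_real \<gamma>1 = \<alpha> * of_real \<gamma>2"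
    by (rule tendsto_unique[OF trivial_limit_at_infinity])
  then have "norm (of_real \<gamma>1 :: complex) = norm (\<alpha> * of_real \<gamma>2)" by simp
  then show g: "\<gamma>1 = \<gamma>2" using \<alpha>(2) pos by (simp add: norm_mult)
  then have "\<alpha> = 1" using e pos by simp
  then show "\<And>z. z \<in> - closure G \<Longrightarrow> \<Phi>1 z = \<Phi>2 z" using \<Phi>12 by simp
qed

text \<open>Far out |\<Phi>| is at least 2. The remaining points at distance at least \<delta> form
  a compact set on which |\<Phi>| attains a minimum above 1.\<close>

lemma exterior_map_away_from_boundary:
  assumes \<Phi>: "exterior_map G \<Phi> \<gamma>" and \<delta>: "\<delta> > 0"
  obtains e where "e > 0" "\<And>z. z \<in> - closure G \<Longrightarrow> infdist z (closure G) \<ge> \<delta> \<Longrightarrow> norm (\<Phi> z) \<ge> 1 + e"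
proof -
  have hol: "\<Phi> holomorphic_on (- closure G)" and inf: "filterlim \<Phi> at_infinity at_infinity"
    using \<Phi> exterior_map_at_infinity(2)[OF \<Phi>] by (auto simp: exterior_map_def)
  note i = exterior_inverse[OF \<Phi>]
  from inf have "\<forall>\<^sub>F z in at_infinity. norm (\<Phi> z) \<ge> 2"
    unfolding filterlim_at_infinity[OF order_refl] by auto
  then obtain r where r: "\<And>z. norm z \<ge> r \<Longrightarrow> norm (\<Phi> z) \<ge> 2" by (auto simp: eventually_at_infinity)
  show thesis
  proof (cases "closure G = {}")
    \<comment> \<open>The distance to the empty set is 0 by convention, so no point satisfies the
      distance condition.\<close>
    case True
    define K where "K = cball (0::complex) r"
    show ?thesis
      by (rule that[of 1]) (use True \<delta> in \<open>auto simp: infdist_def\<close>)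
  next
    case False
    define K where "K = cball 0 r \<inter> {z. infdist z (closure G) \<ge> \<delta>}"
    have K: "compact K" unfolding K_def
      by (intro compact_Int_closed compact_cball closed_Collect_le continuous_intros)
    have sub: "K \<subseteq> - closure G" using \<delta> by (auto simp: K_def)
    have ex: "\<exists>e>0. \<forall>z\<in>K. norm (\<Phi> z) \<ge> 1 + e"
    proof (cases "K = {}")
      case False
      have "continuous_on K (\<lambda>z. norm (\<Phi> z))"
        by (intro continuous_on_norm continuous_on_subset[OF holomorphic_on_imp_continuous_on[OF hol] sub])
      from continuous_attains_inf[OF K False this] obtain z0 where
        z0: "z0 \<in> K" "\<And>z. z \<in> K \<Longrightarrow> norm (\<Phi> z0) \<le> norm (\<Phi> z)" by blast
      then show ?thesis using i(6)[of z0] sub by (intro exI[of _ "norm (\<Phi> z0) - 1"]) auto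
    qed (auto intro: exI[of _ 1])
    then obtain e where e: "e > 0" "\<And>z. z \<in> K \<Longrightarrow> norm (\<Phi> z) \<ge> 1 + e" by blast
    show ?thesis
    proof (rule that[of "min e 1"])
      fix z assume "z \<in> - closure G" "infdist z (closure G) \<ge> \<delta>"
      then show "norm (\<Phi> z) \<ge> 1 + min e 1"
        using e(2)[of z] r[of z] by (cases "norm z \<ge> r") (auto simp: K_def)
    qed (use e in auto)
  qed
qed

section \<open>Conformal continuation across the boundary\<close>

lemma exp_Complex_2pi: "exp (Complex x (2 * pi)) = exp (Complex x 0)"
  by (simp add: exp_eq_polar)

lemma exp_of_nat_Complex_2pi: "exp (of_nat n * Complex x (2 * pi)) = exp (of_nat n * Complex x 0)"
  by (simp only: exp_of_nat_mult exp_Complex_2pi)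

text \<open>Integration by parts in t; the boundary terms cancel by periodicity.\<close>

lemma integral_deriv_exp_periodic:
  assumes U: "open U" and h: "h holomorphic_on U" and sub: "\<And>t. t \<in> {0..2 * pi} \<Longrightarrow> Complex x t \<in> U"
    and per: "h (Complex x (2 * pi)) = h (Complex x 0)"
  shows "integral {0..2 * pi} (\<lambda>t. deriv h (Complex x t) * exp (of_nat n * Complex x t)) =
    - of_nat n * integral {0..2 * pi} (\<lambda>t. h (Complex x t) * exp (of_nat n * Complex x t))"
proof -
  let ?e = "\<lambda>t. exp (of_nat n * Complex x t)"
  have cC: "continuous_on {0..2 * pi} (\<lambda>t. Complex x t)"
    unfolding Complex_eq by (intro continuous_intros)
  have ch: "continuous_on {0..2 * pi} (\<lambda>t. h (Complex x t))"
    by (rule continuous_on_compose2[OF holomorphic_on_imp_continuous_on[OF h] cC]) (use sub in auto)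
  have cd: "continuous_on {0..2 * pi} (\<lambda>t. deriv h (Complex x t))"
    by (rule continuous_on_compose2[OF holomorphic_on_imp_continuous_on[OF holomorphic_deriv[OF h U]] cC]) (use sub in auto)
  have ih: "(\<lambda>t. h (Complex x t) * ?e t) integrable_on {0..2 * pi}" and id: "(\<lambda>t. deriv h (Complex x t) * ?e t) integrable_on {0..2 * pi}"
    by (intro integrable_continuous_real continuous_intros ch cd cC)+
  have "((\<lambda>t. \<i> * (deriv h (Complex x t) * ?e t + of_nat n * (h (Complex x t) * ?e t))) has_integral
     (h (Complex x (2 * pi)) * ?e (2 * pi) - h (Complex x 0) * ?e 0)) {0..2 * pi}"
  proof (rule fundamental_theorem_of_calculus)
    fix t assume t: "t \<in> {0..2 * pi}"
    have hd: "(h has_field_derivative deriv h (of_real x + \<i> * of_real t)) (at (of_real x + \<i> * of_real t))"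
      using holomorphic_derivI[OF h U sub[OF t]] by (simp add: Complex_eq)
    have "((\<lambda>z. of_real x + \<i> * z) has_field_derivative \<i>) (at (of_real t))"
      by (auto intro!: derivative_eq_intros)
    from DERIV_chain'[OF this hd]
    have "((\<lambda>z. h (of_real x + \<i> * z) * exp (of_nat n * (of_real x + \<i> * z))) has_field_derivative
       \<i> * (deriv h (Complex x t) * ?e t + of_nat n * (h (Complex x t) * ?e t))) (at (of_real t))"
      by (auto intro!: derivative_eq_intros simp: Complex_eq algebra_simps)
    from has_vector_derivative_real_field[OF this]
    show "((\<lambda>t. h (Complex x t) * ?e t) has_vector_derivative
      \<i> * (deriv h (Complex x t) * ?e t + of_nat n * (h (Complex x t) * ?e t))) (at t within {0..2 * pi})"
      by (simp add: Complex_eq)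
  qed simp
  from integral_unique[OF this]
  have "integral {0..2 * pi} (\<lambda>t. \<i> * (deriv h (Complex x t) * ?e t + of_nat n * (h (Complex x t) * ?e t))) = 0"
    unfolding per exp_of_nat_Complex_2pi diff_self .
  then have "integral {0..2 * pi} (\<lambda>t. deriv h (Complex x t) * ?e t + of_nat n * (h (Complex x t) * ?e t)) = 0"
    by simp
  moreover have "integral {0..2 * pi} (\<lambda>t. deriv h (Complex x t) * ?e t + of_nat n * (h (Complex x t) * ?e t))
     = integral {0..2 * pi} (\<lambda>t. deriv h (Complex x t) * ?e t) + of_nat n * integral {0..2 * pi} (\<lambda>t. h (Complex x t) * ?e t)"
    by (subst integral_add[OF id integrable_on_mult_right[OF ih]]) simp
  ultimately show ?thesis by (simp add: add_eq_0_iff)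
qed

text \<open>\<open>exp\<close> is injective on an open rectangle of height 2 pi, so g \<circ> exp is
  univalent there and the area bound applies. The bound does not depend on the width of the strip,
  which permits edges tending to the boundary line.\<close>

lemma dirichlet_integral_exp_le:
  assumes g: "g holomorphic_on {w. norm w > r}" "inj_on g {w. norm w > r}" and r: "r < exp x0"
    and R: "R \<ge> 0" "\<And>z. x0 < Re z \<Longrightarrow> Re z < x1 \<Longrightarrow> norm (g (exp z)) \<le> R"
  defines "J \<equiv> \<lambda>x. integral {0..2 * pi} (\<lambda>t. (norm (deriv (\<lambda>z. g (exp z)) (Complex x t)))\<^sup>2)"
  shows "J integrable_on {x0..x1}" "integral {x0..x1} J \<le> 4 * R\<^sup>2"
proof -
  define U where "U = {z::complex. r < norm (exp z)}"
  have U: "open U" unfolding U_def by (intro open_Collect_less continuous_intros)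
  have "(g \<circ> exp) holomorphic_on U"
    by (rule holomorphic_on_compose_gen[OF _ g(1)]) (auto simp: U_def holomorphic_on_exp)
  then have hol: "(\<lambda>z. g (exp z)) holomorphic_on U" by (simp add: o_def)
  have gt: "r < exp x" if "x \<ge> x0" for x
    using r that by (meson exp_le_cancel_iff less_le_trans)
  have "continuous_on {x0..x1} (\<lambda>x. integral (cbox 0 (2 * pi)) (\<lambda>t. (norm (deriv (\<lambda>z. g (exp z)) (Complex x t)))\<^sup>2))"
  proof (rule integral_continuous_on_param)
    show "continuous_on ({x0..x1} \<times> cbox 0 (2 * pi)) (\<lambda>(x, t). (norm (deriv (\<lambda>z. g (exp z)) (Complex x t)))\<^sup>2)"
      unfolding split_def
    proof (intro continuous_on_power continuous_on_norm continuous_on_compose2[OF holomorphic_on_imp_continuous_on[OF holomorphic_deriv[OF hol U]]])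
      show "continuous_on ({x0..x1} \<times> cbox 0 (2 * pi)) (\<lambda>p. Complex (fst p) (snd p))"
        unfolding Complex_eq by (intro continuous_intros)
    qed (use gt in \<open>auto simp: U_def\<close>)
  qed
  then show "J integrable_on {x0..x1}" unfolding J_def by (intro integrable_continuous_real) simp
  show "integral {x0..x1} J \<le> 4 * R\<^sup>2"
    unfolding J_def
  proof (rule iterated_integral_norm_deriv_le[OF U hol])
    show "cbox (Complex x0 0) (Complex x1 (2 * pi)) \<subseteq> U"
      using gt by (auto simp: U_def in_cbox_complex_iff)
    show "inj_on (\<lambda>z. g (exp z)) (box (Complex x0 0) (Complex x1 (2 * pi)))"
    proof (rule inj_onI)
      fix z w assume z: "z \<in> box (Complex x0 0) (Complex x1 (2 * pi))" and w: "w \<in> box (Complex x0 0) (Complex x1 (2 * pi))"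
        and eq: "g (exp z) = g (exp w)"
      have "r < norm (exp z)" "r < norm (exp w)" using z w gt by (auto simp: in_box_complex_iff)
      then have "exp z = exp w" using eq g(2) by (auto dest: inj_onD)
      then show "z = w"
        by (rule exp_complex_eqI[rotated]) (use z w in \<open>auto simp: in_box_complex_iff\<close>)
    qed
  qed (use R in \<open>auto simp: in_box_complex_iff\<close>)
qed

text \<open>The area in question is that of the image of the ring r < |w| < 1, which lies in the
  closure of G and hence in a disc of radius M. The factor 1 - \<rho>^2 in the constant comes from
  bounding 1 - \<rho>^(2 n) below for all n at once.\<close>

lemma coeff_bound_conformal_outside_level:
  assumes \<Phi>: "exterior_map G \<Phi> \<gamma>" and b: "exterior_inverse_coeffs G \<Phi> \<gamma> b"
    and conf: "conformal_outside_level G \<Phi> \<rho>" and \<rho>: "\<rho> < 1"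
    and M: "M \<ge> 0" "\<And>z. z \<in> closure G \<Longrightarrow> norm z \<le> M" and n: "n \<ge> 1"
  shows "norm (b n) \<le> sqrt (4 * M\<^sup>2 / (pi * (1 - \<rho>\<^sup>2))) * (\<rho> ^ n / sqrt (real n))"
proof -
  define \<Psi> where "\<Psi> = the_inv_into (- closure G) \<Phi>"
  note inv = exterior_inverse[OF \<Phi>, folded \<Psi>_def]
  obtain D F where D: "open D" "- G \<subseteq> D" "F holomorphic_on D" "inj_on F D" "F ` D = {w. norm w > \<rho>}"
    "\<And>z. z \<in> - closure G \<Longrightarrow> F z = \<Phi> z" and \<rho>0: "\<rho> \<ge> 0"
    using conf by (auto simp: conformal_outside_level_def)
  obtain g where g: "g holomorphic_on {w. norm w > \<rho>}" "\<And>z. z \<in> D \<Longrightarrow> g (F z) = z"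
    by (rule holomorphic_has_inverse[OF D(3,1,4)]) (metis D(5))
  have gF: "F (g w) = w" "g w \<in> D" if "norm w > \<rho>" for w
  proof -
    from that obtain z where "z \<in> D" "w = F z" using D(5) by blast
    then show "F (g w) = w" "g w \<in> D" using g(2) by auto
  qed
  have g\<Psi>: "g w = \<Psi> w" if "norm w > 1" for w
  proof -
    have "\<Psi> w \<in> D" using inv(3)[OF that] D(2) closure_subset by blast
    moreover have "F (\<Psi> w) = w" using D(6)[OF inv(3)[OF that]] inv(4)[OF that] by simp
    ultimately show ?thesis using g(2) by metis
  qed
  \<comment> \<open>If \<open>g w\<close> lay outside the closure of G, then w = F (g w) = \<Phi> (g
    w) would have modulus above 1.\<close>
  have gM: "norm (g w) \<le> M" if "norm w > \<rho>" "norm w \<le> 1" for w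
  proof -
    have "g w \<in> closure G"
      using D(6)[of "g w"] inv(6)[of "g w"] gF[OF that(1)] that(2) by (cases "g w \<in> closure G") auto
    then show ?thesis by (rule M(2))
  qed
  define U where "U = {z::complex. \<rho> < norm (exp z)}"
  define h where "h = (\<lambda>z. g (exp z))"
  have U: "open U" unfolding U_def by (intro open_Collect_less continuous_intros)
  have hol: "h holomorphic_on U"
  proof -
    have "(g \<circ> exp) holomorphic_on U"
      by (rule holomorphic_on_compose_gen[OF _ g(1)]) (auto simp: U_def holomorphic_on_exp)
    then show ?thesis by (simp add: h_def o_def)
  qed
  have per: "h (Complex x (2 * pi)) = h (Complex x 0)" for x
    unfolding h_def exp_Complex_2pi ..
  have mem: "Complex x t \<in> U" if "\<rho> < exp x" for x t using that by (simp add: U_def)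
  define e where "e = (\<lambda>z::complex. exp (of_nat n * z))"
  define V where "V = (\<lambda>z. h z * e z)"
  \<comment> \<open>The Laurent series of \<open>\<Psi>\<close> gives the coefficient on the line Re
    z = 1. As \<open>V\<close> is holomorphic with period 2 pi \<i>, the mean is the same on every
    line in the domain of the continuation.\<close>
  have bn: "integral {0..2 * pi} (\<lambda>t. V (Complex x t)) = 2 * pi * b n" if x: "\<rho> < exp x" "x < 2" for x
  proof -
    obtain r where r: "\<rho> < r" "r < exp x" using dense[OF x(1)] by blast
    define x0 where "x0 = min 0 (ln r)"
    have "exp (ln r) = r" using r \<rho>0 by simp
    moreover from this have "ln r < x" using r exp_less_cancel_iff[of "ln r" x] by simp
    ultimately have x0: "\<rho> < exp x0" "ln r < x"
      using r \<rho> by (auto simp: x0_def min_def)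
    have VU: "V holomorphic_on U" unfolding V_def e_def by (intro holomorphic_intros hol)
    have sub: "{z. x0 < Re z \<and> Re z < 2} \<subseteq> U"
      using x0(1) by (auto simp: U_def intro: less_trans)
    let ?E = "\<lambda>x. integral {0..2 * pi} (\<lambda>t. V (Complex x t))"
    have d: "(?E has_vector_derivative 2 * integral {0..2 * pi} (\<lambda>t. 0)) (at y)" if y: "x0 < y" "y < 2" for y
    proof (rule periodic_mean_has_vector_derivative[OF _ _ _ _ _ y, of V "deriv V"])
      fix z assume "x0 < Re z" "Re z < 2"
      then have "z \<in> U" using sub by blast
      from holomorphic_derivI[OF VU U this]
      show "(V has_derivative (\<lambda>h. deriv V z * h + 0 * cnj h)) (at z)"
        by (simp add: has_field_derivative_def)
    next
      show "continuous_on {z. x0 < Re z \<and> Re z < 2} (deriv V)"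
        by (rule continuous_on_subset[OF holomorphic_on_imp_continuous_on[OF holomorphic_deriv[OF VU U]] sub])
      show "V (Complex x (2 * pi)) = V (Complex x 0)" for x
        unfolding V_def e_def per exp_of_nat_Complex_2pi ..
    qed auto
    have "?E constant_on {x0<..<2}"
    proof (rule has_derivative_zero_constant[OF convex_real_interval(8), THEN exE])
      fix y assume "y \<in> {x0<..<2}"
      then show "(?E has_derivative (\<lambda>h. 0)) (at y within {x0<..<2})"
        using d[of y] by (auto simp: has_vector_derivative_def intro: has_derivative_at_withinI)
    qed (auto simp: constant_on_def)
    moreover have "x \<in> {x0<..<2}" "1 \<in> {x0<..<2}" using x x0 by (auto simp: x0_def)
    ultimately have "?E x = ?E 1" by (auto simp: constant_on_def)
    also have "?E 1 = integral {0..2 * pi} (\<lambda>t. \<Psi> (exp (Complex 1 t)) * exp (of_nat n * Complex 1 t))"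
      by (simp add: V_def h_def e_def g\<Psi>)
    also have "\<dots> = 2 * pi * b n"
      using b laurent_coeff_integral[of \<Psi> 1 _ b 1 n] n by (simp add: exterior_inverse_coeffs_def \<Psi>_def)
    finally show ?thesis .
  qed
  have low: "2 * pi * (real n)\<^sup>2 * (norm (b n))\<^sup>2 * exp (- (2 * real n * x)) \<le> integral {0..2 * pi} (\<lambda>t. (norm (deriv h (Complex x t)))\<^sup>2)"
    if x: "\<rho> < exp x" "x < 2" for x
  proof -
    have cC: "continuous_on {0..2 * pi} (\<lambda>t. Complex x t)"
      unfolding Complex_eq by (intro continuous_intros)
    have cd: "continuous_on {0..2 * pi} (\<lambda>t. deriv h (Complex x t))"
      by (rule continuous_on_compose2[OF holomorphic_on_imp_continuous_on[OF holomorphic_deriv[OF hol U]] cC]) (use mem[OF x(1)] in auto)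
    have "(norm (integral {0..2 * pi} (\<lambda>t. deriv h (Complex x t) * e (Complex x t))))\<^sup>2
      \<le> (2 * pi - 0) * integral {0..2 * pi} (\<lambda>t. (norm (deriv h (Complex x t) * e (Complex x t)))\<^sup>2)"
      by (rule norm_integral_square_le) (auto intro!: continuous_intros cd cC simp: e_def)
    also have "(\<lambda>t. (norm (deriv h (Complex x t) * e (Complex x t)))\<^sup>2)
       = (\<lambda>t. exp (2 * real n * x) * (norm (deriv h (Complex x t)))\<^sup>2)"
      by (auto simp: norm_mult e_def power_mult_distrib exp_of_nat_mult[symmetric] power2_eq_square mult.commute mult.left_commute exp_add[symmetric])
    also have "integral {0..2 * pi} (\<lambda>t. exp (2 * real n * x) * (norm (deriv h (Complex x t)))\<^sup>2)
       = exp (2 * real n * x) * integral {0..2 * pi} (\<lambda>t. (norm (deriv h (Complex x t)))\<^sup>2)"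
      by (rule integral_mult_right)
    also have "integral {0..2 * pi} (\<lambda>t. deriv h (Complex x t) * e (Complex x t)) = - of_nat n * (2 * pi * b n)"
      unfolding e_def bn[OF x, unfolded V_def e_def, symmetric]
      by (rule integral_deriv_exp_periodic[OF U hol _ per]) (use mem[OF x(1)] in auto)
    finally have "(2 * pi) * (2 * pi * (real n)\<^sup>2 * (norm (b n))\<^sup>2) \<le> (2 * pi) * (exp (2 * real n * x) * integral {0..2 * pi} (\<lambda>t. (norm (deriv h (Complex x t)))\<^sup>2))"
      by (simp add: norm_mult power_mult_distrib power2_eq_square algebra_simps)
    then have "2 * pi * (real n)\<^sup>2 * (norm (b n))\<^sup>2 \<le> exp (2 * real n * x) * integral {0..2 * pi} (\<lambda>t. (norm (deriv h (Complex x t)))\<^sup>2)"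
      by (subst (asm) mult_le_cancel_left_pos) auto
    then show ?thesis by (simp add: exp_minus field_simps)
  qed
  have main: "pi * real n * (norm (b n))\<^sup>2 * (1 - r ^ (2 * n)) \<le> 4 * M\<^sup>2 * r ^ (2 * n)" if r: "\<rho> < r" "r < 1" for r
  proof -
    have r0: "r > 0" using r \<rho>0 by simp
    define x0 where "x0 = ln r"
    have x0: "exp x0 = r" "x0 < 0" using r r0 by (auto simp: x0_def)
    have gt: "\<rho> < exp x" if "x \<ge> x0" for x
      using that x0 r by (metis exp_le_cancel_iff less_le_trans)
    have J: "(\<lambda>x. integral {0..2 * pi} (\<lambda>t. (norm (deriv h (Complex x t)))\<^sup>2)) integrable_on {x0..0}"
      and up: "integral {x0..0} (\<lambda>x. integral {0..2 * pi} (\<lambda>t. (norm (deriv h (Complex x t)))\<^sup>2)) \<le> 4 * M\<^sup>2"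
      unfolding h_def
      by (rule dirichlet_integral_exp_le[OF g(1) inj_on_inverseI[of _ F]]; use gF(1) gt M(1) x0 r in \<open>auto intro!: gM\<close>)+
    have I: "((\<lambda>x. 2 * pi * (real n)\<^sup>2 * (norm (b n))\<^sup>2 * exp (- (2 * real n * x))) has_integral
       (- (pi * real n * (norm (b n))\<^sup>2) * exp (- (2 * real n * 0)) - (- (pi * real n * (norm (b n))\<^sup>2) * exp (- (2 * real n * x0))))) {x0..0}"
    proof (rule fundamental_theorem_of_calculus)
      fix x
      have "((\<lambda>x. - (pi * real n * (norm (b n))\<^sup>2) * exp (- (2 * real n * x))) has_real_derivative
        2 * pi * (real n)\<^sup>2 * (norm (b n))\<^sup>2 * exp (- (2 * real n * x))) (at x within {x0..0})"
        by (auto intro!: derivative_eq_intros simp: power2_eq_square)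
      then show "((\<lambda>x. - (pi * real n * (norm (b n))\<^sup>2) * exp (- (2 * real n * x))) has_vector_derivative
        2 * pi * (real n)\<^sup>2 * (norm (b n))\<^sup>2 * exp (- (2 * real n * x))) (at x within {x0..0})"
        by (simp add: has_real_derivative_iff_has_vector_derivative)
    qed (use x0 in simp)
    have "integral {x0..0} (\<lambda>x. 2 * pi * (real n)\<^sup>2 * (norm (b n))\<^sup>2 * exp (- (2 * real n * x))) \<le>
       integral {x0..0} (\<lambda>x. integral {0..2 * pi} (\<lambda>t. (norm (deriv h (Complex x t)))\<^sup>2))"
    proof (rule integral_le)
      show "(\<lambda>x. 2 * pi * (real n)\<^sup>2 * (norm (b n))\<^sup>2 * exp (- (2 * real n * x))) integrable_on {x0..0}"
        using I by blast
      show "(\<lambda>x. integral {0..2 * pi} (\<lambda>t. (norm (deriv h (Complex x t)))\<^sup>2)) integrable_on {x0..0}"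
        by (rule J)
      show "2 * pi * (real n)\<^sup>2 * (norm (b n))\<^sup>2 * exp (- (2 * real n * x)) \<le> integral {0..2 * pi} (\<lambda>t. (norm (deriv h (Complex x t)))\<^sup>2)"
        if "x \<in> {x0..0}" for x using low[of x] gt[of x] that by simp
    qed
    with up integral_unique[OF I] have "pi * real n * (norm (b n))\<^sup>2 * (exp (- (2 * real n * x0)) - 1) \<le> 4 * M\<^sup>2"
      by (simp add: algebra_simps)
    moreover have "exp (- (2 * real n * x0)) = 1 / r ^ (2 * n)"
    proof -
      have "exp (2 * real n * x0) = r ^ (2 * n)" using x0(1) exp_of_nat_mult[of "2 * n" x0] by simp
      then show ?thesis unfolding exp_minus inverse_eq_divide by simp
    qed
    ultimately have "pi * real n * (norm (b n))\<^sup>2 * (1 / r ^ (2 * n) - 1) * r ^ (2 * n) \<le> 4 * M\<^sup>2 * r ^ (2 * n)"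
      using r0 by (intro mult_right_mono) auto
    then show ?thesis using r0 by (simp add: algebra_simps)
  qed
  \<comment> \<open>The inequality was multiplied out by r^(2 n) beforehand, so the limit is
    legitimate for \<rho> = 0 as well. The limit is one-sided because nothing is known on |w| =
    \<rho> itself.\<close>
  have lim: "pi * real n * (norm (b n))\<^sup>2 * (1 - \<rho> ^ (2 * n)) \<le> 4 * M\<^sup>2 * \<rho> ^ (2 * n)"
  proof (rule tendsto_le[OF trivial_limit_at_right_real])
    show "((\<lambda>r. 4 * M\<^sup>2 * r ^ (2 * n)) \<longlongrightarrow> 4 * M\<^sup>2 * \<rho> ^ (2 * n)) (at_right \<rho>)"
      by (intro tendsto_intros)
    show "((\<lambda>r. pi * real n * (norm (b n))\<^sup>2 * (1 - r ^ (2 * n))) \<longlongrightarrow> pi * real n * (norm (b n))\<^sup>2 * (1 - \<rho> ^ (2 * n))) (at_right \<rho>)"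
      by (intro tendsto_intros)
    show "\<forall>\<^sub>F r in at_right \<rho>. pi * real n * (norm (b n))\<^sup>2 * (1 - r ^ (2 * n)) \<le> 4 * M\<^sup>2 * r ^ (2 * n)"
      using eventually_at_right_real[OF \<rho>] by eventually_elim (use main in auto)
  qed
  have \<rho>2: "1 - \<rho>\<^sup>2 > 0" using \<rho> \<rho>0 by (simp add: power_less_one_iff abs_square_less_1)
  have "\<rho> ^ (2 * n) \<le> \<rho>\<^sup>2" using n \<rho> \<rho>0 by (intro power_decreasing) auto
  then have "pi * real n * (norm (b n))\<^sup>2 * (1 - \<rho>\<^sup>2) \<le> 4 * M\<^sup>2 * \<rho> ^ (2 * n)"
    by (intro order_trans[OF mult_left_mono lim]) auto
  then have "(norm (b n))\<^sup>2 \<le> 4 * M\<^sup>2 / (pi * (1 - \<rho>\<^sup>2)) * ((\<rho> ^ n)\<^sup>2 / real n)"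
    using n \<rho>2 by (simp add: divide_simps power_even_eq) (simp add: mult_ac)
  then have "sqrt ((norm (b n))\<^sup>2) \<le> sqrt (4 * M\<^sup>2 / (pi * (1 - \<rho>\<^sup>2)) * ((\<rho> ^ n)\<^sup>2 / real n))"
    by (rule real_sqrt_le_mono)
  then show ?thesis using \<rho>0 by (simp add: real_sqrt_mult real_sqrt_divide)
qed

section \<open>Curves with a half-Hoelder tangent\<close>

lemma periodic_int:
  fixes f :: "real \<Rightarrow> 'a" and k :: int
  assumes "\<And>s. f (s + L) = f s"
  shows "f (s + of_int k * L) = f s"
proof -
  have nat: "f (s + of_nat n * L) = f s" for n s
  proof (induction n)
    case (Suc n)
    then show ?case using assms[of "s + of_nat n * L"] by (simp add: algebra_simps)
  qed simp
  show ?thesis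
  proof (cases "k \<ge> 0")
    case True
    then show ?thesis using nat[of s "nat k"] by simp
  next
    case False
    then show ?thesis using nat[of "s + of_int k * L" "nat (-k)"] by (simp add: algebra_simps)
  qed
qed

text \<open>A self-map of the disc can shrink the distance to the circle only by a factor controlled
  at 0. The Moebius map taking f 0 to 0 reduces this to the Schwarz lemma, and \<open>id\<close>
  translates back. The 4 collects 1 + |a| <= 2 and 1 - |f|^2 <= 2 (1 - |f|).\<close>

lemma Schwarz_Pick_lower:
  assumes f: "f holomorphic_on ball 0 1" and bd: "\<And>z. norm z < 1 \<Longrightarrow> norm (f z) < 1" and z: "norm z < 1"
  shows "1 - norm (f z) \<ge> (1 - norm (f 0)) * (1 - norm z) / 4"
proof -
  define a where "a = f 0"
  define h where "h = (\<lambda>w. (f w - a) / (1 - cnj a * f w))"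
  have a: "norm a < 1" using bd[of 0] by (simp add: a_def)
  have lt: "norm (cnj a * f w) < 1" if "norm w < 1" for w
    using mult_strict_mono'[OF a bd[OF that]] by (simp add: norm_mult)
  have nz: "1 - cnj a * f w \<noteq> 0" if "norm w < 1" for w
    using lt[OF that] by auto
  have id: "(norm (1 - cnj a * w))\<^sup>2 - (norm (w - a))\<^sup>2 = (1 - (norm a)\<^sup>2) * (1 - (norm w)\<^sup>2)" for w
    unfolding cmod_power2 by (simp add: power2_eq_square algebra_simps)
  have sq: "(norm w)\<^sup>2 < 1" if "norm w < 1" for w :: complex
    using that by (simp add: power_less_one_iff abs_square_less_1)
  have h1: "norm (h w) < 1" if "norm w < 1" for w
    using Moebius_function_norm_lt_1[OF a bd[OF that], of 0] by (simp add: h_def Moebius_function_simple)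
  have "h holomorphic_on ball 0 1"
    unfolding h_def by (intro holomorphic_intros f) (use nz in auto)
  moreover have "h 0 = 0" by (simp add: h_def a_def)
  ultimately have hz: "norm (h z) \<le> norm z" using Schwarz_Lemma(1)[of h z] h1 z by blast
  let ?q = "norm (1 - cnj a * f z)"
  have q: "?q \<ge> 1 - norm a"
  proof -
    have "norm (cnj a * f z) \<le> norm a * 1" unfolding norm_mult using bd[OF z] by (intro mult_mono) auto
    then show ?thesis using norm_triangle_ineq2[of 1 "cnj a * f z"] by simp
  qed
  have "norm (f z - a) = norm (h z) * ?q" using nz[OF z] by (simp add: h_def norm_divide)
  also have "\<dots> \<le> norm z * ?q" using hz by (intro mult_right_mono) auto
  finally have "(norm (f z - a))\<^sup>2 \<le> (norm z * ?q)\<^sup>2" by (rule power_mono) simp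
  with id[of "f z"] have "?q\<^sup>2 * (1 - (norm z)\<^sup>2) \<le> (1 - (norm a)\<^sup>2) * (1 - (norm (f z))\<^sup>2)"
    by (simp add: power_mult_distrib algebra_simps)
  moreover have "(1 - norm a)\<^sup>2 * (1 - (norm z)\<^sup>2) \<le> ?q\<^sup>2 * (1 - (norm z)\<^sup>2)"
    using q a sq[OF z] by (intro mult_right_mono power_mono) auto
  ultimately have "(1 - norm a)\<^sup>2 * (1 - (norm z)\<^sup>2) \<le> (1 - (norm a)\<^sup>2) * (1 - (norm (f z))\<^sup>2)" by linarith
  then have "(1 - norm a) * ((1 - norm a) * (1 - (norm z)\<^sup>2)) \<le> (1 - norm a) * ((1 + norm a) * (1 - (norm (f z))\<^sup>2))"
    by (simp add: power2_eq_square algebra_simps)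
  then have *: "(1 - norm a) * (1 - (norm z)\<^sup>2) \<le> (1 + norm a) * (1 - (norm (f z))\<^sup>2)"
    using a by (subst (asm) mult_le_cancel_left_pos) auto
  have "(1 + norm a) * (1 - (norm (f z))\<^sup>2) \<le> 2 * (2 * (1 - norm (f z)))"
  proof (rule mult_mono)
    show "1 - (norm (f z))\<^sup>2 \<le> 2 * (1 - norm (f z))"
      using zero_le_power2[of "1 - norm (f z)"] by (simp add: power2_eq_square algebra_simps)
  qed (use a sq[OF bd[OF z]] in auto)
  moreover have "(1 - norm a) * (1 - norm z) \<le> (1 - norm a) * (1 - (norm z)\<^sup>2)"
    using a z by (intro mult_left_mono) (auto simp: power2_eq_square mult_left_le)
  ultimately show ?thesis using * by (simp add: a_def)
qed

text \<open>The segment from z to a nearest point of the closure meets the boundary, at a point no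
  farther from z.\<close>

lemma nearest_frontier_point:
  fixes G :: "complex set"
  assumes z: "z \<notin> closure G" and G: "G \<noteq> {}"
  obtains w where "w \<in> frontier G" "dist z w = infdist z (closure G)"
proof -
  obtain w where w: "w \<in> closure G" "infdist z (closure G) = dist z w"
    using infdist_attains_inf[of "closure G" z] G by auto
  have "closed_segment z w \<inter> frontier (closure G) \<noteq> {}"
    by (rule connected_Int_frontier) (use z w in auto)
  then obtain v where v: "v \<in> closed_segment z w" "v \<in> frontier (closure G)" by blast
  have v2: "v \<in> frontier G" using v(2) interior_mono[OF closure_subset, of G] by (auto simp: frontier_def)
  then have "infdist z (closure G) \<le> dist z v" by (intro infdist_le) (auto simp: frontier_def)
  moreover have "dist z v \<le> dist z w" using dist_in_closed_segment[OF v(1)] by (simp add: dist_commute)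
  ultimately show thesis using that[OF v2] w(2) by simp
qed

lemma has_vector_derivative_lipschitz:
  fixes f :: "real \<Rightarrow> complex"
  assumes d: "\<And>s. (f has_vector_derivative f' s) (at s)" and b: "\<And>s. norm (f' s) \<le> B"
  shows "norm (f s - f t) \<le> B * \<bar>s - t\<bar>"
proof -
  have "norm (f s - f t) \<le> B * norm (s - t)"
  proof (rule differentiable_bound[of UNIV f "\<lambda>u h. h *\<^sub>R f' u"])
    show "(f has_derivative (\<lambda>h. h *\<^sub>R f' u)) (at u within UNIV)" for u
      using d[of u] by (simp add: has_vector_derivative_def)
    show "onorm (\<lambda>h. h *\<^sub>R f' u) \<le> B" for u
      using b by (intro onorm_le) (simp add: mult.commute[of _ "\<bar>_\<bar>"] mult_left_mono)
  qed auto
  then show ?thesis by simp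
qed

text \<open>The tangent bound is restricted to parameter distance at most L: on that range any
  Hoelder exponent of at least 1/2 gives it, and each curve point has a parameter within L / 2 of a
  given one.\<close>

locale smooth_curve =
  fixes g g1 :: "real \<Rightarrow> complex" and L M :: real
  assumes L: "L > 0" and per: "\<And>s. g (s + L) = g s" and inj: "inj_on g {0..<L}"
    and der: "\<And>s. (g has_vector_derivative g1 s) (at s)"
    and unit: "\<And>s. norm (g1 s) = 1"
    and M: "M \<ge> 1" and hol: "\<And>s t. \<bar>s - t\<bar> \<le> L \<Longrightarrow> norm (g1 s - g1 t) \<le> M * sqrt \<bar>s - t\<bar>"
begin

lemma cont: "continuous_on A g"
  by (intro continuous_at_imp_continuous_on ballI has_vector_derivative_continuous[OF der])

lemma range_eq: "g ` {0..<L} = range g"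
proof -
  have "g s \<in> g ` {0..<L}" for s
  proof -
    define k where "k = \<lfloor>s / L\<rfloor>"
    have "of_int k \<le> s / L" "s / L < of_int k + 1" unfolding k_def by linarith+
    then have "s + of_int (- k) * L \<in> {0..<L}" using L by (simp add: field_simps)
    moreover have "g (s + of_int (- k) * L) = g s" by (rule periodic_int[of g, OF per])
    ultimately show ?thesis by (metis imageI)
  qed
  then show ?thesis by auto
qed

lemma inj_mod:
  assumes "g s = g t" and st: "\<bar>s - t\<bar> < L"
  shows "s = t"
proof -
  define k where "k = \<lfloor>s / L\<rfloor>" define j where "j = \<lfloor>t / L\<rfloor>"
  have "of_int k \<le> s / L" "s / L < of_int k + 1" "of_int j \<le> t / L" "t / L < of_int j + 1"
    unfolding k_def j_def by linarith+
  then have "s + of_int (- k) * L \<in> {0..<L}" "t + of_int (- j) * L \<in> {0..<L}"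
    using L by (simp_all add: field_simps)
  moreover have "g (s + of_int (- k) * L) = g (t + of_int (- j) * L)"
    unfolding periodic_int[of g, OF per] by fact
  ultimately have "s + of_int (- k) * L = t + of_int (- j) * L"
    using inj by (auto dest: inj_onD)
  then have *: "s - t = of_int (k - j) * L" by (simp add: algebra_simps)
  then have "\<bar>of_int (k - j) :: real\<bar> * L < 1 * L" using st L by (simp add: abs_mult)
  then have "\<bar>of_int (k - j) :: real\<bar> < 1" using L by (simp only: mult_less_cancel_right_pos)
  then have "k = j" by linarith
  then show ?thesis using * by simp
qed

lemma exists_representative:
  obtains k :: int where "\<bar>s + of_int k * L - t\<bar> \<le> L / 2"
proof -
  define k where "k = round ((t - s) / L)"
  have "\<bar>of_int k - (t - s) / L\<bar> \<le> 1 / 2" unfolding k_def by (rule of_int_round_abs_le)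
  then have "\<bar>of_int k - (t - s) / L\<bar> * L \<le> 1 / 2 * L" using L by (intro mult_right_mono) auto
  also have "\<bar>of_int k - (t - s) / L\<bar> * L = \<bar>(of_int k - (t - s) / L) * L\<bar>" using L by (simp add: abs_mult)
  also have "(of_int k - (t - s) / L) * L = s + of_int k * L - t"
  proof -
    have "(t - s) / L * L = t - s" using L by simp
    then show ?thesis by (simp only: left_diff_distrib)
  qed
  finally show thesis using that[of k] by simp
qed

text \<open>The mean value inequality for g u - u g1 t. The deviation of order 3/2 fixes the
  exponent of the barrier u - A u^(3/2) used later.\<close>

lemma linear_approx:
  assumes "\<bar>s - t\<bar> \<le> L"
  shows "norm (g s - g t - (s - t) *\<^sub>R g1 t) \<le> M * \<bar>s - t\<bar> * sqrt \<bar>s - t\<bar>"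
proof -
  have "norm ((g s - s *\<^sub>R g1 t) - (g t - t *\<^sub>R g1 t)) \<le> M * sqrt \<bar>s - t\<bar> * norm (s - t)"
  proof (rule differentiable_bound[of "closed_segment s t" "\<lambda>u. g u - u *\<^sub>R g1 t" "\<lambda>u h. h *\<^sub>R (g1 u - g1 t)"])
    fix u assume u: "u \<in> closed_segment s t"
    show "((\<lambda>u. g u - u *\<^sub>R g1 t) has_derivative (\<lambda>h. h *\<^sub>R (g1 u - g1 t))) (at u within closed_segment s t)"
    proof (rule has_derivative_at_withinI)
      show "((\<lambda>u. g u - u *\<^sub>R g1 t) has_derivative (\<lambda>h. h *\<^sub>R (g1 u - g1 t))) (at u)"
        using der[of u] unfolding has_vector_derivative_def
        by (auto intro!: derivative_eq_intros simp: algebra_simps)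
    qed
    have ut: "\<bar>u - t\<bar> \<le> \<bar>s - t\<bar>" using u by (auto simp: closed_segment_eq_real_ivl split: if_splits)
    have "norm (g1 u - g1 t) \<le> M * sqrt \<bar>u - t\<bar>" using ut assms by (intro hol) auto
    also have "\<dots> \<le> M * sqrt \<bar>s - t\<bar>" using ut M by (intro mult_left_mono) auto
    finally show "onorm (\<lambda>h. h *\<^sub>R (g1 u - g1 t)) \<le> M * sqrt \<bar>s - t\<bar>"
      by (intro onorm_le) (simp add: mult.commute[of _ "\<bar>_\<bar>"] mult_left_mono)
  qed auto
  then show ?thesis by (simp add: algebra_simps)
qed

lemma lipschitz: "norm (g s - g t) \<le> \<bar>s - t\<bar>"
  using has_vector_derivative_lipschitz[OF der, of 1 s t] unit by simp

lemma chord_arc: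
  obtains c where "c > 0" "c \<le> 1" "\<And>s t. t \<in> {0..L} \<Longrightarrow> \<bar>s - t\<bar> \<le> L / 2 \<Longrightarrow> norm (g s - g t) \<ge> c * \<bar>s - t\<bar>"
proof -
  \<comment> \<open>Chosen so that M sqrt \<delta> = 1/2: nearer to the diagonal the tangent term
    keeps half of the arc length, and farther away injectivity and compactness give the
    bound.\<close>
  define \<delta> where "\<delta> = 1 / (4 * M\<^sup>2)"
  have \<delta>: "\<delta> > 0" using M by (simp add: \<delta>_def)
  have near: "norm (g s - g t) \<ge> 1/2 * \<bar>s - t\<bar>" if "\<bar>s - t\<bar> \<le> \<delta>" "\<bar>s - t\<bar> \<le> L / 2" for s t
  proof -
    have "sqrt \<bar>s - t\<bar> \<le> sqrt \<delta>" using that by simp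
    also have "sqrt \<delta> = 1 / (2 * M)" using M by (simp add: \<delta>_def real_sqrt_divide real_sqrt_mult)
    finally have "M * sqrt \<bar>s - t\<bar> \<le> 1/2" using M by (simp add: field_simps)
    then have "M * \<bar>s - t\<bar> * sqrt \<bar>s - t\<bar> \<le> 1/2 * \<bar>s - t\<bar>"
      using mult_right_mono[of "M * sqrt \<bar>s - t\<bar>" "1/2" "\<bar>s - t\<bar>"] by (simp add: mult_ac)
    moreover have "norm (g s - g t - (s - t) *\<^sub>R g1 t) \<le> M * \<bar>s - t\<bar> * sqrt \<bar>s - t\<bar>"
      using that L by (intro linear_approx) auto
    moreover have "norm ((s - t) *\<^sub>R g1 t) = \<bar>s - t\<bar>" by (simp add: unit)
    moreover have "norm ((s - t) *\<^sub>R g1 t) - norm (g s - g t) \<le> norm (g s - g t - (s - t) *\<^sub>R g1 t)"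
      using norm_triangle_ineq2[of "(s - t) *\<^sub>R g1 t" "g s - g t"]
      by (simp only: norm_minus_commute[of "(s - t) *\<^sub>R g1 t" "g s - g t"])
    ultimately have "\<bar>s - t\<bar> - norm (g s - g t) \<le> 1/2 * \<bar>s - t\<bar>"
      by (metis order_trans)
    then show ?thesis by simp
  qed
  define K where "K = {p \<in> cbox (-L, 0) (2 * L, L). \<delta> \<le> \<bar>fst p - snd p\<bar> \<and> \<bar>fst p - snd p\<bar> \<le> L / 2}"
  have "compact K"
  proof -
    have "closed {p::real\<times>real. \<delta> \<le> \<bar>fst p - snd p\<bar> \<and> \<bar>fst p - snd p\<bar> \<le> L / 2}"
      by (intro closed_Collect_conj closed_Collect_le continuous_intros)
    then have "compact (cbox (-L, 0) (2 * L, L) \<inter> {p::real\<times>real. \<delta> \<le> \<bar>fst p - snd p\<bar> \<and> \<bar>fst p - snd p\<bar> \<le> L / 2})"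
      by (intro compact_Int_closed compact_cbox)
    also have "\<dots> = K" by (auto simp: K_def)
    finally show ?thesis .
  qed
  have pos: "norm (g (fst p) - g (snd p)) > 0" if "p \<in> K" for p
  proof -
    have "g (fst p) \<noteq> g (snd p)"
      using inj_mod[of "fst p" "snd p"] that \<delta> L by (auto simp: K_def)
    then show ?thesis by simp
  qed
  have "\<exists>e>0. \<forall>p\<in>K. norm (g (fst p) - g (snd p)) \<ge> e"
  proof (cases "K = {}")
    case False
    have "continuous_on K (\<lambda>p. norm (g (fst p) - g (snd p)))"
      by (intro continuous_intros continuous_on_compose2[OF cont[of UNIV]]) auto
    from continuous_attains_inf[OF \<open>compact K\<close> False this] obtain p where
      "p \<in> K" "\<forall>q\<in>K. norm (g (fst p) - g (snd p)) \<le> norm (g (fst q) - g (snd q))" by blast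
    with pos[of p] show ?thesis by blast
  qed (auto intro: exI[of _ 1])
  then obtain e where e: "e > 0" "\<And>p. p \<in> K \<Longrightarrow> norm (g (fst p) - g (snd p)) \<ge> e" by blast
  define c where "c = min (1/2) (e / L)"
  show thesis
  proof (rule that[of c])
    show "c > 0" using e L by (auto simp: c_def)
    show "c \<le> 1" unfolding c_def min_le_iff_disj by simp
    fix s t assume t: "t \<in> {0..L}" and st: "\<bar>s - t\<bar> \<le> L / 2"
    show "norm (g s - g t) \<ge> c * \<bar>s - t\<bar>"
    proof (cases "\<bar>s - t\<bar> \<le> \<delta>")
      case True
      have "c \<le> 1/2" unfolding c_def by (rule min.cobounded1)
      then have "c * \<bar>s - t\<bar> \<le> 1/2 * \<bar>s - t\<bar>" by (intro mult_right_mono) auto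
      then show ?thesis using near[OF True st] by linarith
    next
      case False
      have "- L \<le> s" "s \<le> 2 * L" using abs_le_D1[OF st] abs_le_D2[OF st] t L by auto
      with False have "(s, t) \<in> K" using t st by (auto simp: K_def cbox_Pair_eq)
      then have "norm (g s - g t) \<ge> e" using e(2) by fastforce
      moreover have "c * \<bar>s - t\<bar> \<le> e / L * L" using st L e by (intro mult_mono) (auto simp: c_def)
      ultimately show ?thesis using L by simp
    qed
  qed
qed

end

section \<open>Growth of the exterior map at the boundary\<close>

text \<open>With x + i y the principal root of u, Re u > 0 means y^2 < x^2, hence |u| <= 2 x^2. The
  smallness condition makes 1 - 3 A x nonnegative, so that only the cubic term remains in the lower
  bound of Re v.\<close>

lemma csqrt_region:
  fixes u :: complex and A :: real
  assumes u: "Re u > 0" and A: "A \<ge> 0" "3 * A * sqrt (norm u) \<le> 1"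
  defines "x \<equiv> Re (csqrt u)" and "v \<equiv> u - of_real A * u * csqrt u"
  shows "x > 0" "norm u \<le> 2 * x\<^sup>2" "Re v \<ge> 2 * A * x ^ 3" "norm v \<le> 2 * norm u"
proof -
  define w where "w = csqrt u"
  define y where "y = Im w"
  have w: "w\<^sup>2 = u" "Re w = x" by (simp_all add: w_def x_def)
  have nw: "(norm w)\<^sup>2 = norm u" using w(1) by (metis norm_power)
  then have nw': "norm w = sqrt (norm u)" by (metis norm_ge_zero real_sqrt_unique)
  have "Re u = x\<^sup>2 - y\<^sup>2" unfolding w(1)[symmetric] using w(2) by (simp add: y_def power2_eq_square)
  then have xy: "x\<^sup>2 - y\<^sup>2 > 0" using u by simp
  have x0: "x \<ge> 0" using csqrt_principal[of u] by (auto simp: x_def)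
  show x: "x > 0" using x0 xy by (cases "x = 0") (auto simp: not_less)
  have n: "(norm w)\<^sup>2 = x\<^sup>2 + y\<^sup>2" unfolding cmod_power2 w(2) y_def ..
  then show "norm u \<le> 2 * x\<^sup>2" using nw xy by simp
  have xw: "x \<le> norm w" using complex_Re_le_cmod[of w] w(2) by simp
  have Ax: "3 * A * x \<le> 1"
    using mult_left_mono[OF xw, of "3 * A"] A nw' by simp
  have v: "v = w\<^sup>2 - of_real A * w ^ 3"
  proof -
    have "v = u - of_real A * u * w" by (simp add: v_def w_def)
    then show ?thesis unfolding w(1)[symmetric] by (simp add: power3_eq_cube power2_eq_square algebra_simps)
  qed
  have "Re v = (x\<^sup>2 - y\<^sup>2) * (1 - 3 * A * x) + 2 * A * x ^ 3"
    unfolding v using w(2) by (simp add: y_def[symmetric] power3_eq_cube power2_eq_square algebra_simps)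
  then show "Re v \<ge> 2 * A * x ^ 3" using xy Ax by simp
  have "norm v \<le> norm u + A * norm u * norm w"
    unfolding v_def w_def[symmetric]
    by (rule order_trans[OF norm_triangle_ineq4]) (use A in \<open>simp add: norm_mult\<close>)
  also have "A * norm u * norm w \<le> norm u * 1"
    using A nw' mult_left_mono[of "A * norm w" 1 "norm u"] by (simp add: mult_ac)
  finally show "norm v \<le> 2 * norm u" by simp
qed

context smooth_curve
begin

text \<open>
  The image of a disc in the right half-plane, tangent to the imaginary axis at 0, under
  \<open>u \<mapsto> g t + \<nu> (u - A u\<^sup>3\<^sup>/\<^sup>2)\<close> touches the curve at \<open>g t\<close> only: with \<open>\<surd>u = x + i y\<close> one has
  \<open>Re (u - A u\<^sup>3\<^sup>/\<^sup>2) = (x\<^sup>2 - y\<^sup>2) (1 - 3 A x) + 2 A x\<^sup>3\<close>, which beats the deviation of the curve from its tangent.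
\<close>
lemma barrier_distance:
  assumes c: "c > 0" and ch: "\<And>s t. t \<in> {0..L} \<Longrightarrow> \<bar>s - t\<bar> \<le> L / 2 \<Longrightarrow> norm (g s - g t) \<ge> c * \<bar>s - t\<bar>"
    and t: "t \<in> {0..L}" and \<nu>: "\<nu> = \<i> * g1 t \<or> \<nu> = - \<i> * g1 t"
    and A: "2 * A \<ge> M * (8 / c) * sqrt (8 / c) + 1"
    and u: "Re u > 0" "3 * A * sqrt (norm u) \<le> 1"
  defines "v \<equiv> u - of_real A * u * csqrt u"
  shows "norm (g t + \<nu> * v - g s) \<ge> min (norm v) (Re (csqrt u) ^ 3)"
proof -
  define x where "x = Re (csqrt u)"
  obtain k :: int where "\<bar>s + of_int k * L - t\<bar> \<le> L / 2" by (rule exists_representative)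
  then obtain r where r: "\<bar>r - t\<bar> \<le> L / 2" "g r = g s"
    using periodic_int[of g, OF per] by metis
  have A0: "A \<ge> 0" using A M c by (smt (verit) divide_nonneg_pos mult_nonneg_nonneg real_sqrt_ge_zero)
  note R = csqrt_region[OF u(1) A0 u(2), folded v_def x_def]
  have n\<nu>: "norm \<nu> = 1" using \<nu> unit[of t] by (auto simp: norm_mult)
  show ?thesis
  \<comment> \<open>Far curve points are handled by the triangle inequality. For near ones the
    component along the normal \<nu> is compared.\<close>
  proof (cases "norm (g r - g t) \<ge> 2 * norm v")
    case True
    have "norm (g r - g t) - norm (\<nu> * v) \<le> norm (g t + \<nu> * v - g r)"
      using norm_triangle_ineq2[of "g r - g t" "\<nu> * v"] by (simp add: norm_minus_commute algebra_simps)
    then show ?thesis using True r(2) n\<nu> by (simp add: norm_mult)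
  next
    case False
    define a where "a = \<bar>r - t\<bar>"
    define e where "e = g r - g t - (r - t) *\<^sub>R g1 t"
    have ne: "norm e \<le> M * a * sqrt a"
      unfolding e_def a_def using r(1) L by (intro linear_approx) auto
    \<comment> \<open>The chain is c a <= |g r - g t| < 2 |v| <= 4 |u| <= 8 x^2, the origin of 8 / c
      in the condition on A.\<close>
    have "c * a \<le> 8 * x\<^sup>2" using ch[OF t r(1)] False R(2,4) by (simp add: a_def)
    then have a: "a \<le> 8 / c * x\<^sup>2" using c by (simp add: field_simps)
    have a0: "a \<ge> 0" by (simp add: a_def)
    have "sqrt a \<le> sqrt (8 / c * x\<^sup>2)" using a by simp
    also have "\<dots> = sqrt (8 / c) * x" unfolding real_sqrt_mult using R(1) by simp
    finally have "a * sqrt a \<le> (8 / c * x\<^sup>2) * (sqrt (8 / c) * x)"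
      using a a0 by (intro mult_mono) auto
    then have "M * (a * sqrt a) \<le> M * ((8 / c * x\<^sup>2) * (sqrt (8 / c) * x))"
      using M by (intro mult_left_mono) auto
    with ne have ne': "norm e \<le> (M * (8 / c) * sqrt (8 / c)) * x ^ 3"
      by (simp add: power3_eq_cube power2_eq_square mult_ac)
    have "Re (cnj \<nu> * (g t + \<nu> * v - g r)) = Re v - Re (cnj \<nu> * e)"
    proof -
      have 1: "cnj \<nu> * \<nu> = 1" using n\<nu> complex_norm_square[of \<nu>] by (simp add: mult.commute)
      have 2: "Re (cnj \<nu> * g1 t) = 0"
        using \<nu> by auto
      have "cnj \<nu> * (g t + \<nu> * v - g r) = (cnj \<nu> * \<nu>) * v - (r - t) *\<^sub>R (cnj \<nu> * g1 t) - cnj \<nu> * e"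
        by (simp add: e_def scaleR_conv_of_real algebra_simps)
      then show ?thesis using 1 2 by simp
    qed
    moreover have "Re (cnj \<nu> * e) \<le> norm e"
      using complex_Re_le_cmod[of "cnj \<nu> * e"] n\<nu> by (simp add: norm_mult)
    moreover have "2 * A * x ^ 3 \<ge> (M * (8 / c) * sqrt (8 / c) + 1) * x ^ 3"
      using A R(1) by (intro mult_right_mono) auto
    ultimately have "Re (cnj \<nu> * (g t + \<nu> * v - g r)) \<ge> x ^ 3"
      using ne' R(3) by (simp add: algebra_simps)
    moreover have "Re (cnj \<nu> * (g t + \<nu> * v - g r)) \<le> norm (g t + \<nu> * v - g r)"
      using complex_Re_le_cmod[of "cnj \<nu> * (g t + \<nu> * v - g r)"] n\<nu> by (simp add: norm_mult)
    ultimately show ?thesis using r(2) by (simp add: x_def)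
  qed
qed

text \<open>At a nearest parameter the derivative of the squared distance vanishes, so z - g t is
  orthogonal to the tangent. The sign records the side of the curve on which z lies.\<close>

lemma normal_direction:
  assumes min: "\<And>s. norm (g t - z) \<le> norm (g s - z)" and z: "z \<noteq> g t"
  obtains \<nu> where "\<nu> = \<i> * g1 t \<or> \<nu> = - \<i> * g1 t" "z = g t + of_real (norm (g t - z)) * \<nu>"
proof -
  have "((\<lambda>s. (g s - z) \<bullet> (g s - z)) has_derivative (\<lambda>h. 2 * ((g t - z) \<bullet> (h *\<^sub>R g1 t)))) (at t)"
    using der[of t] unfolding has_vector_derivative_def
    by (auto intro!: derivative_eq_intros simp: inner_commute)
  then have "(\<lambda>h. 2 * ((g t - z) \<bullet> (h *\<^sub>R g1 t))) = (\<lambda>h. 0)"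
    by (rule has_derivative_local_min)
       (use min in \<open>auto intro!: always_eventually simp: dot_square_norm\<close>)
  from fun_cong[OF this, of 1] have "(g t - z) \<bullet> g1 t = 0" by simp
  then have "Re ((z - g t) * cnj (g1 t)) = 0"
    by (simp add: inner_complex_def algebra_simps)
  then obtain y where y: "(z - g t) * cnj (g1 t) = \<i> * of_real y"
    by (metis complex_eq_iff Re_i_times Im_i_times Im_complex_of_real Re_complex_of_real add.inverse_neutral)
  have 1: "cnj (g1 t) * g1 t = 1" using unit[of t] complex_norm_square[of "g1 t"] by (simp add: mult.commute)
  have "z - g t = (z - g t) * cnj (g1 t) * g1 t" using 1 by (simp add: mult.assoc)
  then have zy: "z - g t = of_real y * (\<i> * g1 t)" unfolding y by (simp add: mult_ac)
  then have ny: "norm (g t - z) = \<bar>y\<bar>" using unit[of t] by (metis norm_minus_commute norm_mult norm_of_real norm_ii mult_1 mult.right_neutral)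
  show thesis
  proof (cases "y \<ge> 0")
    case True
    then show thesis using zy ny by (intro that[of "\<i> * g1 t"]) (simp_all add: algebra_simps)
  next
    case False
    then show thesis using zy ny by (intro that[of "- \<i> * g1 t"]) (simp_all add: algebra_simps)
  qed
qed

text \<open>A Hopf lemma. The same bent disc is attached at the nearest boundary point of every z
  and contains z on its axis; Schwarz-Pick for 1 / \<Phi> on it compares z with the image of the
  centre. The shape does not depend on z, so the constant is uniform.\<close>

lemma exterior_map_boundary_growth:
  assumes G: "open G" "G \<noteq> {}" and fr: "frontier G = g ` {0..<L}" and \<Phi>: "exterior_map G \<Phi> \<gamma>"
  obtains c \<delta> where "c > 0" "\<delta> > 0"
    "\<And>z. z \<in> - closure G \<Longrightarrow> infdist z (closure G) \<le> \<delta> \<Longrightarrow> norm (\<Phi> z) \<ge> 1 + c * infdist z (closure G)"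
proof -
  note inv = exterior_inverse[OF \<Phi>]
  obtain c where c: "c > 0" and ch: "\<And>s t. t \<in> {0..L} \<Longrightarrow> \<bar>s - t\<bar> \<le> L / 2 \<Longrightarrow> norm (g s - g t) \<ge> c * \<bar>s - t\<bar>"
    by (rule chord_arc) (rule that)
  define A where "A = (M * (8 / c) * sqrt (8 / c) + 1) / 2"
  have A: "2 * A \<ge> M * (8 / c) * sqrt (8 / c) + 1" by (simp add: A_def)
  have "M * (8 / c) * sqrt (8 / c) \<ge> 0" using M c by simp
  then have A0: "A > 0" by (simp add: A_def)
  \<comment> \<open>The disc of centre and radius \<eta> lies in |u| < 2 \<eta>, where 3 A sqrt |u|
    <= 1 must hold.\<close>
  define \<eta> where "\<eta> = 1 / (2 * (3 * A + 1)\<^sup>2)"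
  have \<eta>: "\<eta> > 0" using A0 by (simp add: \<eta>_def)
  have "sqrt (2 * \<eta>) = 1 / (3 * A + 1)" using A0 by (simp add: \<eta>_def real_sqrt_divide)
  then have A\<eta>: "3 * A * sqrt (2 * \<eta>) \<le> 1" using A0 by simp
  have small: "3 * A * sqrt r \<le> 1" if "r \<le> 2 * \<eta>" for r
  proof -
    have "3 * A * sqrt r \<le> 3 * A * sqrt (2 * \<eta>)" using A0 that by (intro mult_left_mono) auto
    with A\<eta> show ?thesis by linarith
  qed
  define B where "B = ball (of_real \<eta> :: complex) \<eta>"
  have B: "Re u > 0" "3 * A * sqrt (norm u) \<le> 1" if "u \<in> B" for u
  proof -
    have d: "norm (u - of_real \<eta>) < \<eta>" using that by (simp add: B_def dist_norm norm_minus_commute)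
    then show "Re u > 0" using abs_Re_le_cmod[of "u - of_real \<eta>"] by simp
    have "norm u \<le> norm (u - of_real \<eta>) + norm (of_real \<eta> :: complex)" using norm_triangle_ineq[of "u - of_real \<eta>" "of_real \<eta>"] by simp
    then show "3 * A * sqrt (norm u) \<le> 1" using d \<eta> by (intro small) simp
  qed
  define v where "v = (\<lambda>u. u - of_real A * u * csqrt u)"
  have v_pos: "Re (v u) > 0" "Re (csqrt u) > 0" if "u \<in> B" for u
  proof -
    note R = csqrt_region[OF B(1)[OF that] less_imp_le[OF A0] B(2)[OF that]]
    show "Re (csqrt u) > 0" by (rule R)
    then have "2 * A * Re (csqrt u) ^ 3 > 0" using A0 by simp
    then show "Re (v u) > 0" unfolding v_def using R(3) by linarith
  qed
  \<comment> \<open>A lower bound for the distance of the image of the centre from the curve,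
    independent of the boundary point.\<close>
  define c0 where "c0 = min (norm (v (of_real \<eta>))) (Re (csqrt (of_real \<eta>)) ^ 3)"
  have \<eta>B: "of_real \<eta> \<in> B" using \<eta> by (simp add: B_def)
  have c0: "c0 > 0" using v_pos[OF \<eta>B] by (auto simp: c0_def)
  obtain e where e: "e > 0" "\<And>z. z \<in> - closure G \<Longrightarrow> infdist z (closure G) \<ge> c0 \<Longrightarrow> norm (\<Phi> z) \<ge> 1 + e"
    using exterior_map_away_from_boundary[OF \<Phi> c0] by blast
  \<comment> \<open>The gap of |1 / \<Phi>| below 1 at the centre, the 4 of Schwarz-Pick and the
    radius \<eta>.\<close>
  define \<kappa> where "\<kappa> = (1 - 1 / (1 + e)) / (4 * \<eta>)"
  have \<kappa>: "\<kappa> > 0" using e(1) \<eta> by (simp add: \<kappa>_def)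
  define \<phi> where "\<phi> = (\<lambda>t. t - A * t * sqrt t)"
  have v\<phi>: "v (of_real t) = of_real (\<phi> t)" if "t \<ge> 0" for t
    using that by (simp add: v_def \<phi>_def csqrt_of_real_nonneg)
  have \<phi>\<eta>: "\<phi> \<eta> \<ge> \<eta> / 2"
  proof -
    have "A * sqrt \<eta> \<le> 1 / 2" using small[of \<eta>] \<eta> by simp
    then have "\<eta> * (A * sqrt \<eta>) \<le> \<eta> * (1 / 2)" using \<eta> by (intro mult_left_mono) auto
    then show ?thesis by (simp add: \<phi>_def algebra_simps)
  qed
  show thesis
  proof (rule that[OF \<kappa>, of "\<eta> / 2"])
    fix z assume z: "z \<in> - closure G" and dz: "infdist z (closure G) \<le> \<eta> / 2"
    define d where "d = infdist z (closure G)"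
    obtain w where w: "w \<in> frontier G" "dist z w = d"
      unfolding d_def using nearest_frontier_point[of z G] z G by auto
    obtain t where "t \<in> {0..<L}" "w = g t" using w(1) fr by blast
    then have t: "t \<in> {0..L}" "w = g t" by auto
    have nt: "norm (g t - z) = d" using w(2) t(2) by (simp add: dist_norm norm_minus_commute)
    have zw: "z \<noteq> g t" using w(1) z t(2) by (auto simp: frontier_def)
    have d0: "d > 0" using nt zw by auto
    have min: "norm (g t - z) \<le> norm (g s - z)" for s
    proof -
      have "g s \<in> frontier G" unfolding fr range_eq by simp
      then have "d \<le> dist z (g s)" unfolding d_def by (intro infdist_le) (auto simp: frontier_def)
      then show ?thesis using nt by (simp add: dist_norm norm_minus_commute)
    qed
    obtain \<nu> where \<nu>: "\<nu> = \<i> * g1 t \<or> \<nu> = - \<i> * g1 t" and z\<nu>: "z = g t + of_real d * \<nu>"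
      using normal_direction[OF min zw] unfolding nt by blast
    define q where "q = (\<lambda>u. g t + \<nu> * v u)"
    have dist: "norm (q u - g s) \<ge> min (norm (v u)) (Re (csqrt u) ^ 3)" if "u \<in> B" for u s
      unfolding q_def v_def by (rule barrier_distance[OF c ch t(1) \<nu> A B[OF that]])
    have nfr: "q u \<notin> frontier G" if "u \<in> B" for u
    proof
      assume "q u \<in> frontier G"
      then obtain s where "q u = g s" using fr by auto
      then show False using dist[OF that, of s] v_pos[OF that] by (auto simp: min_def split: if_splits)
    qed
    have "continuous_on {0..\<eta>} \<phi>" unfolding \<phi>_def by (intro continuous_intros)
    \<comment> \<open>The barrier map sends the real axis to the normal, so z is the image of some
      t0. The range d <= \<eta> / 2 is covered because \<phi> \<eta> >= \<eta> / 2, and \<phi> t <=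
      t gives t0 >= d.\<close>
    obtain t0 where t0: "0 \<le> t0" "t0 \<le> \<eta>" "\<phi> t0 = d"
    proof -
      have "\<phi> 0 \<le> d" using d0 by (simp add: \<phi>_def)
      moreover have "d \<le> \<phi> \<eta>" using dz[folded d_def] \<phi>\<eta> by linarith
      ultimately have "\<phi> 0 \<le> d" "d \<le> \<phi> \<eta>" .
      from IVT'[OF this less_imp_le[OF \<eta>] \<open>continuous_on {0..\<eta>} \<phi>\<close>] show ?thesis using that by blast
    qed
    have t0p: "t0 > 0" using t0 d0 by (cases "t0 = 0") (auto simp: \<phi>_def)
    have "A * t0 * sqrt t0 \<ge> 0" using A0 t0p by simp
    then have dt0: "d \<le> t0" using t0(3) unfolding \<phi>_def by linarith
    have t0B: "of_real t0 \<in> B" using t0 t0p \<eta> by (simp add: B_def dist_real_def)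
    have qt0: "q (of_real t0) = z" using z\<nu> t0(3) v\<phi>[OF t0(1)] by (simp add: q_def)
    have csq: "csqrt holomorphic_on B"
      by (intro holomorphic_on_csqrt[THEN holomorphic_on_subset]) (auto simp: complex_nonpos_Reals_iff dest: B(1))
    have qhol: "q holomorphic_on B" unfolding q_def v_def by (intro holomorphic_intros csq)
    have "connected (q ` B)"
      by (intro connected_continuous_image holomorphic_on_imp_continuous_on qhol) (simp add: B_def)
    \<comment> \<open>The image of the disc is connected, avoids the boundary of G and contains the
      exterior point z.\<close>
    have qB: "q u \<in> - closure G" if "u \<in> B" for u
    proof (rule ccontr)
      assume "q u \<notin> - closure G"
      then have "q ` B \<inter> closure G \<noteq> {}" "q ` B - closure G \<noteq> {}"
        using that t0B qt0 z by auto
      from connected_Int_frontier[OF \<open>connected (q ` B)\<close> this]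
      obtain u' where "u' \<in> B" "q u' \<in> frontier (closure G)" by blast
      then show False using nfr[of u'] interior_mono[OF closure_subset, of G] by (auto simp: frontier_def)
    qed
    define p where "p = (\<lambda>\<zeta>::complex. of_real \<eta> + of_real \<eta> * \<zeta>)"
    have pB: "p \<zeta> \<in> B" if "norm \<zeta> < 1" for \<zeta> using that \<eta> by (simp add: p_def B_def dist_norm norm_mult)
    define f where "f = (\<lambda>\<zeta>. 1 / \<Phi> (q (p \<zeta>)))"
    have "(\<Phi> \<circ> (q \<circ> p)) holomorphic_on ball 0 1"
    proof (rule holomorphic_on_compose_gen[OF holomorphic_on_compose_gen[OF _ qhol]])
      show "p holomorphic_on ball 0 1" unfolding p_def by (intro holomorphic_intros)
      show "p ` ball 0 1 \<subseteq> B" using pB by auto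
      show "\<Phi> holomorphic_on (- closure G)" using \<Phi> by (simp add: exterior_map_def)
      show "(q \<circ> p) ` ball 0 1 \<subseteq> - closure G" using qB pB by fastforce
    qed
    then have "(\<lambda>\<zeta>. \<Phi> (q (p \<zeta>))) holomorphic_on ball 0 1" by (simp add: o_def)
    moreover have \<Phi>1: "norm (\<Phi> (q (p \<zeta>))) > 1" if "norm \<zeta> < 1" for \<zeta> using inv(6)[OF qB[OF pB[OF that]]] .
    ultimately have "f holomorphic_on ball 0 1"
      unfolding f_def by (intro holomorphic_intros) fastforce+
    moreover have "norm (f \<zeta>) < 1" if "norm \<zeta> < 1" for \<zeta>
      using \<Phi>1[OF that] by (simp add: f_def norm_divide divide_less_eq)
    moreover have \<zeta>n: "norm (of_real ((t0 - \<eta>) / \<eta>) :: complex) = 1 - t0 / \<eta>"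
      using t0 \<eta> by (subst norm_of_real) (simp add: abs_if field_simps)
    moreover have \<zeta>l: "norm (of_real ((t0 - \<eta>) / \<eta>) :: complex) < 1" unfolding \<zeta>n using t0p \<eta> by simp
    ultimately have SP: "1 - norm (f (of_real ((t0 - \<eta>) / \<eta>))) \<ge> (1 - norm (f 0)) * (t0 / \<eta>) / 4"
      using Schwarz_Pick_lower[of f "of_real ((t0 - \<eta>) / \<eta>)"] by simp
    have "p (of_real ((t0 - \<eta>) / \<eta>)) = of_real t0" using \<eta> by (simp add: p_def)
    then have fz: "f (of_real ((t0 - \<eta>) / \<eta>)) = 1 / \<Phi> z" by (simp add: f_def qt0)
    have "norm (f 0) \<le> 1 / (1 + e)"
    proof -
      obtain w' where w': "w' \<in> frontier G" "dist (q (of_real \<eta>)) w' = infdist (q (of_real \<eta>)) (closure G)"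
        using nearest_frontier_point[of "q (of_real \<eta>)" G] qB[OF \<eta>B] G by auto
      obtain s where "w' = g s" using w'(1) fr by auto
      then have "infdist (q (of_real \<eta>)) (closure G) \<ge> c0"
        using dist[OF \<eta>B, of s] w'(2) by (simp add: c0_def dist_norm)
      from e(2)[OF qB[OF \<eta>B] this] show ?thesis
        using e(1) by (simp add: f_def p_def norm_divide divide_simps)
    qed
    then have "(1 - 1 / (1 + e)) * (t0 / \<eta>) / 4 \<le> (1 - norm (f 0)) * (t0 / \<eta>) / 4"
      using t0p \<eta> by (intro divide_right_mono mult_right_mono) auto
    with SP fz have "1 - 1 / norm (\<Phi> z) \<ge> (1 - 1 / (1 + e)) * (t0 / \<eta>) / 4" by (simp add: norm_divide)
    also have "(1 - 1 / (1 + e)) * (t0 / \<eta>) / 4 = \<kappa> * t0" by (simp add: \<kappa>_def)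
    finally have "1 - 1 / norm (\<Phi> z) \<ge> \<kappa> * t0" .
    moreover have "\<kappa> * d \<le> \<kappa> * t0" using dt0 \<kappa> by (intro mult_left_mono) auto
    ultimately have k: "\<kappa> * d \<le> 1 - 1 / norm (\<Phi> z)" by linarith
    have y: "norm (\<Phi> z) > 1" using inv(6)[OF z] .
    then have "norm (\<Phi> z) > 0" by linarith
    then have "1 - 1 / norm (\<Phi> z) \<le> norm (\<Phi> z) - 1"
      using zero_le_power2[of "norm (\<Phi> z) - 1"] by (simp add: field_simps power2_eq_square)
    with k show "norm (\<Phi> z) \<ge> 1 + \<kappa> * infdist z (closure G)" unfolding d_def by linarith
  qed (use \<eta> in simp)
qed

end

section \<open>Hoelder classes of periodic functions\<close>

text \<open>The periodic class C(k,\<alpha>), by recursion on the derivative. Restricting the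
  Hoelder bound to |s - t| <= L lets a bounded derivative imply it; periodicity at every level gives
  boundedness from compactness of one period.\<close>

primrec holder_class :: "real \<Rightarrow> real \<Rightarrow> nat \<Rightarrow> (real \<Rightarrow> complex) \<Rightarrow> bool" where
  "holder_class L \<alpha> 0 f \<longleftrightarrow> (\<forall>s. f (s + L) = f s) \<and>
     (\<exists>M. \<forall>s t. \<bar>s - t\<bar> \<le> L \<longrightarrow> norm (f s - f t) \<le> M * \<bar>s - t\<bar> powr \<alpha>)"
| "holder_class L \<alpha> (Suc k) f \<longleftrightarrow> (\<forall>s. f (s + L) = f s) \<and>
     (\<exists>f'. (\<forall>s. (f has_vector_derivative f' s) (at s)) \<and> holder_class L \<alpha> k f')"

lemma holder_class_periodic: "holder_class L \<alpha> k f \<Longrightarrow> f (s + L) = f s"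
  by (cases k) auto

lemma holder_class_continuous:
  assumes "holder_class L \<alpha> k f" and L: "L > 0" and \<alpha>: "\<alpha> > 0"
  shows "continuous_on A f"
proof (cases k)
  case 0
  then obtain M where M: "\<And>s t. \<bar>s - t\<bar> \<le> L \<Longrightarrow> norm (f s - f t) \<le> M * \<bar>s - t\<bar> powr \<alpha>"
    using assms by auto
  have "isCont f t" for t
  proof -
    have "((\<lambda>s. \<bar>s - t\<bar>) \<longlongrightarrow> 0) (at t)" by (auto intro!: tendsto_eq_intros)
    then have "((\<lambda>s. M * \<bar>s - t\<bar> powr \<alpha>) \<longlongrightarrow> M * 0 powr \<alpha>) (at t)"
      using \<alpha> by (intro tendsto_intros tendsto_powr') auto
    then have l: "((\<lambda>s. M * \<bar>s - t\<bar> powr \<alpha>) \<longlongrightarrow> 0) (at t)" by simp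
    have "((\<lambda>s. f s - f t) \<longlongrightarrow> 0) (at t)"
    proof (rule Lim_null_comparison[OF _ l])
      show "\<forall>\<^sub>F s in at t. norm (f s - f t) \<le> M * \<bar>s - t\<bar> powr \<alpha>"
        unfolding eventually_at using L M by (intro exI[of _ L]) (auto simp: dist_real_def)
    qed
    then show ?thesis by (simp add: isCont_def LIM_zero_iff)
  qed
  then show ?thesis by (simp add: continuous_at_imp_continuous_on)
next
  case (Suc k)
  then obtain f' where "\<And>s. (f has_vector_derivative f' s) (at s)" using assms by auto
  then show ?thesis by (intro continuous_at_imp_continuous_on ballI has_vector_derivative_continuous)
qed

lemma holder_class_bounded:
  assumes f: "holder_class L \<alpha> k f" and L: "L > 0" and \<alpha>: "\<alpha> > 0"
  obtains B where "B \<ge> 0" "\<And>s. norm (f s) \<le> B"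
proof -
  have "compact (f ` {0..L})" by (intro compact_continuous_image holder_class_continuous[OF assms]) simp
  then obtain B where B: "\<And>s. s \<in> {0..L} \<Longrightarrow> norm (f s) \<le> B"
    using compact_imp_bounded bounded_iff by (metis imageI)
  have "norm (f s) \<le> B" for s
  proof -
    define k where "k = \<lfloor>s / L\<rfloor>"
    have "of_int k \<le> s / L" "s / L < of_int k + 1" unfolding k_def by linarith+
    then have "s + of_int (- k) * L \<in> {0..L}" using L by (simp add: field_simps)
    from B[OF this] show ?thesis
      using periodic_int[of f L s "- k", OF holder_class_periodic[OF f]] by simp
  qed
  moreover have "B \<ge> 0" using B[of 0] L norm_ge_zero[of "f 0"] by (meson atLeastAtMost_iff less_imp_le order_refl order_trans)
  ultimately show thesis using that by blast
qed

lemma holder_class_SucD: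
  assumes "holder_class L \<alpha> (Suc k) f" and L: "L > 0" and \<alpha>: "0 < \<alpha>" "\<alpha> < 1"
  shows "holder_class L \<alpha> k f"
  using assms(1)
proof (induction k arbitrary: f)
  case 0
  then obtain f' where f': "\<And>s. (f has_vector_derivative f' s) (at s)" "holder_class L \<alpha> 0 f'" by auto
  obtain B where B: "B \<ge> 0" "\<And>s. norm (f' s) \<le> B" by (rule holder_class_bounded[OF f'(2) L \<alpha>(1)]) (rule that)
  have "norm (f s - f t) \<le> (B * L powr (1 - \<alpha>)) * \<bar>s - t\<bar> powr \<alpha>" if "\<bar>s - t\<bar> \<le> L" for s t
  proof (cases "s = t")
    case False
    have "\<bar>s - t\<bar> = \<bar>s - t\<bar> powr (1 - \<alpha>) * \<bar>s - t\<bar> powr \<alpha>"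
      using False by (simp add: powr_add[symmetric])
    also have "\<dots> \<le> L powr (1 - \<alpha>) * \<bar>s - t\<bar> powr \<alpha>"
      using that \<alpha> by (intro mult_right_mono powr_mono2) auto
    finally have "B * \<bar>s - t\<bar> \<le> B * (L powr (1 - \<alpha>) * \<bar>s - t\<bar> powr \<alpha>)"
      using B by (intro mult_left_mono) auto
    with has_vector_derivative_lipschitz[OF f'(1) B(2), of s t] show ?thesis by (simp add: mult.assoc)
  qed simp
  then show ?case using 0 by auto
qed auto

lemma holder_class_mono:
  assumes "holder_class L \<alpha> k f" "j \<le> k" and L: "L > 0" and \<alpha>: "0 < \<alpha>" "\<alpha> < 1"
  shows "holder_class L \<alpha> j f"
  using assms(2,1)
proof (induction rule: inc_induct)
  case (step n)
  then show ?case using holder_class_SucD[OF _ L \<alpha>] by blast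
qed

lemma holder_class_cnj: "holder_class L \<alpha> k f \<Longrightarrow> holder_class L \<alpha> k (\<lambda>s. cnj (f s))"
proof (induction k arbitrary: f)
  case 0
  then show ?case by (simp add: complex_cnj_diff[symmetric] del: complex_cnj_diff)
next
  case (Suc k)
  then obtain f' where "\<And>s. (f has_vector_derivative f' s) (at s)" "holder_class L \<alpha> k f'" "\<And>s. f (s + L) = f s" by auto
  then show ?case using Suc.IH by (auto intro!: exI[of _ "\<lambda>s. cnj (f' s)"] has_vector_derivative_cnj)
qed

lemma holder_class_add: "holder_class L \<alpha> k f \<Longrightarrow> holder_class L \<alpha> k h \<Longrightarrow> holder_class L \<alpha> k (\<lambda>s. f s + h s)"
proof (induction k arbitrary: f h)
  case 0
  then obtain M N where M: "\<And>s t. \<bar>s - t\<bar> \<le> L \<Longrightarrow> norm (f s - f t) \<le> M * \<bar>s - t\<bar> powr \<alpha>"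
    and N: "\<And>s t. \<bar>s - t\<bar> \<le> L \<Longrightarrow> norm (h s - h t) \<le> N * \<bar>s - t\<bar> powr \<alpha>" by auto
  have "norm (f s + h s - (f t + h t)) \<le> (M + N) * \<bar>s - t\<bar> powr \<alpha>" if "\<bar>s - t\<bar> \<le> L" for s t
    using norm_triangle_ineq[of "f s - f t" "h s - h t"] M[OF that] N[OF that] by (simp add: algebra_simps)
  then show ?case using 0 by auto
next
  case (Suc k)
  then obtain f' h' where "\<And>s. (f has_vector_derivative f' s) (at s)" "holder_class L \<alpha> k f'"
    "\<And>s. (h has_vector_derivative h' s) (at s)" "holder_class L \<alpha> k h'" by auto
  then show ?case using Suc by (auto intro!: exI[of _ "\<lambda>s. f' s + h' s"] has_vector_derivative_add)
qed

text \<open>The product rule mixes a function with a derivative of lower class, so the factors are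
  first lowered by \<open>holder_class_SucD\<close>.\<close>

lemma holder_class_mult:
  assumes L: "L > 0" and \<alpha>: "0 < \<alpha>" "\<alpha> < 1"
  shows "holder_class L \<alpha> k f \<Longrightarrow> holder_class L \<alpha> k h \<Longrightarrow> holder_class L \<alpha> k (\<lambda>s. f s * h s)"
proof (induction k arbitrary: f h)
  case 0
  then obtain M N where M: "\<And>s t. \<bar>s - t\<bar> \<le> L \<Longrightarrow> norm (f s - f t) \<le> M * \<bar>s - t\<bar> powr \<alpha>"
    and N: "\<And>s t. \<bar>s - t\<bar> \<le> L \<Longrightarrow> norm (h s - h t) \<le> N * \<bar>s - t\<bar> powr \<alpha>" by auto
  obtain B where B: "B \<ge> 0" "\<And>s. norm (f s) \<le> B" by (rule holder_class_bounded[OF 0(1) L \<alpha>(1)]) (rule that)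
  obtain C where C: "C \<ge> 0" "\<And>s. norm (h s) \<le> C" by (rule holder_class_bounded[OF 0(2) L \<alpha>(1)]) (rule that)
  have "norm (f s * h s - f t * h t) \<le> (B * N + C * M) * \<bar>s - t\<bar> powr \<alpha>" if st: "\<bar>s - t\<bar> \<le> L" for s t
  proof -
    have "f s * h s - f t * h t = f s * (h s - h t) + h t * (f s - f t)" by (simp add: algebra_simps)
    also have "norm \<dots> \<le> norm (f s) * norm (h s - h t) + norm (h t) * norm (f s - f t)"
      by (rule order_trans[OF norm_triangle_ineq]) (simp add: norm_mult)
    also have "\<dots> \<le> B * (N * \<bar>s - t\<bar> powr \<alpha>) + C * (M * \<bar>s - t\<bar> powr \<alpha>)"
      using B C M[OF st] N[OF st] by (intro add_mono mult_mono) auto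
    finally show ?thesis by (simp add: algebra_simps)
  qed
  then show ?case using 0 by auto
next
  case (Suc k)
  then obtain f' h' where f': "\<And>s. (f has_vector_derivative f' s) (at s)" "holder_class L \<alpha> k f'"
    and h': "\<And>s. (h has_vector_derivative h' s) (at s)" "holder_class L \<alpha> k h'" by auto
  have "holder_class L \<alpha> k f" "holder_class L \<alpha> k h" using Suc.prems holder_class_SucD[OF _ L \<alpha>] by blast+
  then have "holder_class L \<alpha> k (\<lambda>s. f s * h' s + f' s * h s)"
    using Suc.IH f' h' by (intro holder_class_add) auto
  moreover have "((\<lambda>s. f s * h s) has_vector_derivative (f s * h' s + f' s * h s)) (at s)" for s
    by (rule has_vector_derivative_mult[OF f'(1) h'(1)])
  ultimately show ?case using Suc.prems by (auto intro!: exI[of _ "\<lambda>s. f s * h' s + f' s * h s"])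
qed

lemma curve_class_imp_holder_class:
  assumes "curve_class q \<alpha> \<Gamma>" and \<alpha>: "0 < \<alpha>" "\<alpha> < 1"
  obtains g g1 L where "L > 0" "inj_on g {0..<L}" "g ` {0..<L} = \<Gamma>" "holder_class L \<alpha> q g"
    "\<And>s. (g has_vector_derivative g1 s) (at s)" "\<And>s. norm (g1 s) = 1" "holder_class L \<alpha> (q - 1) g1"
proof -
  obtain g L d where L: "L > 0" and per: "\<And>s. g (s + L) = g s" and inj: "inj_on g {0..<L}" "g ` {0..<L} = \<Gamma>"
    and d0: "d 0 = g" and d: "\<And>k s. k < q \<Longrightarrow> (d k has_vector_derivative d (Suc k) s) (at s)"
    and u: "\<And>s. norm (d 1 s) = 1" and h: "holder \<alpha> (d q)" and q: "q \<ge> 1"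
    using assms(1) unfolding curve_class_def by blast
  \<comment> \<open>\<open>curve_class\<close> states periodicity for g; uniqueness of derivatives
    passes it on to each d k.\<close>
  have dp: "d k (s + L) = d k s" if "k \<le> q" for k s
    using that
  proof (induction k arbitrary: s)
    case (Suc k)
    have "((\<lambda>s. s + L) has_vector_derivative 1) (at s)" by (auto intro!: derivative_eq_intros)
    from vector_diff_chain_at[OF this d[of k "s + L"]]
    have "((\<lambda>s. d k (s + L)) has_vector_derivative d (Suc k) (s + L)) (at s)"
      using Suc.prems by (simp add: o_def)
    moreover have "(\<lambda>s. d k (s + L)) = d k" using Suc by auto
    ultimately show ?case using d[of k s] Suc.prems vector_derivative_unique_at by fastforce
  qed (simp add: d0 per)
  have hc: "holder_class L \<alpha> (q - k) (d k)" if "k \<le> q" for k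
    using that
  proof (induction rule: inc_induct)
    case base
    then show ?case using h dp[of q] unfolding holder_def by auto
  next
    case (step k)
    then have "q - k = Suc (q - Suc k)" by simp
    then show ?case using step d[of k] dp[of k] by auto
  qed
  show thesis
    by (rule that[OF L inj, of "d 1"]) (use hc[of 0] hc[of 1] d[of 0] d0 u q in auto)
qed

section \<open>Jets of the conjugation along a curve\<close>

text \<open>
  The \<open>j\<close>-th derivative of \<open>z \<mapsto> cnj z\<close> along the curve with respect to the complex variable \<open>z\<close>; the unit
  speed makes \<open>cnj g1\<close> the reciprocal of \<open>g1\<close>.
\<close>
primrec jet :: "(real \<Rightarrow> complex) \<Rightarrow> (real \<Rightarrow> complex) \<Rightarrow> nat \<Rightarrow> real \<Rightarrow> complex" where
  "jet g g1 0 = (\<lambda>s. cnj (g s))"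
| "jet g g1 (Suc j) = (\<lambda>s. cnj (g1 s) * vector_derivative (jet g g1 j) (at s))"

locale holder_curve = smooth_curve +
  fixes \<alpha> :: real and p :: nat
  assumes \<alpha>: "0 < \<alpha>" "\<alpha> < 1" and class_g: "holder_class L \<alpha> (p + 1) g" and class_g1: "holder_class L \<alpha> p g1"
begin

abbreviation \<sigma> where "\<sigma> \<equiv> jet g g1"

text \<open>A Taylor polynomial in z about the curve point g s. For an analytic curve it would be
  that of the Schwarz function.\<close>

definition jet_poly :: "nat \<Rightarrow> real \<Rightarrow> complex \<Rightarrow> complex" where
  "jet_poly m s z = (\<Sum>j\<le>m. \<sigma> j s * (z - g s) ^ j / fact j)"

lemma jet_class: "j \<le> p + 1 \<Longrightarrow> holder_class L \<alpha> (p + 1 - j) (\<sigma> j)"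
proof (induction j)
  case 0
  then show ?case using holder_class_cnj[OF class_g] by simp
next
  case (Suc j)
  then have "holder_class L \<alpha> (Suc (p - j)) (\<sigma> j)" by (simp add: Suc_diff_le)
  then obtain f' where f': "\<And>s. (\<sigma> j has_vector_derivative f' s) (at s)" "holder_class L \<alpha> (p - j) f'" by auto
  have "holder_class L \<alpha> (p - j) (\<lambda>s. cnj (g1 s))"
    by (rule holder_class_mono[OF holder_class_cnj[OF class_g1] _ L \<alpha>]) simp
  then have "holder_class L \<alpha> (p - j) (\<lambda>s. cnj (g1 s) * f' s)"
    by (rule holder_class_mult[OF L \<alpha> _ f'(2)])
  then show ?case by (simp add: vector_derivative_at[OF f'(1)])
qed

lemma jet_deriv:
  assumes "j \<le> p"
  shows "(\<sigma> j has_vector_derivative \<sigma> (Suc j) s * g1 s) (at s)"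
proof -
  have "holder_class L \<alpha> (Suc (p - j)) (\<sigma> j)" using jet_class[of j] assms by (simp add: Suc_diff_le)
  then obtain f' where f': "\<And>s. (\<sigma> j has_vector_derivative f' s) (at s)" by auto
  have 1: "cnj (g1 s) * g1 s = 1" using unit[of s] complex_norm_square[of "g1 s"] by (simp add: mult.commute)
  have "\<sigma> (Suc j) s * g1 s = (cnj (g1 s) * g1 s) * f' s"
    using f' by (simp add: vector_derivative_at mult_ac)
  then show ?thesis using f'[of s] 1 by simp
qed

lemma jet_periodic: "j \<le> p + 1 \<Longrightarrow> \<sigma> j (s + L) = \<sigma> j s"
  using jet_class holder_class_periodic by blast

lemma jet_continuous: "j \<le> p + 1 \<Longrightarrow> continuous_on A (\<sigma> j)"
  using jet_class holder_class_continuous[OF _ L \<alpha>(1)] by blast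

lemma jet_poly_periodic:
  assumes "m \<le> p + 1" shows "jet_poly m (s + of_int k * L) z = jet_poly m s z"
proof -
  have "g (s + of_int k * L) = g s" by (rule periodic_int[of g, OF per])
  moreover have "\<sigma> j (s + of_int k * L) = \<sigma> j s" if "j \<le> m" for j
    using that assms by (intro periodic_int jet_periodic) auto
  ultimately show ?thesis by (simp add: jet_poly_def)
qed

lemma power_has_vector_derivative:
  "((\<lambda>s. (z - g s) ^ Suc m / fact (Suc m)) has_vector_derivative - ((z - g s) ^ m / fact m * g1 s)) (at s)"
proof -
  have 1: "((\<lambda>s. z - g s) has_vector_derivative - g1 s) (at s)"
    using der[of s] by (auto intro!: derivative_eq_intros)
  have 2: "((\<lambda>w. w ^ Suc m / fact (Suc m)) has_field_derivative ((z - g s) ^ m / fact m)) (at (z - g s))"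
  proof -
    have "((\<lambda>w. w ^ Suc m / fact (Suc m)) has_field_derivative (of_nat (Suc m) * (z - g s) ^ m / fact (Suc m))) (at (z - g s))"
    proof -
      have "((\<lambda>w. w ^ Suc m) has_field_derivative of_nat (Suc m) * (z - g s) ^ m) (at (z - g s))"
        by (rule DERIV_power[OF DERIV_ident, THEN DERIV_cong]) (simp del: of_nat_Suc)
      then show ?thesis by (rule DERIV_cdivide)
    qed
    also have "of_nat (Suc m) * (z - g s) ^ m / fact (Suc m) = (z - g s) ^ m / fact m"
      by (simp add: fact_Suc del: of_nat_Suc)
    finally show ?thesis .
  qed
  have "- g1 s * ((z - g s) ^ m / fact m) = - ((z - g s) ^ m / fact m * g1 s)"
    by (simp add: mult.commute)
  with field_vector_diff_chain_at[OF 1 2] show ?thesis unfolding o_def by argo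
qed

lemma jet_poly_Suc: "jet_poly (Suc m) s z = jet_poly m s z + \<sigma> (Suc m) s * ((z - g s) ^ Suc m / fact (Suc m))"
  by (simp add: jet_poly_def)

text \<open>Moving the base point makes all terms telescope except the top one, as in Taylor's
  formula with integral remainder.\<close>

lemma jet_poly_deriv:
  assumes "m \<le> p"
  shows "((\<lambda>s. jet_poly m s z) has_vector_derivative \<sigma> (Suc m) s * g1 s * ((z - g s) ^ m / fact m)) (at s)"
  using assms
proof (induction m)
  case 0
  then show ?case using jet_deriv[of 0 s] by (simp add: jet_poly_def)
next
  case (Suc m)
  have "((\<lambda>s. jet_poly m s z + \<sigma> (Suc m) s * ((z - g s) ^ Suc m / fact (Suc m))) has_vector_derivative
     \<sigma> (Suc m) s * g1 s * ((z - g s) ^ m / fact m) +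
     (\<sigma> (Suc m) s * - ((z - g s) ^ m / fact m * g1 s) + \<sigma> (Suc (Suc m)) s * g1 s * ((z - g s) ^ Suc m / fact (Suc m)))) (at s)"
    using Suc by (intro has_vector_derivative_add has_vector_derivative_mult power_has_vector_derivative jet_deriv) auto
  then show ?case unfolding jet_poly_Suc by (simp add: algebra_simps)
qed

text \<open>As g s0 is nearest to z, the points g s and g s0 are at most 2 |g s - z| apart, so by
  chord-arc the arc between them is at most (2 / c) |g s - z|. Along it the difference gains the
  power \<alpha> from the top coefficient, p from the Taylor factor and 1 from the length.\<close>

lemma jet_difference:
  obtains C where "C \<ge> 0" "\<And>z s s0. s0 \<in> {0..L} \<Longrightarrow> \<forall>u. norm (g s0 - z) \<le> norm (g u - z) \<Longrightarrow>
    norm (jet_poly (Suc p) s z - jet_poly (Suc p) s0 z) \<le> C * norm (g s - z) ^ Suc p * norm (g s - z) powr \<alpha>"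
proof -
  obtain c where c: "c > 0" and ch: "\<And>s t. t \<in> {0..L} \<Longrightarrow> \<bar>s - t\<bar> \<le> L / 2 \<Longrightarrow> norm (g s - g t) \<ge> c * \<bar>s - t\<bar>"
    by (rule chord_arc) (rule that)
  obtain H' where H': "\<And>s t. \<bar>s - t\<bar> \<le> L \<Longrightarrow> norm (\<sigma> (Suc p) s - \<sigma> (Suc p) t) \<le> H' * \<bar>s - t\<bar> powr \<alpha>"
    using jet_class[of "Suc p"] by auto
  define H where "H = max H' 0"
  have H0: "H \<ge> 0" by (simp add: H_def)
  have H: "norm (\<sigma> (Suc p) s - \<sigma> (Suc p) t) \<le> H * \<bar>s - t\<bar> powr \<alpha>" if "\<bar>s - t\<bar> \<le> L" for s t
    by (rule order_trans[OF H'[OF that]]) (simp add: H_def mult_right_mono)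
  \<comment> \<open>On the arc, |z - g u| <= \<rho> + a <= K \<rho>, where \<rho> = |g s - z| and a
    is the arc length.\<close>
  define K where "K = 1 + 2 / c"
  have K: "K \<ge> 1" using c by (simp add: K_def)
  define C where "C = H * (2 / c) powr \<alpha> * (K ^ p * (2 / c) + 1)"
  have C0: "C \<ge> 0" using H0 K c by (simp add: C_def)
  show thesis
  proof (rule that[OF C0])
    fix z s s0 assume s0: "s0 \<in> {0..L}" and min': "\<forall>u. norm (g s0 - z) \<le> norm (g u - z)"
    have min: "norm (g s0 - z) \<le> norm (g u - z)" for u using min' by blast
    obtain k :: int where k: "\<bar>s + of_int k * L - s0\<bar> \<le> L / 2" by (rule exists_representative)
    define r where "r = s + of_int k * L"
    define a where "a = \<bar>r - s0\<bar>"
    define \<rho> where "\<rho> = norm (g s - z)"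
    have rs: "g r = g s" "jet_poly (Suc p) r z = jet_poly (Suc p) s z"
      unfolding r_def by (simp_all add: periodic_int[of g, OF per] jet_poly_periodic)
    have aL: "a \<le> L / 2" "a \<le> L" using k L by (simp_all add: a_def r_def)
    have "norm (g r - g s0) \<le> norm (g s - z) + norm (g s0 - z)"
      unfolding rs using norm_triangle_ineq4[of "g s - z" "g s0 - z"] by simp
    also have "\<dots> \<le> 2 * \<rho>" using min[of s] by (simp add: \<rho>_def)
    finally have "c * a \<le> 2 * \<rho>" using ch[OF s0 aL(1)[unfolded a_def]] by (simp add: a_def)
    then have a\<rho>: "a \<le> 2 / c * \<rho>" using c by (simp add: field_simps)
    have a0: "a \<ge> 0" and \<rho>0: "\<rho> \<ge> 0" by (simp_all add: a_def \<rho>_def)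
    have apow: "a powr \<alpha> \<le> (2 / c) powr \<alpha> * \<rho> powr \<alpha>"
    proof -
      have "a powr \<alpha> \<le> (2 / c * \<rho>) powr \<alpha>" using a\<rho> a0 \<alpha> by (intro powr_mono2) auto
      then show ?thesis using c \<rho>0 powr_mult[of "2 / c" \<rho> \<alpha>] by simp
    qed
    \<comment> \<open>Freezing the top coefficient at \<open>s0\<close> makes the derivative telescope to a Hoelder difference.\<close>
    define Y where "Y = (\<lambda>u. jet_poly p u z + \<sigma> (Suc p) s0 * ((z - g u) ^ Suc p / fact (Suc p)))"
    let ?D = "\<lambda>u. (\<sigma> (Suc p) u - \<sigma> (Suc p) s0) * g1 u * ((z - g u) ^ p / fact p)"
    have dY: "(Y has_vector_derivative ?D u) (at u)" for u
    proof -
      have "(Y has_vector_derivative (\<sigma> (Suc p) u * g1 u * ((z - g u) ^ p / fact p)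
          + \<sigma> (Suc p) s0 * - ((z - g u) ^ p / fact p * g1 u))) (at u)"
        unfolding Y_def
        by (intro has_vector_derivative_add jet_poly_deriv order_refl has_vector_derivative_mult_right power_has_vector_derivative)
      then show ?thesis by (simp add: algebra_simps)
    qed
    have "norm (Y r - Y s0) \<le> (H * a powr \<alpha> * (K * \<rho>) ^ p) * norm (r - s0)"
    proof (rule differentiable_bound[of "closed_segment r s0" Y "\<lambda>u h. h *\<^sub>R (?D u)"])
      fix u assume u: "u \<in> closed_segment r s0"
      show "(Y has_derivative (\<lambda>h. h *\<^sub>R (?D u))) (at u within closed_segment r s0)"
        using dY[of u] unfolding has_vector_derivative_def by (rule has_derivative_at_withinI)
      have us: "\<bar>u - s0\<bar> \<le> a"
        using u unfolding a_def by (auto simp: closed_segment_eq_real_ivl split: if_splits)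
      have 1: "norm (\<sigma> (Suc p) u - \<sigma> (Suc p) s0) \<le> H * a powr \<alpha>"
      proof -
        have "norm (\<sigma> (Suc p) u - \<sigma> (Suc p) s0) \<le> H * \<bar>u - s0\<bar> powr \<alpha>" using us aL by (intro H) auto
        also have "\<dots> \<le> H * a powr \<alpha>" using us H0 \<alpha> by (intro mult_left_mono powr_mono2) auto
        finally show ?thesis .
      qed
      have "norm (z - g u) \<le> norm (g s0 - z) + norm (g u - g s0)"
        using norm_triangle_ineq[of "g s0 - z" "g u - g s0"] by (simp add: norm_minus_commute)
      also have "\<dots> \<le> \<rho> + a" using min[of s] lipschitz[of u s0] us by (simp add: \<rho>_def)
      also have "\<dots> \<le> K * \<rho>" using a\<rho> by (simp add: K_def algebra_simps)
      finally have 2: "norm (z - g u) ^ p \<le> (K * \<rho>) ^ p" by (intro power_mono) auto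
      have "norm (?D u)
          = norm (\<sigma> (Suc p) u - \<sigma> (Suc p) s0) * (norm (z - g u) ^ p / fact p)"
        by (simp add: norm_mult norm_divide norm_power unit)
      also have "\<dots> \<le> (H * a powr \<alpha>) * ((K * \<rho>) ^ p / 1)"
        using 1 2 H0 K \<rho>0 by (intro mult_mono frac_le) (auto simp: fact_ge_1 simp del: jet.simps)
      finally show "onorm (\<lambda>h. h *\<^sub>R (?D u)) \<le> H * a powr \<alpha> * (K * \<rho>) ^ p"
        by (intro onorm_le) (simp add: mult.commute[of _ "\<bar>_\<bar>"] mult_left_mono del: norm_mult)
    qed auto
    also have "\<dots> = H * a powr \<alpha> * (K ^ p * \<rho> ^ p) * a" by (simp add: a_def power_mult_distrib)
    also have "\<dots> \<le> H * ((2 / c) powr \<alpha> * \<rho> powr \<alpha>) * (K ^ p * \<rho> ^ p) * (2 / c * \<rho>)"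
      using apow a\<rho> a0 H0 K \<rho>0 c by (intro mult_mono) auto
    finally have Y1: "norm (Y r - Y s0) \<le> (H * (2 / c) powr \<alpha> * (K ^ p * (2 / c))) * (\<rho> ^ Suc p * \<rho> powr \<alpha>)"
      by (simp add: mult_ac)
    have "jet_poly (Suc p) r z - Y r = (\<sigma> (Suc p) r - \<sigma> (Suc p) s0) * ((z - g r) ^ Suc p / fact (Suc p))"
      unfolding jet_poly_Suc Y_def left_diff_distrib by (simp del: jet.simps power_Suc fact_Suc)
    also have "norm \<dots> = norm (\<sigma> (Suc p) r - \<sigma> (Suc p) s0) * (norm (z - g r) ^ Suc p / fact (Suc p))"
      by (simp only: norm_mult norm_divide norm_power norm_fact)
    also have "\<dots> \<le> (H * ((2 / c) powr \<alpha> * \<rho> powr \<alpha>)) * (\<rho> ^ Suc p / 1)"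
    proof (intro mult_mono frac_le)
      have "norm (\<sigma> (Suc p) r - \<sigma> (Suc p) s0) \<le> H * a powr \<alpha>" unfolding a_def using aL by (intro H) (simp add: a_def)
      also have "\<dots> \<le> H * ((2 / c) powr \<alpha> * \<rho> powr \<alpha>)" using apow H0 by (intro mult_left_mono) auto
      finally show "norm (\<sigma> (Suc p) r - \<sigma> (Suc p) s0) \<le> H * ((2 / c) powr \<alpha> * \<rho> powr \<alpha>)" .
      show "norm (z - g r) ^ Suc p \<le> \<rho> ^ Suc p" by (simp add: rs \<rho>_def norm_minus_commute)
    qed (use H0 \<rho>0 in \<open>auto simp del: fact_Suc simp: fact_ge_1\<close>)
    finally have Y2: "norm (jet_poly (Suc p) r z - Y r) \<le> H * (2 / c) powr \<alpha> * (\<rho> ^ Suc p * \<rho> powr \<alpha>)"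
      by (simp add: mult_ac)
    have Y0: "Y s0 = jet_poly (Suc p) s0 z" by (simp only: Y_def jet_poly_Suc)
    have "norm (jet_poly (Suc p) s z - jet_poly (Suc p) s0 z) \<le> norm (jet_poly (Suc p) r z - Y r) + norm (Y r - Y s0)"
      unfolding Y0[symmetric] rs(2)[symmetric] using norm_triangle_ineq[of "jet_poly (Suc p) r z - Y r" "Y r - Y s0"] by simp
    also have "\<dots> \<le> C * (\<rho> ^ Suc p * \<rho> powr \<alpha>)"
      using Y1 Y2 by (simp add: C_def algebra_simps)
    finally show "norm (jet_poly (Suc p) s z - jet_poly (Suc p) s0 z) \<le> C * norm (g s - z) ^ Suc p * norm (g s - z) powr \<alpha>"
      by (simp add: \<rho>_def mult.assoc)
  qed
qed

text \<open>The constant term cnj (g s) misses cnj z by |g s - z|, and all other terms contain a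
  factor z - g s.\<close>

lemma jet_near_conjugate:
  obtains C where "C \<ge> 0" "\<And>z s. norm (g s - z) \<le> 1 \<Longrightarrow> norm (jet_poly (Suc p) s z - cnj z) \<le> C * norm (g s - z)"
proof -
  have "\<exists>B. B \<ge> 0 \<and> (\<forall>s. norm (\<sigma> j s) \<le> B)" if "j \<le> Suc p" for j
    using that holder_class_bounded[OF jet_class[of j] L \<alpha>(1)] by (metis Suc_eq_plus1)
  then obtain B where B: "\<And>j. j \<le> Suc p \<Longrightarrow> B j \<ge> 0" "\<And>j s. j \<le> Suc p \<Longrightarrow> norm (\<sigma> j s) \<le> B j" by metis
  define C where "C = 1 + (\<Sum>j\<le>p. B (Suc j))"
  have "C \<ge> 0" unfolding C_def using B(1) by (intro add_nonneg_nonneg sum_nonneg) auto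
  moreover have "norm (jet_poly (Suc p) s z - cnj z) \<le> C * norm (g s - z)" if n: "norm (g s - z) \<le> 1" for s z
  proof -
    let ?t = "\<lambda>j. \<sigma> (Suc j) s * (z - g s) ^ Suc j / fact (Suc j)"
    have "jet_poly (Suc p) s z = cnj (g s) + (\<Sum>j\<le>p. ?t j)"
      unfolding jet_poly_def by (subst sum.atMost_Suc_shift) simp
    then have "jet_poly (Suc p) s z - cnj z = cnj (g s - z) + (\<Sum>j\<le>p. ?t j)"
      by simp
    then have "norm (jet_poly (Suc p) s z - cnj z) \<le> norm (g s - z) + norm (\<Sum>j\<le>p. ?t j)"
      by (metis norm_triangle_ineq complex_mod_cnj)
    also have "norm (\<Sum>j\<le>p. ?t j) \<le> (\<Sum>j\<le>p. B (Suc j) * norm (g s - z))"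
    proof (rule sum_norm_le)
      fix j assume j: "j \<in> {..p}"
      have "norm (?t j) = norm (\<sigma> (Suc j) s) * (norm (g s - z) ^ Suc j / fact (Suc j))"
        by (simp only: norm_mult norm_divide norm_power norm_fact norm_minus_commute[of z] times_divide_eq_right)
      also have "\<dots> \<le> B (Suc j) * (norm (g s - z) / 1)"
      proof (intro mult_mono frac_le)
        show "norm (g s - z) ^ Suc j \<le> norm (g s - z)"
          using n power_le_one[of "norm (g s - z)" j] by (simp add: mult_left_le)
      qed (use B[of "Suc j"] j in \<open>auto simp del: fact_Suc jet.simps simp: fact_ge_1\<close>)
      finally show "norm (?t j) \<le> B (Suc j) * norm (g s - z)" by simp
    qed
    finally show ?thesis by (simp add: C_def sum_distrib_right[symmetric] algebra_simps)
  qed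
  ultimately show thesis using that by blast
qed

end

section \<open>Weighted means of the jets\<close>

text \<open>Differentiation under the integral for a product of a holomorphic and an antiholomorphic
  factor. The derivative is only real linear, hence the bounded linear maps over the reals.\<close>

lemma has_derivative_integral_wirtinger:
  fixes P P' Q Q' :: "complex \<Rightarrow> real \<Rightarrow> complex"
  assumes W: "open W" "z \<in> W"
    and P: "\<And>z s. z \<in> W \<Longrightarrow> s \<in> {a..b} \<Longrightarrow> ((\<lambda>z. P z s) has_field_derivative P' z s) (at z)"
    and Q: "\<And>z s. z \<in> W \<Longrightarrow> s \<in> {a..b} \<Longrightarrow> ((\<lambda>z. Q z s) has_field_derivative Q' z s) (at z)"
    and cont: "continuous_on (W \<times> {a..b}) (\<lambda>x. P (fst x) (snd x))" "continuous_on (W \<times> {a..b}) (\<lambda>x. P' (fst x) (snd x))"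
      "continuous_on (W \<times> {a..b}) (\<lambda>x. Q (fst x) (snd x))" "continuous_on (W \<times> {a..b}) (\<lambda>x. Q' (fst x) (snd x))"
  shows "((\<lambda>z. integral {a..b} (\<lambda>s. P z s * cnj (Q z s))) has_derivative
     (\<lambda>h. integral {a..b} (\<lambda>s. P' z s * cnj (Q z s)) * h + integral {a..b} (\<lambda>s. P z s * cnj (Q' z s)) * cnj h)) (at z)"
proof -
  obtain r where r: "r > 0" "ball z r \<subseteq> W" using W openE by blast
  define J where "J = Blinfun cnj"
  have J: "blinfun_apply J = cnj" unfolding J_def by (rule bounded_linear_Blinfun_apply[OF bounded_linear_cnj])
  define fx where "fx = (\<lambda>w s. blinfun_mult_right (P' w s * cnj (Q w s)) + (blinfun_mult_right (P w s * cnj (Q' w s)) o\<^sub>L J))"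
  have fx_apply: "blinfun_apply (fx w s) h = P' w s * cnj (Q w s) * h + P w s * cnj (Q' w s) * cnj h" for w s h
    by (simp add: fx_def blinfun.add_left J)
  have sub: "ball z r \<times> {a..b} \<subseteq> W \<times> {a..b}" using r by auto
  note c = cont[THEN continuous_on_subset, OF sub]
  have cfx: "continuous_on (ball z r \<times> {a..b}) (\<lambda>x. fx (fst x) (snd x))"
    unfolding fx_def by (intro continuous_intros c)
  have cpq: "continuous_on (ball z r \<times> {a..b}) (\<lambda>x. P (fst x) (snd x) * cnj (Q (fst x) (snd x)))"
    by (intro continuous_intros c)
  have slice: "continuous_on {a..b} (\<lambda>s. F w s)" if "continuous_on (ball z r \<times> {a..b}) (\<lambda>x. F (fst x) (snd x))" "w \<in> ball z r"
    for F :: "complex \<Rightarrow> real \<Rightarrow> 'd::topological_space" and w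
  proof -
    have "continuous_on {a..b} (\<lambda>s. (w, s))" by (intro continuous_intros)
    moreover have "(\<lambda>s. (w, s)) ` {a..b} \<subseteq> ball z r \<times> {a..b}" using that(2) by auto
    ultimately show ?thesis using continuous_on_compose2[OF that(1), of "{a..b}" "\<lambda>s. (w, s)"] by simp
  qed
  have "((\<lambda>w. integral (cbox a b) (\<lambda>s. P w s * cnj (Q w s))) has_derivative integral (cbox a b) (fx z)) (at z within ball z r)"
  proof (rule leibniz_rule)
    fix w s assume w: "w \<in> ball z r" and s: "s \<in> cbox a b"
    then have "w \<in> W" "s \<in> {a..b}" using r by auto
    from P[OF this] Q[OF this]
    have "((\<lambda>w. P w s * cnj (Q w s)) has_derivative (\<lambda>h. P w s * cnj (Q' w s * h) + P' w s * h * cnj (Q w s))) (at w)"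
      unfolding has_field_derivative_def
      by (intro has_derivative_mult has_derivative_cnj)
    then have "((\<lambda>w. P w s * cnj (Q w s)) has_derivative blinfun_apply (fx w s)) (at w)"
      by (rule has_derivative_eq_rhs) (auto simp: fx_apply algebra_simps)
    then show "((\<lambda>w. P w s * cnj (Q w s)) has_derivative blinfun_apply (fx w s)) (at w within ball z r)"
      by (rule has_derivative_at_withinI)
  next
    show "(\<lambda>s. P w s * cnj (Q w s)) integrable_on cbox a b" if "w \<in> ball z r" for w
      using slice[OF cpq that] by (intro integrable_continuous) simp
    show "continuous_on (ball z r \<times> cbox a b) (\<lambda>(w, s). fx w s)"
      using cfx by (simp add: split_def)
  qed (use r in auto)
  then have d: "((\<lambda>w. integral {a..b} (\<lambda>s. P w s * cnj (Q w s))) has_derivative integral {a..b} (fx z)) (at z)"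
    using r by (simp add: at_within_open[of z "ball z r"])
  have zr: "z \<in> ball z r" using r by simp
  have "blinfun_apply (integral {a..b} (fx z)) h = integral {a..b} (\<lambda>s. P' z s * cnj (Q z s)) * h + integral {a..b} (\<lambda>s. P z s * cnj (Q' z s)) * cnj h" for h
  proof -
    have "fx z integrable_on {a..b}" by (intro integrable_continuous_real slice[OF cfx zr])
    from integral_linear[OF this blinfun.bounded_linear_left[of h]]
    have "blinfun_apply (integral {a..b} (fx z)) h = integral {a..b} (\<lambda>s. P' z s * cnj (Q z s) * h + P z s * cnj (Q' z s) * cnj h)"
      by (simp add: o_def fx_apply)
    also have "\<dots> = integral {a..b} (\<lambda>s. P' z s * cnj (Q z s) * h) + integral {a..b} (\<lambda>s. P z s * cnj (Q' z s) * cnj h)"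
      by (intro integral_add integrable_continuous_real continuous_intros slice[OF c(1) zr] slice[OF c(2) zr] slice[OF c(3) zr] slice[OF c(4) zr])
    finally show ?thesis by simp
  qed
  then show ?thesis by (intro has_derivative_eq_rhs[OF d]) auto
qed

lemma continuous_on_integral_wirtinger:
  fixes P Q :: "complex \<Rightarrow> real \<Rightarrow> complex"
  assumes "continuous_on (W \<times> {a..b}) (\<lambda>x. P (fst x) (snd x))" "continuous_on (W \<times> {a..b}) (\<lambda>x. Q (fst x) (snd x))"
  shows "continuous_on W (\<lambda>z. integral {a..b} (\<lambda>s. P z s * cnj (Q z s)))"
proof -
  have "continuous_on (W \<times> {a..b}) (\<lambda>x. P (fst x) (snd x) * cnj (Q (fst x) (snd x)))"
    by (intro continuous_intros assms)
  then show ?thesis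
    using integral_continuous_on_param[of W a b "\<lambda>z s. P z s * cnj (Q z s)"] by (simp add: split_def)
qed

lemma integral_complex_of_real_on:
  "f integrable_on A \<Longrightarrow> integral A (\<lambda>s. complex_of_real (f s)) = of_real (integral A f)"
  by (intro integral_unique has_integral_of_real integrable_integral)

text \<open>As \<rho> / d >= 1, a fractional power may be traded for any larger integer power, so
  that the kernel integrals involve integer exponents.\<close>

lemma powr_le_power_quotient:
  fixes \<rho> d \<beta> :: real
  assumes "0 < d" "d \<le> \<rho>" "\<beta> \<le> real k"
  shows "\<rho> powr \<beta> \<le> d powr \<beta> * (\<rho> / d) ^ k"
proof -
  have "(\<rho> / d) powr \<beta> \<le> (\<rho> / d) powr (real k)" using assms by (intro powr_mono) auto
  also have "\<dots> = (\<rho> / d) ^ k" using assms by (intro powr_realpow) auto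
  finally have "d powr \<beta> * (\<rho> / d) powr \<beta> \<le> d powr \<beta> * (\<rho> / d) ^ k" by (intro mult_left_mono) auto
  moreover have "d powr \<beta> * (\<rho> / d) powr \<beta> = \<rho> powr \<beta>" using assms by (simp add: powr_divide)
  ultimately show ?thesis by simp
qed

lemma integral_inverse_square_le:
  fixes d x L :: real
  assumes d: "d > 0" and L: "L \<ge> 0"
  shows "(\<lambda>s. 1 / (d\<^sup>2 + (s - x)\<^sup>2)) integrable_on {0..L}" "integral {0..L} (\<lambda>s. 1 / (d\<^sup>2 + (s - x)\<^sup>2)) \<le> pi / d"
proof -
  have I: "((\<lambda>s. 1 / (d\<^sup>2 + (s - x)\<^sup>2)) has_integral (arctan ((L - x) / d) / d - arctan ((0 - x) / d) / d)) {0..L}"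
  proof (rule fundamental_theorem_of_calculus[OF L])
    fix s
    have "1 + ((s - x) / d)\<^sup>2 > 0" by (smt (verit) zero_le_power2)
    moreover have "d\<^sup>2 + (s - x)\<^sup>2 = d\<^sup>2 * (1 + ((s - x) / d)\<^sup>2)" using d by (simp add: field_simps)
    ultimately have "((\<lambda>s. arctan ((s - x) / d) / d) has_real_derivative 1 / (d\<^sup>2 + (s - x)\<^sup>2)) (at s within {0..L})"
      using d by (auto intro!: derivative_eq_intros simp: power2_eq_square divide_simps)
    then show "((\<lambda>s. arctan ((s - x) / d) / d) has_vector_derivative 1 / (d\<^sup>2 + (s - x)\<^sup>2)) (at s within {0..L})"
      by (simp add: has_real_derivative_iff_has_vector_derivative)
  qed
  then show "(\<lambda>s. 1 / (d\<^sup>2 + (s - x)\<^sup>2)) integrable_on {0..L}" by blast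
  have "arctan ((L - x) / d) - arctan ((0 - x) / d) \<le> pi"
    using arctan_bounded[of "(L - x) / d"] arctan_bounded[of "(0 - x) / d"] by linarith
  then show "integral {0..L} (\<lambda>s. 1 / (d\<^sup>2 + (s - x)\<^sup>2)) \<le> pi / d"
    unfolding integral_unique[OF I] using d by (simp add: diff_divide_distrib[symmetric] divide_right_mono)
qed

section \<open>The kernel, the weighted means and their size near the curve\<close>

context holder_curve
begin

text \<open>In the term j = 0 the truncated exponent j - 1 is harmless, since the factor
  \<open>of_nat j\<close> vanishes.\<close>

definition jet_poly' :: "real \<Rightarrow> complex \<Rightarrow> complex" where
  "jet_poly' s z = (\<Sum>j\<le>Suc p. \<sigma> j s * (of_nat j * (z - g s) ^ (j - 1)) / fact j)"

text \<open>Holomorphic in z, so that |weight|^2 splits into a holomorphic and an antiholomorphic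
  factor. With exponent p + 2, a factor |g s - z|^(-2) is still left after the jet differences have
  been absorbed.\<close>

definition weight :: "complex \<Rightarrow> real \<Rightarrow> complex" where "weight z s = inverse ((z - g s) ^ (p + 2))"

definition weight' :: "complex \<Rightarrow> real \<Rightarrow> complex" where "weight' z s = - of_nat (p + 2) * inverse ((z - g s) ^ (p + 3))"

lemma jet_poly_field_derivative: "((\<lambda>z. jet_poly (Suc p) s z) has_field_derivative jet_poly' s z) (at z)"
  unfolding jet_poly_def jet_poly'_def
proof (rule DERIV_sum)
  fix j
  have "((\<lambda>z. (z - g s) ^ j) has_field_derivative of_nat j * (1 * (z - g s) ^ (j - Suc 0))) (at z)"
    by (rule DERIV_power) (auto intro!: derivative_eq_intros)
  from DERIV_cdivide[OF DERIV_cmult[OF this, of "\<sigma> j s"], of "fact j"]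
  show "((\<lambda>z. \<sigma> j s * (z - g s) ^ j / fact j) has_field_derivative \<sigma> j s * (of_nat j * (z - g s) ^ (j - 1)) / fact j) (at z)"
    by simp
qed

lemma weight_field_derivative:
  assumes "z \<notin> range g" shows "((\<lambda>z. weight z s) has_field_derivative weight' z s) (at z)"
proof -
  have nz: "z - g s \<noteq> 0" using assms by auto
  have "((\<lambda>z. (z - g s) ^ (p + 2)) has_field_derivative of_nat (p + 2) * (1 * (z - g s) ^ (p + 2 - Suc 0))) (at z)"
    by (rule DERIV_power) (auto intro!: derivative_eq_intros)
  then have 1: "((\<lambda>z. inverse ((z - g s) ^ (p + 2))) has_field_derivative
     - (inverse ((z - g s) ^ (p + 2)) * (of_nat (p + 2) * (1 * (z - g s) ^ (p + 2 - Suc 0))) * inverse ((z - g s) ^ (p + 2)))) (at z)"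
    by (rule DERIV_inverse') (use nz in simp)
  have alg: "inverse (w ^ (p + 2)) * (of_nat (p + 2) * (1 * w ^ (p + 2 - Suc 0))) * inverse (w ^ (p + 2))
     = of_nat (p + 2) * inverse (w ^ (p + 3))" if "w \<noteq> 0" for w :: complex
    using that by (simp add: divide_simps power2_eq_square power3_eq_cube power_add)
  show ?thesis unfolding weight_def weight'_def
    by (rule DERIV_cong[OF 1]) (simp only: alg[OF nz] minus_mult_left)
qed

lemma range_compact: "compact (range g)"
proof -
  have "range g = g ` {0..L}" using range_eq L by (metis atLeastLessThan_subseteq_atLeastAtMost_iff image_mono order_refl subset_UNIV subset_antisym)
  then show ?thesis using compact_continuous_image[OF cont compact_Icc] by simp
qed

lemma joint_continuous:
  "continuous_on (X \<times> Y) (\<lambda>x. jet_poly (Suc p) (snd x) (fst x))"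
  "continuous_on (X \<times> Y) (\<lambda>x. jet_poly' (snd x) (fst x))"
  "X \<subseteq> - range g \<Longrightarrow> continuous_on (X \<times> Y) (\<lambda>x. weight (fst x) (snd x))"
  "X \<subseteq> - range g \<Longrightarrow> continuous_on (X \<times> Y) (\<lambda>x. weight' (fst x) (snd x))"
proof -
  have cg: "continuous_on (X \<times> Y) (\<lambda>x. fst x - g (snd x))"
    by (intro continuous_intros continuous_on_compose2[OF cont[of UNIV]]) auto
  have cs: "continuous_on (X \<times> Y) (\<lambda>x. \<sigma> j (snd x))" if "j \<le> Suc p" for j
    by (rule continuous_on_compose2[OF jet_continuous[of j UNIV]]) (use that in \<open>auto intro!: continuous_intros\<close>)
  show "continuous_on (X \<times> Y) (\<lambda>x. jet_poly (Suc p) (snd x) (fst x))"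
    unfolding jet_poly_def by (intro continuous_intros cg cs) auto
  show "continuous_on (X \<times> Y) (\<lambda>x. jet_poly' (snd x) (fst x))"
    unfolding jet_poly'_def by (intro continuous_intros cg cs) auto
  assume "X \<subseteq> - range g"
  then have nz: "fst x - g (snd x) \<noteq> 0" if "x \<in> X \<times> Y" for x using that by auto
  show "continuous_on (X \<times> Y) (\<lambda>x. weight (fst x) (snd x))"
    unfolding weight_def by (intro continuous_on_inverse continuous_intros cg) (use nz in auto)
  show "continuous_on (X \<times> Y) (\<lambda>x. weight' (fst x) (snd x))"
    unfolding weight'_def by (intro continuous_on_inverse continuous_intros cg) (use nz in auto)
qed

lemma slice_continuous:
  assumes "z \<notin> range g"
  shows "continuous_on Y (\<lambda>s. jet_poly (Suc p) s z)" "continuous_on Y (\<lambda>s. jet_poly' s z)"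
    "continuous_on Y (weight z)" "continuous_on Y (weight' z)" "continuous_on Y (\<lambda>s. norm (g s - z))"
proof -
  have c: "continuous_on Y (\<lambda>s. F z s)" if "continuous_on ({z} \<times> Y) (\<lambda>x. F (fst x) (snd x))" for F :: "complex \<Rightarrow> real \<Rightarrow> complex"
  proof -
    have "continuous_on Y (\<lambda>s. (z, s))" by (intro continuous_intros)
    moreover have "(\<lambda>s. (z, s)) ` Y \<subseteq> {z} \<times> Y" by auto
    ultimately show ?thesis using continuous_on_compose2[OF that, of Y "\<lambda>s. (z, s)"] by simp
  qed
  show "continuous_on Y (\<lambda>s. jet_poly (Suc p) s z)" "continuous_on Y (\<lambda>s. jet_poly' s z)"
    "continuous_on Y (weight z)" "continuous_on Y (weight' z)"
    using c[of "\<lambda>z s. jet_poly (Suc p) s z"] c[of "\<lambda>z s. jet_poly' s z"] c[of weight] c[of weight'] joint_continuous[of "{z}" Y] assms by auto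
  show "continuous_on Y (\<lambda>s. norm (g s - z))" by (intro continuous_intros cont)
qed

text \<open>
  \<open>num / den\<close> is the mean of the jets over the curve with weight \<open>\<bar>z - g s\<bar>\<close> to the power \<open>-2 (p + 2)\<close>, which
  concentrates on the points whose distance to \<open>z\<close> is comparable to the distance \<open>d\<close> from \<open>z\<close> to the curve.
  As each jet is holomorphic in \<open>z\<close>, only differences of jets enter the \<open>cnj z\<close>-derivative, and these are
  of order \<open>d\<close> to the power \<open>p + 1 + \<alpha>\<close>. The suffixes \<open>_z\<close> and \<open>_zbar\<close> denote Wirtinger derivatives.
\<close>
definition num where "num z = integral {0..L} (\<lambda>s. jet_poly (Suc p) s z * weight z s * cnj (weight z s))"
definition num_z where "num_z z = integral {0..L} (\<lambda>s. (jet_poly' s z * weight z s + jet_poly (Suc p) s z * weight' z s) * cnj (weight z s))"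
definition num_zbar where "num_zbar z = integral {0..L} (\<lambda>s. jet_poly (Suc p) s z * weight z s * cnj (weight' z s))"
definition den where "den z = integral {0..L} (\<lambda>s. weight z s * cnj (weight z s))"
definition den_z where "den_z z = integral {0..L} (\<lambda>s. weight' z s * cnj (weight z s))"
definition den_zbar where "den_zbar z = integral {0..L} (\<lambda>s. weight z s * cnj (weight' z s))"

lemma open_compl: "open (- range g)"
  using range_compact compact_imp_closed by blast

lemma num_derivative:
  assumes "z \<notin> range g" shows "(num has_derivative (\<lambda>h. num_z z * h + num_zbar z * cnj h)) (at z)"
proof -
  let ?P = "\<lambda>z s. jet_poly (Suc p) s z * weight z s" and ?P' = "\<lambda>z s. jet_poly' s z * weight z s + jet_poly (Suc p) s z * weight' z s"
  have "((\<lambda>z. integral {0..L} (\<lambda>s. ?P z s * cnj (weight z s))) has_derivative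
     (\<lambda>h. integral {0..L} (\<lambda>s. ?P' z s * cnj (weight z s)) * h + integral {0..L} (\<lambda>s. ?P z s * cnj (weight' z s)) * cnj h)) (at z)"
  proof (rule has_derivative_integral_wirtinger[OF open_compl])
    show "((\<lambda>z. ?P z s) has_field_derivative ?P' z s) (at z)" if "z \<in> - range g" for z s
      using DERIV_mult[OF jet_poly_field_derivative[of s z] weight_field_derivative[of z s]] that by (simp add: algebra_simps)
  qed (use assms weight_field_derivative in \<open>auto intro!: continuous_intros joint_continuous\<close>)
  then show ?thesis by (simp add: num_def[abs_def] num_z_def num_zbar_def)
qed

lemma den_derivative:
  assumes "z \<notin> range g" shows "(den has_derivative (\<lambda>h. den_z z * h + den_zbar z * cnj h)) (at z)"
proof -
  have "((\<lambda>z. integral {0..L} (\<lambda>s. weight z s * cnj (weight z s))) has_derivative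
     (\<lambda>h. integral {0..L} (\<lambda>s. weight' z s * cnj (weight z s)) * h + integral {0..L} (\<lambda>s. weight z s * cnj (weight' z s)) * cnj h)) (at z)"
    by (rule has_derivative_integral_wirtinger[OF open_compl])
       (use assms weight_field_derivative in \<open>auto intro!: joint_continuous\<close>)
  then show ?thesis by (simp add: den_def[abs_def] den_z_def den_zbar_def)
qed

lemma num_den_continuous:
  "continuous_on (- range g) num" "continuous_on (- range g) num_z" "continuous_on (- range g) num_zbar"
  "continuous_on (- range g) den" "continuous_on (- range g) den_z" "continuous_on (- range g) den_zbar"
  unfolding num_def[abs_def] num_z_def[abs_def] num_zbar_def[abs_def] den_def[abs_def] den_z_def[abs_def] den_zbar_def[abs_def]
  by (rule continuous_on_integral_wirtinger; intro continuous_intros joint_continuous order_refl)+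

text \<open>By chord-arc the integrand is dominated by Cauchy kernels 1 / (d^2 + (s - s0)^2), each
  with integral at most pi / d.\<close>

lemma inverse_square_integral:
  obtains K where "K \<ge> 0" "\<And>z s0. z \<notin> range g \<Longrightarrow> s0 \<in> {0..L} \<Longrightarrow> \<forall>u. norm (g s0 - z) \<le> norm (g u - z) \<Longrightarrow>
     integral {0..L} (\<lambda>s. 1 / (norm (g s - z))\<^sup>2) \<le> K / norm (g s0 - z)"
proof -
  obtain c where c: "c > 0" and ch: "\<And>s t. t \<in> {0..L} \<Longrightarrow> \<bar>s - t\<bar> \<le> L / 2 \<Longrightarrow> norm (g s - g t) \<ge> c * \<bar>s - t\<bar>"
    by (rule chord_arc) (rule that)
  define K0 where "K0 = 1 + 4 / c\<^sup>2"
  have K0: "K0 > 0" by (simp add: K0_def add_pos_nonneg)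
  show thesis
  proof (rule that[of "3 * pi * K0"])
    show "0 \<le> 3 * pi * K0" using K0 by simp
    fix z s0 assume z: "z \<notin> range g" and s0: "s0 \<in> {0..L}" and min': "\<forall>u. norm (g s0 - z) \<le> norm (g u - z)"
    have min: "norm (g s0 - z) \<le> norm (g u - z)" for u using min' by blast
    define d where "d = norm (g s0 - z)"
    have d: "d > 0" using z by (auto simp: d_def)
    \<comment> \<open>Three shifts by j L suffice: s and s0 lie in one period, so a representative
      within L / 2 of s0 differs from s by -L, 0 or L.\<close>
    define e where "e = (\<lambda>j s. 1 / (d\<^sup>2 + (s - (s0 - j * L))\<^sup>2))"
    have e0: "e j s \<ge> 0" for j s unfolding e_def using d by (intro divide_nonneg_pos add_pos_nonneg) auto
    have pw: "1 / (norm (g s - z))\<^sup>2 \<le> K0 * (e (-1) s + e 0 s + e 1 s)" if s: "s \<in> {0..L}" for s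
    proof -
      define \<rho> where "\<rho> = norm (g s - z)"
      have d\<rho>: "d \<le> \<rho>" using min by (simp add: d_def \<rho>_def)
      obtain k :: int where k: "\<bar>s + of_int k * L - s0\<bar> \<le> L / 2" by (rule exists_representative)
      define r where "r = s + of_int k * L"
      have gr: "g r = g s" unfolding r_def by (rule periodic_int[of g, OF per])
      have rL: "\<bar>r - s0\<bar> \<le> L / 2" using k by (simp add: r_def)
      have "of_int k * L \<le> 3 / 2 * L" "- (3 / 2) * L \<le> of_int k * L"
        using abs_le_D1[OF k] abs_le_D2[OF k] s s0 by auto
      then have "(of_int k :: real) \<le> 3 / 2" "- (3 / 2) \<le> (of_int k :: real)"
        using L by (simp_all only: mult_le_cancel_right_pos)
      then have "k \<le> 1" "-1 \<le> k" by linarith+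
      then have kk: "k = -1 \<or> k = 0 \<or> k = 1" by linarith
      have "norm (g r - g s0) \<le> norm (g s - z) + norm (g s0 - z)"
        unfolding gr using norm_triangle_ineq4[of "g s - z" "g s0 - z"] by simp
      then have "c * \<bar>r - s0\<bar> \<le> 2 * \<rho>" using ch[OF s0 rL] d\<rho> by (simp add: d_def \<rho>_def)
      then have "\<bar>r - s0\<bar> \<le> 2 * \<rho> / c" using c by (simp add: field_simps)
      then have "\<bar>r - s0\<bar>\<^sup>2 \<le> (2 * \<rho> / c)\<^sup>2" by (rule power_mono) simp
      moreover have "d\<^sup>2 \<le> \<rho>\<^sup>2" using d\<rho> d by (intro power_mono) auto
      ultimately have le: "d\<^sup>2 + (r - s0)\<^sup>2 \<le> K0 * \<rho>\<^sup>2"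
        by (simp add: K0_def power_divide power_mult_distrib algebra_simps)
      have pos: "d\<^sup>2 + (r - s0)\<^sup>2 > 0" using d by (intro add_pos_nonneg) auto
      have \<rho>0: "\<rho> > 0" using d d\<rho> by linarith
      have "1 / \<rho>\<^sup>2 \<le> K0 * (1 / (d\<^sup>2 + (r - s0)\<^sup>2))"
        using le pos \<rho>0 by (simp add: divide_simps mult.commute)
      also have "1 / (d\<^sup>2 + (r - s0)\<^sup>2) = e (of_int k) s"
        unfolding e_def r_def by (simp add: algebra_simps)
      also have "K0 * e (of_int k) s \<le> K0 * (e (-1) s + e 0 s + e 1 s)"
        using kk e0[of "-1" s] e0[of 0 s] e0[of 1 s] K0 by (intro mult_left_mono) auto
      finally show ?thesis by (simp add: \<rho>_def)
    qed
    have ei: "e j integrable_on {0..L}" "integral {0..L} (e j) \<le> pi / d" for j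
      unfolding e_def using integral_inverse_square_le[OF d less_imp_le[OF L]] by blast+
    have "integral {0..L} (\<lambda>s. 1 / (norm (g s - z))\<^sup>2) \<le> integral {0..L} (\<lambda>s. K0 * (e (-1) s + e 0 s + e 1 s))"
    proof (rule integral_le[OF _ _ pw])
      show "(\<lambda>s. 1 / (norm (g s - z))\<^sup>2) integrable_on {0..L}"
        using z by (intro integrable_continuous_real continuous_intros slice_continuous) auto
      show "(\<lambda>s. K0 * (e (-1) s + e 0 s + e 1 s)) integrable_on {0..L}"
        by (intro integrable_on_mult_right integrable_add ei)
    qed
    also have "\<dots> = K0 * (integral {0..L} (e (-1)) + integral {0..L} (e 0) + integral {0..L} (e 1))"
      by (simp add: integral_add integrable_add ei)
    also have "\<dots> \<le> K0 * (pi / d + pi / d + pi / d)"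
      using K0 by (intro mult_left_mono add_mono ei) auto
    finally show "integral {0..L} (\<lambda>s. 1 / (norm (g s - z))\<^sup>2) \<le> 3 * pi * K0 / norm (g s0 - z)"
      by (simp add: d_def field_simps)
  qed
qed

lemma norm_weight: "norm (weight z s) = 1 / norm (g s - z) ^ (p + 2)"
  by (simp add: weight_def norm_inverse norm_power norm_divide norm_mult norm_minus_commute[of z "g s"] inverse_eq_divide)

lemma norm_weight': "norm (weight' z s) = real (p + 2) / norm (g s - z) ^ (p + 3)"
proof -
  have "norm (weight' z s) = norm (of_nat (p + 2) :: complex) * norm (inverse ((z - g s) ^ (p + 3)))"
    unfolding weight'_def norm_mult norm_minus_cancel ..
  then show ?thesis unfolding norm_of_nat
    by (simp add: norm_inverse norm_power norm_divide norm_minus_commute[of z "g s"] inverse_eq_divide)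
qed

text \<open>On an arc of length d ending at s0 the distance to z is at most 2 d, as g is
  1-Lipschitz. The condition d <= L / 2 ensures that such an arc fits into the period on one of the
  two sides.\<close>

lemma den_lower:
  assumes z: "z \<notin> range g" and s0: "s0 \<in> {0..L}" and d: "norm (g s0 - z) \<le> L / 2"
  shows "1 / (2 ^ (2 * p + 4) * norm (g s0 - z) ^ (2 * p + 3)) \<le> norm (den z)"
proof -
  define d where "d = norm (g s0 - z)"
  have d0: "d > 0" using z by (auto simp: d_def)
  define f where "f = (\<lambda>s. 1 / norm (g s - z) ^ (2 * p + 4))"
  have qq: "weight z s * cnj (weight z s) = of_real (f s)" for s
    unfolding complex_norm_square[symmetric] norm_weight f_def
    by (simp add: power_divide power_mult[symmetric] algebra_simps power_add)
  have nz: "norm (g s - z) \<noteq> 0" for s using z by auto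
  have cf: "continuous_on Y f" for Y
    unfolding f_def by (intro continuous_intros slice_continuous z) (use nz in auto)
  have f0: "f s \<ge> 0" for s by (simp add: f_def)
  have "den z = of_real (integral {0..L} f)"
    unfolding den_def qq using cf by (simp add: integral_complex_of_real_on integrable_continuous_real)
  then have "norm (den z) = \<bar>integral {0..L} f\<bar>" by simp
  also have "\<dots> = integral {0..L} f" using f0 cf by (simp add: integral_nonneg integrable_continuous_real)
  finally have Nf: "norm (den z) = integral {0..L} f" .
  define a where "a = (if s0 + d \<le> L then s0 else s0 - d)"
  have sub: "{a..a + d} \<subseteq> {0..L}" using s0 d0 d by (auto simp: a_def d_def[symmetric])
  have "1 / (2 * d) ^ (2 * p + 4) \<le> f s" if s: "s \<in> {a..a + d}" for s
  proof -
    have "\<bar>s - s0\<bar> \<le> d" using s d0 by (auto simp: a_def split: if_splits)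
    then have "norm (g s - z) \<le> 2 * d"
      using norm_triangle_ineq[of "g s - g s0" "g s0 - z"] lipschitz[of s s0] by (simp add: d_def)
    then have "norm (g s - z) ^ (2 * p + 4) \<le> (2 * d) ^ (2 * p + 4)" by (intro power_mono) auto
    then show ?thesis unfolding f_def using nz[of s] d0 by (intro divide_left_mono mult_pos_pos) auto
  qed
  then have "integral {a..a + d} (\<lambda>s. 1 / (2 * d) ^ (2 * p + 4)) \<le> integral {a..a + d} f"
    using cf by (intro integral_le) (auto intro: integrable_continuous_real)
  also have "\<dots> \<le> integral {0..L} f"
    using sub cf f0 by (intro integral_subset_le) (auto intro: integrable_continuous_real)
  also have "integral {a..a + d} (\<lambda>s. 1 / (2 * d) ^ (2 * p + 4)) = d * (1 / (2 * d) ^ (2 * p + 4))"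
    using d0 by simp
  also have "\<dots> = 1 / (2 ^ (2 * p + 4) * d ^ (2 * p + 3))"
  proof -
    have "(2 * d) ^ (2 * p + 4) = 2 ^ (2 * p + 4) * (d ^ (2 * p + 3) * d)"
      unfolding power_mult_distrib by (simp add: power_add power3_eq_cube power4_eq_xxxx mult_ac)
    then show ?thesis using d0 by simp
  qed
  finally show ?thesis unfolding Nf d_def .
qed

text \<open>An almost holomorphic Schwarz function. The next two formulas are its Wirtinger
  derivatives by the quotient rule.\<close>

definition schwarz where "schwarz z = num z / den z"
definition schwarz_z where "schwarz_z z = (num_z z * den z - num z * den_z z) / (den z * den z)"
definition schwarz_zbar where "schwarz_zbar z = (num_zbar z * den z - num z * den_zbar z) / (den z * den z)"

lemma den_nonzero:
  assumes z: "z \<notin> range g" shows "den z \<noteq> 0"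
proof -
  define f where "f = (\<lambda>s. (norm (weight z s))\<^sup>2)"
  have cf: "continuous_on {0..L} f" unfolding f_def by (intro continuous_intros slice_continuous z)
  have "den z = of_real (integral {0..L} f)"
    unfolding den_def complex_norm_square[symmetric] f_def[symmetric] using cf
    by (simp add: f_def integral_complex_of_real_on integrable_continuous_real flip: of_real_power)
  moreover have "integral {0..L} f \<noteq> 0"
  proof
    assume "integral {0..L} f = 0"
    then have "f 0 = 0"
      using integral_eq_0_iff[OF cf L] L by (auto simp: f_def)
    then show False using z by (auto simp: f_def weight_def)
  qed
  ultimately show ?thesis by simp
qed

lemma schwarz_derivative:
  assumes z: "z \<notin> range g" shows "(schwarz has_derivative (\<lambda>h. schwarz_z z * h + schwarz_zbar z * cnj h)) (at z)"
proof -
  have "(schwarz has_derivative (\<lambda>h. ((num_z z * h + num_zbar z * cnj h) * den z - num z * (den_z z * h + den_zbar z * cnj h)) / (den z * den z))) (at z)"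
    unfolding schwarz_def[abs_def] by (rule has_derivative_divide'[OF num_derivative[OF z] den_derivative[OF z] den_nonzero[OF z]])
  then show ?thesis
    by (rule has_derivative_eq_rhs) (auto simp: schwarz_z_def schwarz_zbar_def add_divide_distrib diff_divide_distrib algebra_simps)
qed

lemma schwarz_continuous:
  "continuous_on (- range g) schwarz_z" "continuous_on (- range g) schwarz_zbar" "continuous_on (- range g) schwarz"
  unfolding schwarz_z_def[abs_def] schwarz_zbar_def[abs_def] schwarz_def[abs_def]
  by (intro continuous_intros num_den_continuous; use den_nonzero in auto)+

text \<open>Subtracting the jet \<open>T0\<close> at the nearest parameter leaves the cnj
  z-derivative of the quotient unchanged, since \<open>T0\<close> only multiplies \<open>den\<close>
  and \<open>den_zbar\<close>. What remains are jet differences, integrated against the kernel and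
  divided by the lower bound of \<open>den\<close>.\<close>

lemma schwarz_estimates:
  obtains C \<delta> where "C \<ge> 0" "\<delta> > 0"
    "\<And>z s0. z \<notin> range g \<Longrightarrow> s0 \<in> {0..L} \<Longrightarrow> \<forall>u. norm (g s0 - z) \<le> norm (g u - z) \<Longrightarrow> norm (g s0 - z) \<le> \<delta> \<Longrightarrow>
      norm (schwarz_zbar z) \<le> C * norm (g s0 - z) powr (real p + \<alpha>)"
    "\<And>z s0. z \<notin> range g \<Longrightarrow> s0 \<in> {0..L} \<Longrightarrow> \<forall>u. norm (g s0 - z) \<le> norm (g u - z) \<Longrightarrow> norm (g s0 - z) \<le> \<delta> \<Longrightarrow>
      norm (schwarz z - cnj z) \<le> C * norm (g s0 - z)"
proof -
  obtain K where K0: "K \<ge> 0" and K: "\<And>z s0. z \<notin> range g \<Longrightarrow> s0 \<in> {0..L} \<Longrightarrow> \<forall>u. norm (g s0 - z) \<le> norm (g u - z) \<Longrightarrow>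
     integral {0..L} (\<lambda>s. 1 / (norm (g s - z))\<^sup>2) \<le> K / norm (g s0 - z)"
    by (rule inverse_square_integral) (rule that)
  obtain C1 where C10: "C1 \<ge> 0" and C1: "\<And>z s s0. s0 \<in> {0..L} \<Longrightarrow> \<forall>u. norm (g s0 - z) \<le> norm (g u - z) \<Longrightarrow>
    norm (jet_poly (Suc p) s z - jet_poly (Suc p) s0 z) \<le> C1 * norm (g s - z) ^ Suc p * norm (g s - z) powr \<alpha>"
    by (rule jet_difference) (rule that)
  obtain C2 where C20: "C2 \<ge> 0" and C2: "\<And>z s. norm (g s - z) \<le> 1 \<Longrightarrow> norm (jet_poly (Suc p) s z - cnj z) \<le> C2 * norm (g s - z)"
    by (rule jet_near_conjugate) (rule that)
  define c where "c = (2::real) ^ (2 * p + 4)"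
  have c: "c > 0" by (simp add: c_def)
  define m where "m = real (p + 2)"
  have m0: "m \<ge> 0" by (simp add: m_def)
  define C3 where "C3 = C1 * m * K * c + C1 * K * (m * K) * c\<^sup>2"
  define C4 where "C4 = C1 * K * c + C2"
  have C3: "C3 \<ge> 0" and C4: "C4 \<ge> 0" using C10 C20 K0 c m0 by (simp_all add: C3_def C4_def)
  have main: "norm (schwarz_zbar z) \<le> C3 * norm (g s0 - z) powr (real p + \<alpha>)" "norm (schwarz z - cnj z) \<le> C4 * norm (g s0 - z)"
    if z: "z \<notin> range g" and s0: "s0 \<in> {0..L}" and min': "\<forall>u. norm (g s0 - z) \<le> norm (g u - z)"
      and small: "norm (g s0 - z) \<le> min 1 (L / 2)" for z s0
  proof -
    have min: "norm (g s0 - z) \<le> norm (g u - z)" for u using min' by blast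
    define d where "d = norm (g s0 - z)"
    define X where "X = d powr (real p + \<alpha>)"
    define T0 where "T0 = jet_poly (Suc p) s0 z"
    have d0: "d > 0" using z by (auto simp: d_def)
    have d1: "d \<le> 1" "d \<le> L / 2" using small by (simp_all add: d_def)
    have X0: "X \<ge> 0" by (simp add: X_def)
    have X1: "X \<le> 1" unfolding X_def using d0 d1 \<alpha> by (intro powr_le1) auto
    have \<rho>: "norm (g s - z) \<ge> d" for s using min by (simp add: d_def)
    have \<rho>0: "norm (g s - z) > 0" for s using \<rho>[of s] d0 by linarith
    have bound: "norm (integral {0..L} F) \<le> B * K / d"
      if F: "continuous_on {0..L} F" "\<And>s. norm (F s) \<le> B * (1 / (norm (g s - z))\<^sup>2)" and B: "B \<ge> 0" for F :: "real \<Rightarrow> complex" and B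
    proof -
      have i: "(\<lambda>s. 1 / (norm (g s - z))\<^sup>2) integrable_on {0..L}"
        using z by (intro integrable_continuous_real continuous_intros slice_continuous) auto
      have "norm (integral {0..L} F) \<le> integral {0..L} (\<lambda>s. B * (1 / (norm (g s - z))\<^sup>2))"
        by (rule integral_norm_bound_integral) (intro F integrable_continuous_real integrable_on_mult_right i)+
      also have "\<dots> = B * integral {0..L} (\<lambda>s. 1 / (norm (g s - z))\<^sup>2)" by (rule integral_mult_right)
      also have "\<dots> \<le> B * (K / d)" unfolding d_def using B by (intro mult_left_mono K z s0 min') auto
      finally show ?thesis by simp
    qed
    have jd: "norm (jet_poly (Suc p) s z - T0) \<le> C1 * (X * (norm (g s - z) ^ Suc k / d ^ k))" if "real p + \<alpha> \<le> real k" for s k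
    proof -
      let ?r = "norm (g s - z)"
      have "norm (jet_poly (Suc p) s z - T0) \<le> C1 * ?r ^ Suc p * ?r powr \<alpha>" unfolding T0_def by (rule C1[OF s0 min'])
      also have "\<dots> = C1 * (?r * ?r powr (real p + \<alpha>))"
        using \<rho>0[of s] by (simp add: powr_add powr_realpow)
      also have "\<dots> \<le> C1 * (?r * (X * (?r / d) ^ k))"
        unfolding X_def using C10 \<rho>0[of s] by (intro mult_left_mono powr_le_power_quotient d0 \<rho> that) auto
      finally show ?thesis by (simp add: power_divide mult_ac)
    qed
    note cont = slice_continuous[OF z, of "{0..L}"]
    have int: "(\<lambda>s. weight z s * cnj (weight z s)) integrable_on {0..L}" "(\<lambda>s. weight z s * cnj (weight' z s)) integrable_on {0..L}"
      "(\<lambda>s. jet_poly (Suc p) s z * weight z s * cnj (weight z s)) integrable_on {0..L}" "(\<lambda>s. jet_poly (Suc p) s z * weight z s * cnj (weight' z s)) integrable_on {0..L}"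
      by (intro integrable_continuous_real continuous_intros cont)+
    have ratio: "r ^ Suc k / r ^ (k + 3) = 1 / r\<^sup>2" if "r > 0" for r :: real and k
      using that by (simp add: power_add power2_eq_square power3_eq_cube)
    have rearrange: "a * (b * (u / v)) * (e / w) = a * e * b / v * (u / w)"
      "a * (b * (u / v)) * (1 / w) = a * b / v * (u / w)" for a b e u v w :: real
      by (simp_all add: mult_ac)
    \<comment> \<open>The integer power k = 2 p + 2 leaves exactly |g s - z|^(-2) in the integrand;
      for \<open>E2\<close>, whose kernel has one power less, it is k = 2 p + 1. Both exceed p +
      \<alpha> because \<alpha> < 1.\<close>
    have E1: "norm (num_zbar z - T0 * den_zbar z) \<le> (C1 * m * X / d ^ (2 * p + 2)) * K / d"
    proof -
      have "num_zbar z - T0 * den_zbar z = integral {0..L} (\<lambda>s. (jet_poly (Suc p) s z - T0) * weight z s * cnj (weight' z s))"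
        unfolding num_zbar_def den_zbar_def using int(2,4)
        by (simp add: left_diff_distrib integral_diff integrable_on_mult_right mult.assoc)
      also have "norm \<dots> \<le> (C1 * m * X / d ^ (2 * p + 2)) * K / d"
      proof (rule bound)
        fix s let ?r = "norm (g s - z)"
        have "norm ((jet_poly (Suc p) s z - T0) * weight z s * cnj (weight' z s)) = norm (jet_poly (Suc p) s z - T0) * (m / (?r ^ (p + 2) * ?r ^ (p + 3)))"
          by (simp add: norm_mult norm_weight norm_weight' m_def)
        also have "\<dots> \<le> C1 * (X * (?r ^ Suc (2 * p + 2) / d ^ (2 * p + 2))) * (m / (?r ^ (p + 2) * ?r ^ (p + 3)))"
          using \<alpha> m0 by (intro mult_right_mono jd) auto
        also have "?r ^ (p + 2) * ?r ^ (p + 3) = ?r ^ (2 * p + 2 + 3)"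
          unfolding power_add[symmetric] by (rule arg_cong[of _ _ "\<lambda>k. ?r ^ k"]) simp
        also note rearrange(1)
        finally show "norm ((jet_poly (Suc p) s z - T0) * weight z s * cnj (weight' z s)) \<le> C1 * m * X / d ^ (2 * p + 2) * (1 / ?r\<^sup>2)"
          unfolding ratio[OF \<rho>0] .
      qed (use C10 m0 X0 d0 in \<open>auto intro!: continuous_intros cont\<close>)
      finally show ?thesis .
    qed
    have E2: "norm (num z - T0 * den z) \<le> (C1 * X / d ^ (2 * p + 1)) * K / d"
    proof -
      have "num z - T0 * den z = integral {0..L} (\<lambda>s. (jet_poly (Suc p) s z - T0) * weight z s * cnj (weight z s))"
        unfolding num_def den_def using int(1,3)
        by (simp add: left_diff_distrib integral_diff integrable_on_mult_right mult.assoc)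
      also have "norm \<dots> \<le> (C1 * X / d ^ (2 * p + 1)) * K / d"
      proof (rule bound)
        fix s let ?r = "norm (g s - z)"
        have "norm ((jet_poly (Suc p) s z - T0) * weight z s * cnj (weight z s)) = norm (jet_poly (Suc p) s z - T0) * (1 / (?r ^ (p + 2) * ?r ^ (p + 2)))"
          by (simp add: norm_mult norm_weight)
        also have "\<dots> \<le> C1 * (X * (?r ^ Suc (2 * p + 1) / d ^ (2 * p + 1))) * (1 / (?r ^ (p + 2) * ?r ^ (p + 2)))"
          using \<alpha> by (intro mult_right_mono jd) auto
        also have "?r ^ (p + 2) * ?r ^ (p + 2) = ?r ^ (2 * p + 1 + 3)"
          unfolding power_add[symmetric] by (rule arg_cong[of _ _ "\<lambda>k. ?r ^ k"]) simp
        also note rearrange(2)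
        finally show "norm ((jet_poly (Suc p) s z - T0) * weight z s * cnj (weight z s)) \<le> C1 * X / d ^ (2 * p + 1) * (1 / ?r\<^sup>2)"
          unfolding ratio[OF \<rho>0] .
      qed (use C10 X0 d0 in \<open>auto intro!: continuous_intros cont\<close>)
      finally show ?thesis .
    qed
    have E3: "norm (den_zbar z) \<le> (m / d ^ (2 * p + 3)) * K / d"
      unfolding den_zbar_def
    proof (rule bound)
      fix s let ?r = "norm (g s - z)"
      have "norm (weight z s * cnj (weight' z s)) = m / (?r ^ (p + 2) * ?r ^ (p + 3))"
        by (simp add: norm_mult norm_weight norm_weight' m_def)
      also have "?r ^ (p + 2) * ?r ^ (p + 3) = ?r ^ (2 * p + 3) * ?r\<^sup>2"
        unfolding power_add[symmetric] by (rule arg_cong[of _ _ "\<lambda>k. ?r ^ k"]) simp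
      also have "m / (?r ^ (2 * p + 3) * ?r\<^sup>2) \<le> m / (d ^ (2 * p + 3) * ?r\<^sup>2)"
        using m0 d0 \<rho>0[of s] \<rho>[of s] by (intro divide_left_mono mult_right_mono power_mono mult_pos_pos) auto
      finally show "norm (weight z s * cnj (weight' z s)) \<le> m / d ^ (2 * p + 3) * (1 / ?r\<^sup>2)" by simp
    qed (use m0 d0 in \<open>auto intro!: continuous_intros cont\<close>)
    have Nl: "norm (den z) \<ge> 1 / (c * d ^ (2 * p + 3))"
      unfolding c_def d_def by (rule den_lower[OF z s0]) (use d1 in \<open>simp add: d_def\<close>)
    have N0: "norm (den z) > 0" using den_nonzero[OF z] by simp
    have Ninv: "1 / norm (den z) \<le> c * d ^ (2 * p + 3)"
    proof -
      have "1 / norm (den z) \<le> 1 / (1 / (c * d ^ (2 * p + 3)))"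
        using Nl N0 c d0 by (intro divide_left_mono mult_pos_pos) auto
      then show ?thesis by simp
    qed
    have Ninv0: "1 / norm (den z) \<ge> 0" by simp
    have dp: "d ^ (2 * p + 2) * d = d ^ (2 * p + 3)" "d ^ (2 * p + 1) * d = d ^ (2 * p + 2)" "d ^ (2 * p + 3) * d = d ^ (2 * p + 4)"
      by (simp_all add: power_add power2_eq_square power3_eq_cube power4_eq_xxxx)
    have "schwarz_zbar z = (num_zbar z - T0 * den_zbar z) / den z - (num z - T0 * den z) * den_zbar z / (den z * den z)"
      unfolding schwarz_zbar_def using den_nonzero[OF z] by (simp add: divide_simps) (simp add: algebra_simps)
    then have "norm (schwarz_zbar z) \<le> norm (num_zbar z - T0 * den_zbar z) * (1 / norm (den z)) + norm (num z - T0 * den z) * norm (den_zbar z) * (1 / norm (den z) * (1 / norm (den z)))"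
      using norm_triangle_ineq4[of "(num_zbar z - T0 * den_zbar z) / den z" "(num z - T0 * den z) * den_zbar z / (den z * den z)"]
      by (simp add: norm_divide norm_mult)
    also have "norm (num_zbar z - T0 * den_zbar z) * (1 / norm (den z)) \<le> ((C1 * m * X / d ^ (2 * p + 2)) * K / d) * (c * d ^ (2 * p + 3))"
      using d0 C10 m0 X0 K0 by (intro mult_mono E1 Ninv) auto
    also have "\<dots> = C1 * m * K * c * X" unfolding dp(1)[symmetric] using d0 by (simp add: field_simps)
    also have "norm (num z - T0 * den z) * norm (den_zbar z) * (1 / norm (den z) * (1 / norm (den z))) \<le>
        ((C1 * X / d ^ (2 * p + 1)) * K / d) * ((m / d ^ (2 * p + 3)) * K / d) * ((c * d ^ (2 * p + 3)) * (c * d ^ (2 * p + 3)))"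
      using d0 C10 m0 X0 K0 c by (intro mult_mono E2 E3 Ninv) auto
    also have "\<dots> = C1 * K * (m * K) * c\<^sup>2 * X"
      unfolding dp(1)[symmetric] dp(2)[symmetric] using d0 by (simp add: field_simps power2_eq_square)
    finally show "norm (schwarz_zbar z) \<le> C3 * norm (g s0 - z) powr (real p + \<alpha>)"
      by (simp add: C3_def X_def d_def algebra_simps)
    have "norm (schwarz z - T0) = norm (num z - T0 * den z) * (1 / norm (den z))"
      unfolding schwarz_def using den_nonzero[OF z] by (simp add: norm_divide[symmetric] divide_simps)
    also have "\<dots> \<le> ((C1 * X / d ^ (2 * p + 1)) * K / d) * (c * d ^ (2 * p + 3))"
      using d0 C10 X0 K0 by (intro mult_mono E2 Ninv) auto
    also have "\<dots> = C1 * K * c * d * X"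
      unfolding dp(1)[symmetric] dp(2)[symmetric] using d0 by (simp add: field_simps)
    also have "\<dots> \<le> C1 * K * c * d * 1"
      using C10 K0 c d0 X1 by (intro mult_left_mono) auto
    finally have "norm (schwarz z - T0) \<le> C1 * K * c * d" by simp
    moreover have "norm (T0 - cnj z) \<le> C2 * d"
      unfolding T0_def d_def using d1 by (intro C2) (simp add: d_def)
    ultimately show "norm (schwarz z - cnj z) \<le> C4 * norm (g s0 - z)"
      using norm_triangle_ineq[of "schwarz z - T0" "T0 - cnj z"] by (simp add: C4_def d_def algebra_simps)
  qed
  show thesis
  \<comment> \<open>The 1 serves \<open>jet_near_conjugate\<close> and d powr (p + \<alpha>) <= 1;
    the L / 2 serves \<open>den_lower\<close>.\<close>
  proof (rule that[of "max C3 C4" "min 1 (L / 2)"])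
    fix z s0 assume a: "z \<notin> range g" "s0 \<in> {0..L}" "\<forall>u. norm (g s0 - z) \<le> norm (g u - z)" "norm (g s0 - z) \<le> min 1 (L / 2)"
    show "norm (schwarz_zbar z) \<le> max C3 C4 * norm (g s0 - z) powr (real p + \<alpha>)"
      by (rule order_trans[OF main(1)[OF a]]) (auto intro!: mult_right_mono)
    show "norm (schwarz z - cnj z) \<le> max C3 C4 * norm (g s0 - z)"
      by (rule order_trans[OF main(2)[OF a]]) (auto intro!: mult_right_mono)
  qed (use C3 L in auto)
qed

end

section \<open>Curves in a Hoelder class\<close>

text \<open>The logarithm is bounded by its tangent at a + 1 rather than at the maximiser a, so that
  a = 0 needs no separate case.\<close>

lemma powr_exp_bound:
  fixes a y :: real
  assumes "a \<ge> 0" "y \<ge> 0"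
  shows "y powr a * exp (- y) \<le> (a + 1) powr a"
proof (cases "y = 0")
  case False
  then have y: "y > 0" using assms by simp
  have "ln (y / (a + 1)) \<le> y / (a + 1) - 1" using y assms by (intro ln_le_minus_one) simp
  then have "ln y \<le> ln (a + 1) + y / (a + 1)" using y assms by (simp add: ln_div)
  then have "a * ln y \<le> a * (ln (a + 1) + y / (a + 1))" using assms by (intro mult_left_mono) auto
  also have "a * (ln (a + 1) + y / (a + 1)) \<le> a * ln (a + 1) + y"
    using assms by (simp add: field_simps)
  finally have "exp (a * ln y) \<le> exp (a * ln (a + 1)) * exp y" by (simp add: exp_add[symmetric])
  then have "exp (a * ln y) * exp (- y) \<le> exp (a * ln (a + 1)) * exp y * exp (- y)"
    by (rule mult_right_mono) simp
  then show ?thesis using y assms by (simp add: powr_def mult.assoc exp_minus)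
qed (use assms in simp)

context holder_curve
begin

lemma coeff_bound_holder_curve:
  assumes G: "open G" "G \<noteq> {}" "bounded G" and fr: "frontier G = g ` {0..<L}" and \<Phi>: "exterior_map G \<Phi> \<gamma>"
  obtains C where "C \<ge> 0" "\<And>b n. exterior_inverse_coeffs G \<Phi> \<gamma> b \<Longrightarrow> n \<ge> 1 \<Longrightarrow>
    norm (b n) \<le> C * (1 / real n powr (real p + \<alpha> + 1 / 2))"
proof -
  define \<Psi> where "\<Psi> = the_inv_into (- closure G) \<Phi>"
  note inv = exterior_inverse[OF \<Phi>, folded \<Psi>_def]
  define \<beta> where "\<beta> = real p + \<alpha>"
  have \<beta>: "\<beta> > 0" using \<alpha> by (simp add: \<beta>_def)
  obtain CS \<delta>1 where CS: "CS \<ge> 0" and \<delta>1: "\<delta>1 > 0"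
    and Sb_le: "\<And>z s0. z \<notin> range g \<Longrightarrow> s0 \<in> {0..L} \<Longrightarrow> \<forall>u. norm (g s0 - z) \<le> norm (g u - z) \<Longrightarrow> norm (g s0 - z) \<le> \<delta>1 \<Longrightarrow>
      norm (schwarz_zbar z) \<le> CS * norm (g s0 - z) powr (real p + \<alpha>)"
    and S_le: "\<And>z s0. z \<notin> range g \<Longrightarrow> s0 \<in> {0..L} \<Longrightarrow> \<forall>u. norm (g s0 - z) \<le> norm (g u - z) \<Longrightarrow> norm (g s0 - z) \<le> \<delta>1 \<Longrightarrow>
      norm (schwarz z - cnj z) \<le> CS * norm (g s0 - z)"
    by (rule schwarz_estimates) (rule that)
  obtain c \<delta>2 where c: "c > 0" and \<delta>2: "\<delta>2 > 0"
    and growth: "\<And>z. z \<in> - closure G \<Longrightarrow> infdist z (closure G) \<le> \<delta>2 \<Longrightarrow> norm (\<Phi> z) \<ge> 1 + c * infdist z (closure G)"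
    by (rule exterior_map_boundary_growth[OF G(1,2) fr \<Phi>]) (rule that)
  define \<delta> where "\<delta> = min \<delta>1 \<delta>2"
  have \<delta>: "\<delta> > 0" using \<delta>1 \<delta>2 by (simp add: \<delta>_def)
  obtain e where e: "e > 0" and away: "\<And>z. z \<in> - closure G \<Longrightarrow> infdist z (closure G) \<ge> \<delta> \<Longrightarrow> norm (\<Phi> z) \<ge> 1 + e"
    by (rule exterior_map_away_from_boundary[OF \<Phi> \<delta>]) (rule that)
  \<comment> \<open>For Re z < x1 one has |\<Phi> (H z)| < 1 + e, which forces H z into the
    \<delta>-neighbourhood of the closure of G where both local estimates hold. The line x0 lies
    inside this strip.\<close>
  define x1 where "x1 = min 1 (ln (1 + e))"
  have x1: "x1 > 0" "x1 \<le> 1" using e by (simp_all add: x1_def)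
  have "exp x1 \<le> exp (ln (1 + e))" unfolding x1_def by (subst exp_le_cancel_iff) simp
  then have ex1: "exp x1 \<le> 1 + e" using e by simp
  define x0 where "x0 = x1 / 2"
  have x0: "x0 > 0" "x0 < x1" "x0 \<le> 1" using x1 by (simp_all add: x0_def)
  obtain M where M: "\<And>z. z \<in> closure G \<Longrightarrow> norm z \<le> M" using G(3) bounded_closure bounded_iff by metis
  define R where "R = \<bar>M\<bar> + \<delta>"
  have R: "R \<ge> 0" using \<delta> by (simp add: R_def)
  define U where "U = {z::complex. Re z > 0}"
  define H where "H = (\<lambda>z. \<Psi> (exp z))"
  have U: "open U" unfolding U_def by (rule open_halfspace_Re_gt)
  have hol: "H holomorphic_on U"
  proof -
    have "(\<Psi> \<circ> exp) holomorphic_on U"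
      by (rule holomorphic_on_compose_gen[OF _ inv(1)]) (auto simp: U_def holomorphic_on_exp)
    then show ?thesis by (simp add: H_def o_def)
  qed
  have HG: "H z \<in> - closure G" "norm (\<Phi> (H z)) = exp (Re z)" if "z \<in> U" for z
    using inv(3)[of "exp z"] inv(4)[of "exp z"] that by (auto simp: H_def U_def)
  have Hr: "H z \<notin> range g" if "z \<in> U" for z
    using HG(1)[OF that] fr unfolding range_eq[symmetric] by (auto simp: frontier_def)
  define C5 where "C5 = CS * (2 / c) powr \<beta>"
  define C6 where "C6 = CS * (2 / c)"
  have C56: "C5 \<ge> 0" "C6 \<ge> 0" using CS c by (simp_all add: C5_def C6_def)
  have near: "norm (schwarz_zbar (H z)) \<le> C5 * Re z powr \<beta>" "norm (schwarz (H z) - cnj (H z)) \<le> C6 * Re z" "norm (H z) \<le> R"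
    if z: "0 < Re z" "Re z < x1" for z
  proof -
    have zU: "z \<in> U" using z by (simp add: U_def)
    have "norm (\<Phi> (H z)) < 1 + e"
      using HG(2)[OF zU] z(2) ex1 by (metis exp_less_cancel_iff less_le_trans)
    then have small: "infdist (H z) (closure G) < \<delta>" using away[OF HG(1)[OF zU]] by (meson not_le)
    obtain w where w: "w \<in> frontier G" "dist (H z) w = infdist (H z) (closure G)"
      using nearest_frontier_point[of "H z" G] HG(1)[OF zU] G(2) by auto
    obtain s0 where "s0 \<in> {0..<L}" "w = g s0" using w(1) fr by blast
    then have s0: "s0 \<in> {0..L}" "w = g s0" by auto
    define d where "d = norm (g s0 - H z)"
    have d: "d = infdist (H z) (closure G)" using w(2) s0(2) by (simp add: d_def dist_norm norm_minus_commute)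
    have min: "\<forall>u. norm (g s0 - H z) \<le> norm (g u - H z)"
    proof
      fix u
      have "g u \<in> frontier G" unfolding fr range_eq by simp
      then have "d \<le> dist (H z) (g u)" unfolding d by (intro infdist_le) (auto simp: frontier_def)
      then show "norm (g s0 - H z) \<le> norm (g u - H z)" by (simp add: d_def dist_norm norm_minus_commute)
    qed
    have d\<delta>: "d \<le> \<delta>1" "d \<le> \<delta>2" "d \<le> \<delta>" using small d by (simp_all add: \<delta>_def)
    have "1 + c * d \<le> exp (Re z)"
      using growth[OF HG(1)[OF zU]] d\<delta>(2) HG(2)[OF zU] unfolding d by simp
    \<comment> \<open>As Re z <= 1, this gives exp (Re z) - 1 <= 2 Re z, the 2 of the factor 2 /
      c.\<close>
    also have "exp (Re z) \<le> 1 + Re z + (Re z)\<^sup>2" using z x1 by (intro exp_bound) auto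
    also have "(Re z)\<^sup>2 \<le> Re z" using z x1 by (simp add: power2_eq_square mult_left_le)
    finally have "c * d \<le> 2 * Re z" by simp
    then have dx: "d \<le> 2 / c * Re z" using c by (simp add: field_simps)
    have d0: "d \<ge> 0" by (simp add: d_def)
    have "norm (schwarz_zbar (H z)) \<le> CS * d powr \<beta>"
      unfolding d_def \<beta>_def by (rule Sb_le[OF Hr[OF zU] s0(1) min]) (use d\<delta> in \<open>simp add: d_def\<close>)
    also have "\<dots> \<le> CS * (2 / c * Re z) powr \<beta>"
      using CS d0 dx \<beta> by (intro mult_left_mono powr_mono2) auto
    also have "\<dots> = C5 * Re z powr \<beta>"
      using c z powr_mult[of "2 / c" "Re z" \<beta>] by (simp add: C5_def)
    finally show "norm (schwarz_zbar (H z)) \<le> C5 * Re z powr \<beta>" .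
    have "norm (schwarz (H z) - cnj (H z)) \<le> CS * d"
      unfolding d_def by (rule S_le[OF Hr[OF zU] s0(1) min]) (use d\<delta> in \<open>simp add: d_def\<close>)
    also have "\<dots> \<le> CS * (2 / c * Re z)" using CS dx by (intro mult_left_mono) auto
    finally show "norm (schwarz (H z) - cnj (H z)) \<le> C6 * Re z" by (simp add: C6_def)
    have "norm w \<le> M" using w(1) by (intro M) (auto simp: frontier_def)
    then show "norm (H z) \<le> R"
      using norm_triangle_ineq2[of "H z" w] d\<delta>(3) s0(2) by (simp add: R_def d_def norm_minus_commute)
  qed
  have cC: "continuous_on Y (\<lambda>t. Complex x t)" for x Y
    unfolding Complex_eq by (intro continuous_intros)
  have cH: "continuous_on U H" and cdH: "continuous_on U (deriv H)"
    by (intro holomorphic_on_imp_continuous_on hol holomorphic_deriv U)+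
  define J where "J = (\<lambda>x. integral {0..2 * pi} (\<lambda>t. (norm (deriv H (Complex x t)))\<^sup>2))"
  have J_int: "J integrable_on {x2..x0}" "integral {x2..x0} J \<le> 4 * R\<^sup>2" if x2: "0 < x2" for x2
    unfolding J_def H_def
  proof -
    have "norm (\<Psi> (exp z)) \<le> R" if "x2 < Re z" "Re z < x0" for z
      using near(3)[of z] that x2 x0 by (simp add: H_def)
    note d = dirichlet_integral_exp_le[OF inv(1,2) _ R this]
    show "(\<lambda>x. integral {0..2 * pi} (\<lambda>t. (norm (deriv (\<lambda>z. \<Psi> (exp z)) (Complex x t)))\<^sup>2)) integrable_on {x2..x0}"
      "integral {x2..x0} (\<lambda>x. integral {0..2 * pi} (\<lambda>t. (norm (deriv (\<lambda>z. \<Psi> (exp z)) (Complex x t)))\<^sup>2)) \<le> 4 * R\<^sup>2"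
      using x2 by (intro d; simp)+
  qed
  define K where "K = (2 * \<beta> + 1) powr (2 * \<beta>)"
  define K' where "K' = (\<beta> + 1/2 + 1) powr (\<beta> + 1/2)"
  have K: "K \<ge> 0" "K' \<ge> 0" by (simp_all add: K_def K'_def)
  \<comment> \<open>The first summand bounds the change of the coefficient between the lines x2 and
    x0, the second its value on x0.\<close>
  define C7 where "C7 = C5 * (2 * pi * K + 4 * R\<^sup>2) + 2 * pi * (R + C6) * (K' / x0 powr (\<beta> + 1/2))"
  have C7: "C7 \<ge> 0" using C56 K R x0 by (simp add: C7_def)
  have main: "norm (b n) \<le> C7 / (2 * pi) * (1 / real n powr (real p + \<alpha> + 1 / 2))"
    if b: "exterior_inverse_coeffs G \<Phi> \<gamma> b" and n: "n \<ge> 1" for b n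
  proof -
    \<comment> \<open>The target rate, also used as the weight that balances the two terms of the
      arithmetic-geometric mean inequality below.\<close>
    define \<nu> where "\<nu> = real n powr (- (\<beta> + 1/2))"
    have \<nu>: "\<nu> > 0" using n by (simp add: \<nu>_def)
    have n0: "real n > 0" using n by simp
    define E where "E = (\<lambda>z::complex. exp (- of_nat n * z))"
    have normE: "norm (E z) = exp (- real n * Re z)" for z by (simp add: E_def)
    have cE: "continuous_on Y E" for Y unfolding E_def by (intro continuous_intros)
    let ?W = "\<lambda>x t. cnj (H (Complex x t)) * E (Complex x t)"
    define V where "V = (\<lambda>z. schwarz (H z) * E z)"
    define a where "a = (\<lambda>z. schwarz_z (H z) * deriv H z * E z - of_nat n * schwarz (H z) * E z)"
    define v where "v = (\<lambda>z. schwarz_zbar (H z) * cnj (deriv H z) * E z)"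
    define I where "I = (\<lambda>x. integral {0..2 * pi} (\<lambda>t. V (Complex x t)))"
    have strip: "{z. 0 < Re z \<and> Re z < x1} \<subseteq> U" by (auto simp: U_def)
    have cS: "continuous_on U (\<lambda>z. schwarz (H z))" "continuous_on U (\<lambda>z. schwarz_z (H z))" "continuous_on U (\<lambda>z. schwarz_zbar (H z))"
      by (rule continuous_on_compose2[OF schwarz_continuous(3) cH] continuous_on_compose2[OF schwarz_continuous(1) cH]
            continuous_on_compose2[OF schwarz_continuous(2) cH]; use Hr in auto)+
    have ca: "continuous_on U a" and cv: "continuous_on U v" and cV: "continuous_on U V"
      unfolding a_def v_def V_def by (intro continuous_intros cS cdH cE)+
    have dI: "(I has_vector_derivative 2 * integral {0..2 * pi} (\<lambda>t. v (Complex x t))) (at x)"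
      if x: "0 < x" "x < x1" for x
      unfolding I_def
    proof (rule periodic_mean_has_vector_derivative[OF _ continuous_on_subset[OF ca strip] continuous_on_subset[OF cv strip] _ _ x])
      fix z assume "0 < Re z" "Re z < x1"
      then have zU: "z \<in> U" by (simp add: U_def)
      have dH: "(H has_derivative (\<lambda>h. deriv H z * h)) (at z)"
        using holomorphic_derivI[OF hol U zU] by (simp add: has_field_derivative_def)
      have dE: "(E has_derivative (\<lambda>h. (- of_nat n * E z) * h)) (at z)"
      proof -
        have "(E has_field_derivative - of_nat n * E z) (at z)"
          unfolding E_def by (auto intro!: derivative_eq_intros)
        then show ?thesis unfolding has_field_derivative_def by (rule has_derivative_eq_rhs) auto
      qed
      have "((\<lambda>z. schwarz (H z)) has_derivative (\<lambda>h. schwarz_z (H z) * (deriv H z * h) + schwarz_zbar (H z) * cnj (deriv H z * h))) (at z)"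
        using has_derivative_compose[OF dH schwarz_derivative[OF Hr[OF zU]]] by simp
      from has_derivative_mult[OF this dE]
      show "(V has_derivative (\<lambda>h. a z * h + v z * cnj h)) (at z)"
        unfolding V_def by (rule has_derivative_eq_rhs) (auto simp: a_def v_def algebra_simps)
    next
      show "V (Complex x (2 * pi)) = V (Complex x 0)" for x
      proof -
        have "E (Complex x (2 * pi)) = E (Complex x 0)"
          unfolding E_def mult_minus_left exp_minus exp_of_nat_Complex_2pi ..
        then show ?thesis unfolding V_def H_def exp_Complex_2pi by simp
      qed
    qed auto
    define D where "D = (\<lambda>x. C5 * (2 * pi * K * real n * \<nu> * exp (- real n * x) + \<nu> * J x))"
    have vD: "norm (2 * integral {0..2 * pi} (\<lambda>t. v (Complex x t))) \<le> D x" if x: "0 < x" "x < x1" for x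
    proof -
      have sub: "(\<lambda>t. Complex x t) ` Y \<subseteq> U" for Y using x by (auto simp: U_def)
      have iH: "(\<lambda>t. (norm (deriv H (Complex x t)))\<^sup>2) integrable_on {0..2 * pi}"
        by (intro integrable_continuous_real continuous_intros continuous_on_compose2[OF cdH cC sub])
      have pw: "norm (2 * v (Complex x t)) \<le> C5 * (K * real n * \<nu> * exp (- real n * x)) + C5 * \<nu> * (norm (deriv H (Complex x t)))\<^sup>2" for t
      proof -
        define h where "h = norm (deriv H (Complex x t))"
        define y where "y = x powr \<beta> * exp (- real n * x)"
        have "norm (v (Complex x t)) = norm (schwarz_zbar (H (Complex x t))) * h * exp (- real n * x)"
          by (simp add: v_def norm_mult normE h_def)
        also have "\<dots> \<le> (C5 * x powr \<beta>) * h * exp (- real n * x)"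
          using near(1)[of "Complex x t"] x by (intro mult_right_mono) (auto simp: h_def)
        finally have 1: "norm (2 * v (Complex x t)) \<le> C5 * (2 * y * h)"
          by (simp add: norm_mult y_def algebra_simps)
        have "0 \<le> (y / \<nu> - h)\<^sup>2 * \<nu>" using \<nu> by simp
        also have "(y / \<nu> - h)\<^sup>2 * \<nu> = y\<^sup>2 / \<nu> - 2 * y * h + \<nu> * h\<^sup>2"
          using \<nu> by (simp add: power2_eq_square field_simps)
        finally have 2: "2 * y * h \<le> y\<^sup>2 / \<nu> + \<nu> * h\<^sup>2" by simp
        \<comment> \<open>One of the two factors exp (- n x) in y^2 absorbs x^(2 \<beta>), giving K
          n^(- 2 \<beta>) = K n \<nu>^2. The other is kept: its integral over x is at most 1 / n,
          which cancels the n.\<close>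
        have "y\<^sup>2 / \<nu> \<le> K * real n * \<nu> * exp (- real n * x)"
        proof -
          have "(real n * x) powr (2 * \<beta>) * exp (- (real n * x)) \<le> K"
            unfolding K_def using \<beta> x n0 by (intro powr_exp_bound) auto
          then have k: "real n powr (2 * \<beta>) * x powr (2 * \<beta>) * exp (- (real n * x)) \<le> K"
            using x n0 by (simp add: powr_mult)
          have \<nu>2: "real n powr (2 * \<beta>) = 1 / (real n * \<nu>\<^sup>2)"
          proof -
            have "real n powr (2 * \<beta>) * (real n powr 1 * (real n powr (- (\<beta> + 1/2)) * real n powr (- (\<beta> + 1/2)))) = 1"
              unfolding powr_add[symmetric] using n0 by simp
            then show ?thesis using n0 \<nu> unfolding \<nu>_def by (simp add: field_simps power2_eq_square)
          qed
          have "y\<^sup>2 = x powr (2 * \<beta>) * exp (- (real n * x)) * exp (- real n * x)"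
            using powr_add[of x \<beta> \<beta>] by (simp add: y_def power2_eq_square mult_ac)
          also have "x powr (2 * \<beta>) * exp (- (real n * x)) \<le> K * (real n * \<nu>\<^sup>2)"
            using k n0 \<nu> unfolding \<nu>2 by (simp add: field_simps)
          finally have "y\<^sup>2 \<le> K * (real n * \<nu>\<^sup>2) * exp (- real n * x)" by (simp add: mult_right_mono)
          then show ?thesis using \<nu> by (simp add: field_simps power2_eq_square)
        qed
        with 2 have "2 * y * h \<le> K * real n * \<nu> * exp (- real n * x) + \<nu> * h\<^sup>2" by linarith
        then have "C5 * (2 * y * h) \<le> C5 * (K * real n * \<nu> * exp (- real n * x) + \<nu> * h\<^sup>2)"
          using C56 by (intro mult_left_mono) auto
        with 1 show ?thesis by (simp add: h_def algebra_simps)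
      qed
      have "norm (integral {0..2 * pi} (\<lambda>t. 2 * v (Complex x t))) \<le>
         integral {0..2 * pi} (\<lambda>t. C5 * (K * real n * \<nu> * exp (- real n * x)) + C5 * \<nu> * (norm (deriv H (Complex x t)))\<^sup>2)"
        by (intro integral_norm_bound_integral pw integrable_add integrable_const_ivl integrable_on_mult_right iH
              integrable_continuous_real continuous_intros continuous_on_compose2[OF cv cC sub])
      also have "\<dots> = D x"
        by (subst integral_add[OF integrable_const_ivl integrable_on_mult_right[OF iH]])
           (simp add: D_def J_def algebra_simps)
      finally show ?thesis by simp
    qed
    have step: "norm (I x0 - I x2) \<le> C5 * (2 * pi * K + 4 * R\<^sup>2) * \<nu>" if x2: "0 < x2" "x2 < x0" for x2
    proof -
      have f: "((\<lambda>x. 2 * integral {0..2 * pi} (\<lambda>t. v (Complex x t))) has_integral (I x0 - I x2)) {x2..x0}"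
        by (rule fundamental_theorem_of_calculus)
           (use x2 x0 dI in \<open>auto intro: has_vector_derivative_at_within\<close>)
      have ee: "((\<lambda>x. exp (- real n * x)) has_integral (- exp (- real n * x0) / real n - - exp (- real n * x2) / real n)) {x2..x0}"
      proof (rule fundamental_theorem_of_calculus)
        fix x
        have "((\<lambda>x. - exp (- real n * x) / real n) has_real_derivative exp (- real n * x)) (at x within {x2..x0})"
          using n0 by (auto intro!: derivative_eq_intros)
        then show "((\<lambda>x. - exp (- real n * x) / real n) has_vector_derivative exp (- real n * x)) (at x within {x2..x0})"
          by (simp add: has_real_derivative_iff_has_vector_derivative)
      qed (use x2 in simp)
      have ie: "(\<lambda>x. exp (- real n * x)) integrable_on {x2..x0}" using ee by blast
      have "exp (- real n * x2) \<le> 1" using x2 n0 by simp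
      then have "exp (- real n * x2) - exp (- real n * x0) \<le> 1"
        using exp_gt_zero[of "- real n * x0"] by linarith
      from divide_right_mono[OF this, of "real n"]
      have "integral {x2..x0} (\<lambda>x. exp (- real n * x)) \<le> 1 / real n"
        unfolding integral_unique[OF ee] by (simp add: diff_divide_distrib)
      then have le: "(2 * pi * K * real n * \<nu>) * integral {x2..x0} (\<lambda>x. exp (- real n * x)) \<le> (2 * pi * K * real n * \<nu>) * (1 / real n)"
        using K n0 \<nu> by (intro mult_left_mono) auto
      have "norm (I x0 - I x2) \<le> integral {x2..x0} D"
        unfolding integral_unique[OF f, symmetric]
      proof (rule integral_norm_bound_integral)
        show "D integrable_on {x2..x0}"
          unfolding D_def by (intro integrable_on_mult_right integrable_add ie J_int x2(1))
      qed (use f vD x2 x0 in auto)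
      also have "\<dots> = C5 * ((2 * pi * K * real n * \<nu>) * integral {x2..x0} (\<lambda>x. exp (- real n * x)) + \<nu> * integral {x2..x0} J)"
        unfolding D_def using ie J_int(1)[OF x2(1)]
        by (simp only: integral_mult_right integral_add integrable_on_mult_right)
      also have "\<dots> \<le> C5 * ((2 * pi * K * real n * \<nu>) * (1 / real n) + \<nu> * (4 * R\<^sup>2))"
        using C56 \<nu> by (intro mult_left_mono add_mono le J_int x2(1)) auto
      also have "\<dots> = C5 * (2 * pi * K + 4 * R\<^sup>2) * \<nu>" using n0 by (simp add: field_simps)
      finally show ?thesis .
    qed
    have ix: "(\<lambda>t. V (Complex x t)) integrable_on {0..2 * pi}" "?W x integrable_on {0..2 * pi}"
      if "0 < x" for x
      by (intro integrable_continuous_real continuous_intros continuous_on_compose2[OF cV cC]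
            continuous_on_compose2[OF cH cC] continuous_on_compose2[OF cE[of UNIV] cC]; use that in \<open>auto simp: U_def\<close>)+
    have top: "norm (I x0) \<le> 2 * pi * (R + C6) * (K' / x0 powr (\<beta> + 1/2)) * \<nu>"
    proof -
      have "norm (V (Complex x0 t)) \<le> (R + C6) * exp (- real n * x0)" for t
      proof -
        have "norm (schwarz (H (Complex x0 t))) \<le> norm (schwarz (H (Complex x0 t)) - cnj (H (Complex x0 t))) + norm (H (Complex x0 t))"
          using norm_triangle_sub[of "schwarz (H (Complex x0 t))" "cnj (H (Complex x0 t))"] by simp
        also have "\<dots> \<le> C6 * x0 + R" using near(2,3)[of "Complex x0 t"] x0 by (intro add_mono) auto
        also have "\<dots> \<le> R + C6" using mult_left_le[of x0 C6] C56 x0 by simp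
        finally show ?thesis unfolding V_def norm_mult normE complex.sel by (rule mult_right_mono) simp
      qed
      then have "norm (I x0) \<le> integral {0..2 * pi} (\<lambda>t. (R + C6) * exp (- real n * x0))"
        unfolding I_def by (intro integral_norm_bound_integral ix x0 integrable_const_ivl)
      also have "\<dots> = 2 * pi * (R + C6) * exp (- (real n * x0))" by simp
      \<comment> \<open>Exponential decay on the fixed line x0 beats the required power of
        n.\<close>
      also have "exp (- (real n * x0)) \<le> K' / x0 powr (\<beta> + 1/2) * \<nu>"
      proof -
        have "(real n * x0) powr (\<beta> + 1/2) * exp (- (real n * x0)) \<le> K'"
          unfolding K'_def using \<beta> x0 n0 by (intro powr_exp_bound) auto
        then show ?thesis using x0 n0 unfolding \<nu>_def by (simp add: powr_mult powr_minus field_simps)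
      qed
      finally show ?thesis using R C56 by (simp add: mult_left_mono mult.assoc)
    qed
    \<comment> \<open>Replacing \<open>schwarz\<close> by conjugation costs O(x) on the line Re z =
      x, and conjugation recovers the Laurent coefficient exactly, up to exp (- 2 n x). Both defects
      disappear as x tends to 0.\<close>
    have bot: "2 * pi * norm (b n) * exp (- (2 * real n * x)) \<le> norm (I x) + 2 * pi * C6 * x" if x: "0 < x" "x < x1" for x
    proof -
      have "integral {0..2 * pi} (?W x) = of_real (exp (- (2 * real n * x))) * cnj (2 * pi * b n)"
      proof -
        have "cnj (H (Complex x t)) * E (Complex x t) = of_real (exp (- (2 * real n * x))) * cnj (H (Complex x t) * exp (of_nat n * Complex x t))" for t
        proof -
          have "E (Complex x t) = of_real (exp (- (2 * real n * x))) * cnj (exp (of_nat n * Complex x t))"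
            unfolding E_def exp_cnj exp_of_real[symmetric] exp_add[symmetric]
            by (rule arg_cong[of _ _ exp]) (simp add: complex_eq_iff)
          then show ?thesis by (simp add: mult_ac)
        qed
        then have "integral {0..2 * pi} (?W x)
            = of_real (exp (- (2 * real n * x))) * integral {0..2 * pi} (\<lambda>t. cnj (H (Complex x t) * exp (of_nat n * Complex x t)))"
          by (simp only: integral_mult_right)
        also have "integral {0..2 * pi} (\<lambda>t. cnj (H (Complex x t) * exp (of_nat n * Complex x t))) =
           cnj (integral {0..2 * pi} (\<lambda>t. H (Complex x t) * exp (of_nat n * Complex x t)))"
          by (rule integral_cnj[symmetric])
        also have "integral {0..2 * pi} (\<lambda>t. H (Complex x t) * exp (of_nat n * Complex x t)) = 2 * pi * b n"
          unfolding H_def using b x n laurent_coeff_integral[of \<Psi> 1 _ b x n]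
          by (simp add: exterior_inverse_coeffs_def \<Psi>_def)
        finally show ?thesis .
      qed
      then have "2 * pi * norm (b n) * exp (- (2 * real n * x)) = norm (integral {0..2 * pi} (?W x))"
        by (simp add: norm_mult)
      also have "\<dots> \<le> norm (I x) + norm (I x - integral {0..2 * pi} (?W x))"
        using norm_triangle_sub[of "integral {0..2 * pi} (?W x)" "I x"]
        unfolding norm_minus_commute[of "integral {0..2 * pi} (?W x)" "I x"] .
      also have "I x - integral {0..2 * pi} (?W x)
         = integral {0..2 * pi} (\<lambda>t. (schwarz (H (Complex x t)) - cnj (H (Complex x t))) * E (Complex x t))"
        using integral_diff[OF ix[OF x(1)]] by (simp only: I_def V_def left_diff_distrib)
      also have "norm \<dots> \<le> integral {0..2 * pi} (\<lambda>t. C6 * x)"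
      proof (rule integral_norm_bound_integral)
        show "(\<lambda>t. (schwarz (H (Complex x t)) - cnj (H (Complex x t))) * E (Complex x t)) integrable_on {0..2 * pi}"
          using integrable_diff[OF ix[OF x(1)]] by (simp add: V_def left_diff_distrib)
        fix t
        have "norm ((schwarz (H (Complex x t)) - cnj (H (Complex x t))) * E (Complex x t)) \<le> (C6 * x) * 1"
          unfolding norm_mult normE using near(2)[of "Complex x t"] x n0 C56 by (intro mult_mono) auto
        then show "norm ((schwarz (H (Complex x t)) - cnj (H (Complex x t))) * E (Complex x t)) \<le> C6 * x" by simp
      qed (rule integrable_const_ivl)
      finally show ?thesis by (simp add: mult_ac)
    qed
    have total: "2 * pi * norm (b n) * exp (- (2 * real n * x)) \<le> C7 * \<nu> + 2 * pi * C6 * x" if x: "0 < x" "x < x0" for x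
    proof -
      have "norm (I x) \<le> norm (I x0) + norm (I x0 - I x)"
        using norm_triangle_sub[of "I x" "I x0"] unfolding norm_minus_commute[of "I x" "I x0"] .
      also have "\<dots> \<le> C7 * \<nu>" using add_mono[OF top step[OF x]] by (simp only: C7_def distrib_right add.commute)
      finally have "norm (I x) \<le> C7 * \<nu>" .
      moreover have "x < x1" using x x0 by linarith
      ultimately show ?thesis using bot[OF x(1)] by linarith
    qed
    have "2 * pi * norm (b n) * exp (- (2 * real n * 0)) \<le> C7 * \<nu> + 2 * pi * C6 * 0"
    proof (rule tendsto_le[OF trivial_limit_at_right_real])
      show "((\<lambda>x. C7 * \<nu> + 2 * pi * C6 * x) \<longlongrightarrow> C7 * \<nu> + 2 * pi * C6 * 0) (at_right 0)"
        by (intro tendsto_intros)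
      show "((\<lambda>x. 2 * pi * norm (b n) * exp (- (2 * real n * x))) \<longlongrightarrow> 2 * pi * norm (b n) * exp (- (2 * real n * 0))) (at_right 0)"
        by (intro tendsto_intros)
      show "\<forall>\<^sub>F x in at_right 0. 2 * pi * norm (b n) * exp (- (2 * real n * x)) \<le> C7 * \<nu> + 2 * pi * C6 * x"
        using eventually_at_right_real[OF x0(1)] by eventually_elim (use total in auto)
    qed
    then have "2 * pi * norm (b n) \<le> C7 * \<nu>" by simp
    then have "norm (b n) * (2 * pi) \<le> C7 * \<nu>" by (simp add: mult.commute)
    then have "norm (b n) \<le> C7 * \<nu> / (2 * pi)"
      by (simp add: pos_le_divide_eq)
    then have "norm (b n) \<le> C7 / (2 * pi) * \<nu>" by simp
    also have "\<nu> = 1 / real n powr (real p + \<alpha> + 1 / 2)"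
      unfolding \<nu>_def \<beta>_def by (rule powr_minus_divide)
    finally show "norm (b n) \<le> C7 / (2 * pi) * (1 / real n powr (real p + \<alpha> + 1 / 2))" .
  qed
  show thesis
  proof (rule that[of "C7 / (2 * pi)"])
    show "0 \<le> C7 / (2 * pi)" using C7 by simp
    fix b n assume "exterior_inverse_coeffs G \<Phi> \<gamma> b" "n \<ge> (1::nat)"
    then show "norm (b n) \<le> C7 / (2 * pi) * (1 / real n powr (real p + \<alpha> + 1 / 2))" by (rule main[of b n])
  qed
qed

end

section \<open>Assembly: constants depending on the curve alone\<close>

lemma the_inv_into_cong:
  assumes "\<And>z. z \<in> A \<Longrightarrow> f z = h z"
  shows "the_inv_into A f = the_inv_into A h"
proof -
  have "(y \<in> A \<and> f y = x) = (y \<in> A \<and> h y = x)" for x y using assms by auto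
  then show ?thesis unfolding the_inv_into_def by simp
qed

text \<open>For p = 0 the exponent \<alpha> exceeds 1/2, and for p > 0 the function is Lipschitz.
  Lowering an exponent a to 1/2 on |s - t| <= L costs the factor L powr (a - 1/2).\<close>

lemma holder_class_sqrt:
  assumes f: "holder_class L \<alpha> p f" and L: "L > 0" and \<alpha>: "0 < \<alpha>" "\<alpha> < 1" and p: "real p + \<alpha> > 1 / 2"
  obtains M where "M \<ge> 1" "\<And>s t. \<bar>s - t\<bar> \<le> L \<Longrightarrow> norm (f s - f t) \<le> M * sqrt \<bar>s - t\<bar>"
proof -
  have "\<exists>B a. a \<ge> 1/2 \<and> (\<forall>s t. \<bar>s - t\<bar> \<le> L \<longrightarrow> norm (f s - f t) \<le> B * \<bar>s - t\<bar> powr a)"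
  proof (cases p)
    case 0
    then obtain M where "\<forall>s t. \<bar>s - t\<bar> \<le> L \<longrightarrow> norm (f s - f t) \<le> M * \<bar>s - t\<bar> powr \<alpha>"
      using f by auto
    then show ?thesis using p 0 by (intro exI[of _ M] exI[of _ \<alpha>]) simp
  next
    case (Suc k)
    then obtain f' where f': "\<And>s. (f has_vector_derivative f' s) (at s)" "holder_class L \<alpha> k f'" using f by auto
    obtain B where "B \<ge> 0" "\<And>s. norm (f' s) \<le> B" by (rule holder_class_bounded[OF f'(2) L \<alpha>(1)]) (rule that)
    then have "norm (f s - f t) \<le> B * \<bar>s - t\<bar> powr 1" for s t
      using has_vector_derivative_lipschitz[OF f'(1), of B s t] by simp
    then show ?thesis by (intro exI[of _ B] exI[of _ "1::real"]) simp
  qed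
  then obtain B a where a: "a \<ge> 1/2" and B: "\<And>s t. \<bar>s - t\<bar> \<le> L \<Longrightarrow> norm (f s - f t) \<le> B * \<bar>s - t\<bar> powr a" by blast
  define M where "M = max 1 (\<bar>B\<bar> * L powr (a - 1/2))"
  show thesis
  proof (rule that)
    show "M \<ge> 1" by (simp add: M_def)
    fix s t assume st: "\<bar>s - t\<bar> \<le> L"
    have "\<bar>s - t\<bar> powr a = \<bar>s - t\<bar> powr (a - 1/2) * \<bar>s - t\<bar> powr (1/2)"
      by (simp add: powr_add[symmetric])
    also have "\<dots> = \<bar>s - t\<bar> powr (a - 1/2) * sqrt \<bar>s - t\<bar>" by (simp add: powr_half_sqrt)
    also have "\<dots> \<le> L powr (a - 1/2) * sqrt \<bar>s - t\<bar>"
      using st a by (intro mult_right_mono powr_mono2) auto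
    finally have "\<bar>B\<bar> * \<bar>s - t\<bar> powr a \<le> \<bar>B\<bar> * (L powr (a - 1/2) * sqrt \<bar>s - t\<bar>)"
      by (rule mult_left_mono) simp
    also have "\<bar>B\<bar> * (L powr (a - 1/2) * sqrt \<bar>s - t\<bar>) \<le> M * sqrt \<bar>s - t\<bar>"
      unfolding mult.assoc[symmetric] by (rule mult_right_mono) (simp_all add: M_def)
    finally have "\<bar>B\<bar> * \<bar>s - t\<bar> powr a \<le> M * sqrt \<bar>s - t\<bar>" .
    moreover have "B * \<bar>s - t\<bar> powr a \<le> \<bar>B\<bar> * \<bar>s - t\<bar> powr a" by (rule mult_right_mono) auto
    ultimately show "norm (f s - f t) \<le> M * sqrt \<bar>s - t\<bar>" using B[OF st] by linarith
  qed
qed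

theorem corollary1p1:
  fixes G :: "complex set"
  assumes "open G" and "G \<noteq> {}" and "bounded G" and "simply_connected G"
    and "jordan_curve (frontier G)"
  shows
    "(analytic_jordan_curve (frontier G) \<longrightarrow>
       (\<exists>c10::real. c10 \<ge> 0 \<and>
         (\<forall>\<Phi> \<gamma> b \<rho>. exterior_map G \<Phi> \<gamma> \<and> exterior_inverse_coeffs G \<Phi> \<gamma> b
             \<and> \<rho> < 1 \<and> smallest_conformal_level G \<Phi> \<rho> \<longrightarrow>
           (\<forall>n::nat. n \<ge> 1 \<longrightarrow> norm (b n) \<le> c10 * (\<rho> ^ n / sqrt (real n))))))
     \<and>
     (\<forall>(p::nat) (\<alpha>::real). 0 < \<alpha> \<and> \<alpha> < 1 \<and> real p + \<alpha> > 1 / 2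
         \<and> curve_class (p + 1) \<alpha> (frontier G) \<longrightarrow>
       (\<exists>c11::real. c11 \<ge> 0 \<and>
         (\<forall>\<Phi> \<gamma> b. exterior_map G \<Phi> \<gamma> \<and> exterior_inverse_coeffs G \<Phi> \<gamma> b \<longrightarrow>
           (\<forall>n::nat. n \<ge> 1 \<longrightarrow>
              norm (b n) \<le> c11 * (1 / real n powr (real p + \<alpha> + 1 / 2))))))"
proof (intro conjI impI allI)
  obtain M where M: "\<And>z. z \<in> closure G \<Longrightarrow> norm z \<le> M"
    using bounded_closure[OF assms(3)] unfolding bounded_iff by blast
  obtain z0 where "z0 \<in> closure G" using assms(2) closure_subset by blast
  then have M0: "M \<ge> 0" using M[of z0] norm_ge_zero[of z0] by linarith
  let ?hyp = "\<lambda>\<Phi> \<gamma> b \<rho>. exterior_map G \<Phi> \<gamma> \<and> exterior_inverse_coeffs G \<Phi> \<gamma> b \<and> \<rho> < 1 \<and> smallest_conformal_level G \<Phi> \<rho>"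
  show "\<exists>c10\<ge>0. \<forall>\<Phi> \<gamma> b \<rho>. ?hyp \<Phi> \<gamma> b \<rho> \<longrightarrow> (\<forall>n\<ge>1. norm (b n) \<le> c10 * (\<rho> ^ n / sqrt (real n)))"
  \<comment> \<open>The constant is chosen before the map and the level. It is taken from one
    admissible choice, and uniqueness identifies the level \<rho> of every other; if there is none,
    the claim is vacuous.\<close>
  proof (cases "\<exists>\<Phi> \<gamma> b \<rho>. ?hyp \<Phi> \<gamma> b \<rho>")
    case True
    then obtain \<Phi>0 \<gamma>0 b0 \<rho>0 where 0: "exterior_map G \<Phi>0 \<gamma>0" "exterior_inverse_coeffs G \<Phi>0 \<gamma>0 b0" "\<rho>0 < 1"
      "smallest_conformal_level G \<Phi>0 \<rho>0" by blast
    let ?c = "sqrt (4 * M\<^sup>2 / (pi * (1 - \<rho>0\<^sup>2)))"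
    have "\<rho>0 \<ge> 0" using 0(4) by (simp add: smallest_conformal_level_def conformal_outside_level_def)
    then have "1 - \<rho>0\<^sup>2 > 0" using 0(3) by (simp add: abs_square_less_1)
    then have c: "?c \<ge> 0" by simp
    have bound: "norm (b n) \<le> ?c * (\<rho> ^ n / sqrt (real n))" if h: "?hyp \<Phi> \<gamma> b \<rho>" and n: "n \<ge> 1" for \<Phi> \<gamma> b \<rho> n
    proof -
      have "\<Phi>0 z = \<Phi> z" if "z \<in> - closure G" for z
        using exterior_map_unique(2)[OF 0(1,2) _ _ assms(3) that] h by blast
      then have "conformal_outside_level G \<Phi>0 r = conformal_outside_level G \<Phi> r" for r
        unfolding conformal_outside_level_def by simp
      then have "smallest_conformal_level G \<Phi>0 \<rho>"
        using h unfolding smallest_conformal_level_def by simp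
      with 0(4) have "\<rho> = \<rho>0"
        unfolding smallest_conformal_level_def by (intro order_antisym) simp_all
      moreover have "norm (b n) \<le> sqrt (4 * M\<^sup>2 / (pi * (1 - \<rho>\<^sup>2))) * (\<rho> ^ n / sqrt (real n))"
        using h M0 M n by (intro coeff_bound_conformal_outside_level) (auto simp: smallest_conformal_level_def)
      ultimately show ?thesis by simp
    qed
    show ?thesis
    proof (intro exI[of _ ?c] conjI allI impI)
      show "0 \<le> ?c" by (rule c)
    qed (rule bound)
  next
    case False
    then show ?thesis by (intro exI[of _ 0] conjI order_refl) blast
  qed
next
  fix p :: nat and \<alpha> :: real
  assume h: "0 < \<alpha> \<and> \<alpha> < 1 \<and> real p + \<alpha> > 1 / 2 \<and> curve_class (p + 1) \<alpha> (frontier G)"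
  then have \<alpha>: "0 < \<alpha>" "\<alpha> < 1" and p: "real p + \<alpha> > 1 / 2" and cc: "curve_class (p + 1) \<alpha> (frontier G)" by auto
  obtain g g1 L where L: "L > 0" and inj: "inj_on g {0..<L}" and im: "g ` {0..<L} = frontier G"
    and cg: "holder_class L \<alpha> (p + 1) g" and der: "\<And>s. (g has_vector_derivative g1 s) (at s)"
    and unit: "\<And>s. norm (g1 s) = 1" and cg1: "holder_class L \<alpha> (p + 1 - 1) g1"
    by (rule curve_class_imp_holder_class[OF cc \<alpha>]) (rule that)
  have cg1': "holder_class L \<alpha> p g1" using cg1 by simp
  obtain M where M: "M \<ge> 1" "\<And>s t. \<bar>s - t\<bar> \<le> L \<Longrightarrow> norm (g1 s - g1 t) \<le> M * sqrt \<bar>s - t\<bar>"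
    by (rule holder_class_sqrt[OF cg1' L \<alpha> p]) (rule that)
  interpret holder_curve g g1 L M \<alpha> p
    by unfold_locales (fact L holder_class_periodic[OF cg] inj der unit M \<alpha> cg cg1')+
  let ?hyp = "\<lambda>\<Phi> \<gamma> b. exterior_map G \<Phi> \<gamma> \<and> exterior_inverse_coeffs G \<Phi> \<gamma> b"
  show "\<exists>c11\<ge>0. \<forall>\<Phi> \<gamma> b. ?hyp \<Phi> \<gamma> b \<longrightarrow> (\<forall>n\<ge>1. norm (b n) \<le> c11 * (1 / real n powr (real p + \<alpha> + 1 / 2)))"
  proof (cases "\<exists>\<Phi> \<gamma> b. ?hyp \<Phi> \<gamma> b")
    case True
    then obtain \<Phi>0 \<gamma>0 b0 where 0: "exterior_map G \<Phi>0 \<gamma>0" "exterior_inverse_coeffs G \<Phi>0 \<gamma>0 b0" by blast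
    obtain C where C: "C \<ge> 0" "\<And>b n. exterior_inverse_coeffs G \<Phi>0 \<gamma>0 b \<Longrightarrow> n \<ge> 1 \<Longrightarrow>
        norm (b n) \<le> C * (1 / real n powr (real p + \<alpha> + 1 / 2))"
      by (rule coeff_bound_holder_curve[OF assms(1,2,3) im[symmetric] 0(1)]) (rule that)
    have "exterior_inverse_coeffs G \<Phi>0 \<gamma>0 b" if "?hyp \<Phi> \<gamma> b" for \<Phi> \<gamma> b
    proof -
      note u = exterior_map_unique[OF 0(1,2) conjunct1[OF that] conjunct2[OF that] assms(3)]
      have "the_inv_into (- closure G) \<Phi>0 = the_inv_into (- closure G) \<Phi>"
        by (rule the_inv_into_cong) (rule u(2))
      then show ?thesis using that u(1) by (simp add: exterior_inverse_coeffs_def)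
    qed
    then have bound: "norm (b n) \<le> C * (1 / real n powr (real p + \<alpha> + 1 / 2))" if "?hyp \<Phi> \<gamma> b" "n \<ge> 1" for \<Phi> \<gamma> b n
      using that by (intro C(2))
    show ?thesis
    proof (intro exI[of _ C] conjI allI impI)
      show "0 \<le> C" by (rule C(1))
    qed (rule bound)
  next
    case False
    then show ?thesis by (intro exI[of _ 0] conjI order_refl) blast
  qed
qed

end
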